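(* For all integers $p\ge 1$ and $d\ge 1$ there exist a constant $C_{d,p}>0$ and an integer $r_0=r_0(d,p)$ such that, for all $\mathbf a=(a_1,\dots,a_d)\in\mathbb R^d$, all $k>0$, all integers $r\ge r_0$ and all $f\in\mathcal W^{p,d}$, $$\bigl|\mathcal I^{k,d,\mathbf a}f-\mathcal I^{k,d,\mathbf a,r}f\bigr|\ \le\ C_{d,p}\Bigl(\prod_{j\in\{1,\dots,d\},\ k|a_j|\ge 1}k|a_j|\Bigr)^{-1}\bigl(\log^{d-1}N(r,d)\bigr)^{p}\Bigl(\frac1{N(r,d)}\Bigr)^{p-1}\|f\|_{\mathcal W^{p,d}},$$ where $N(r,d)$ is the number of point evaluations of $f$ used in the quadrature rule $\mathcal I^{k,d,\mathbf a,r}f$.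
   Context: **Integral.** For $k>0$, $\mathbf a\in\mathbb R^d$: $\mathcal I^{k,d,\mathbf a}f:=\int_{[-1,1]^d}f(\boldsymbol y)\exp(\mathrm i k\,\mathbf a\cdot\boldsymbol y)\,d\boldsymbol y$. **Function space.** $\mathcal W^{p,d}$ is the space of functions $f:[-1,1]^d\to\mathbb R$ such that $\partial^{|\mathbf s|}f/\partial\boldsymbol y^{\mathbf s}\in C([-1,1]^d)$ for all $\mathbf s\in\mathbb N_0^d$ with $|\mathbf s|_\infty=\max_i s_i\le p$, with norm $\|f\|_{\mathcal W^{p,d}}=\max_{|\mathbf s|_\infty\le p}\|\partial^{|\mathbf s|}f/\partial\boldsymbol y^{\mathbf s}\|_{\infty,[-1,1]^d}$. **Splitting of $\mathbf a$.** For $a\in\mathbb R$, $k>0$: $\tilde a=a$ if $k|a|\ge1$, $\tilde a=0$ otherwise, and $\hat a=a-\tilde a$. Applied componentwise this gives $\tilde{\mathbf a},\hat{\mathbf a}$. Set $\hat f(\boldsymbol y)=f(\boldsymbol y)\exp(\mathrm i k\,\hat{\mathbf a}\cdot\boldsymbol y)$. **1D grids and interpolation.** $n_\ell=2^{\ell-1}$ for $\ell\ge1$. The level-$1$ grid is $X^1=\{0\}$; for $\ell\ge2$ the level-$\ell$ grid is $X^\ell=\{\cos(j\pi/n_\ell):j=0,\dots,n_\ell\}$. $Q^1g$ is the constant $g(0)$; for $\ell\ge2$, $Q^\ell g$ is the polynomial of degree at most $n_\ell$ interpolating $g$ on $X^\ell$; $Q^0g=0$; $D^\ell=Q^\ell-Q^{\ell-1}$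 for $\ell\ge1$. **Smolyak interpolant.** For $r\in\mathbb N=\{1,2,\dots\}$, with $|\boldsymbol\ell|=\ell_1+\dots+\ell_d$, $$\mathcal Q^{r,d}g=\sum_{\boldsymbol\ell\in\mathbb N^d,\ |\boldsymbol\ell|\le r+d-1}(D^{\ell_1}\otimes\cdots\otimes D^{\ell_d})g,$$ where $D^{\ell_j}$ acts in the variable $y_j$. **FCCS rule.** $\mathcal I^{k,d,\mathbf a,r}f:=\int_{[-1,1]^d}(\mathcal Q^{r,d}\hat f)(\boldsymbol y)\exp(\mathrm i k\,\tilde{\mathbf a}\cdot\boldsymbol y)\,d\boldsymbol y$. It uses the values of $f$ at the points of the sparse grid $\bigcup_{\boldsymbol\ell\in\mathbb N^d,\,|\boldsymbol\ell|\le r+d-1}X^{\ell_1}\times\cdots\times X^{\ell_d}$, and $N(r,d)$ is the cardinality of this set. **Conventions.** $\log^{d-1}N=(\log N)^{d-1}$ (equal to $1$ if $d=1$); an empty product equals $1$. *)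

theory Defs
  imports "HOL-Analysis.Analysis" "HOL-Computational_Algebra.Polynomial"
begin

text \<open>The dimension \<open>d\<close> is a natural number. A point of \<open>\<real>\<^sup>d\<close> is a function on
  \<open>{..<d}\<close>, the coordinates being numbered from \<open>0\<close>; points of the cube are extensional, so that
  \<open>cube d\<close> is homeomorphic to the usual \<open>[-1,1]\<^sup>d\<close> and is a subset of the space of the
  product measure \<open>\<Pi>\<^sub>M j\<in>{..<d}. lborel\<close>.\<close>

definition cube :: "nat \<Rightarrow> (nat \<Rightarrow> real) set" where
  "cube d = {..<d} \<rightarrow>\<^sub>E {-1..1}"


subsection \<open>The space of functions with continuous mixed derivatives\<close>

definition multi_indices :: "nat \<Rightarrow> nat \<Rightarrow> (nat \<Rightarrow> nat) set" where
  "multi_indices p d = {..<d} \<rightarrow>\<^sub>E {..p}"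

text \<open>On the faces of the cube the derivative is one-sided.\<close>

definition partial_deriv ::
    "nat \<Rightarrow> ((nat \<Rightarrow> real) \<Rightarrow> real) \<Rightarrow> (nat \<Rightarrow> real) \<Rightarrow> real" where
  "partial_deriv i f y = vector_derivative (\<lambda>t. f (y(i := t))) (at (y i) within {-1..1})"

text \<open>The differentiation in the last variable is carried out first.\<close>

definition mixed_deriv ::
    "nat \<Rightarrow> (nat \<Rightarrow> nat) \<Rightarrow> ((nat \<Rightarrow> real) \<Rightarrow> real) \<Rightarrow> (nat \<Rightarrow> real) \<Rightarrow> real" where
  "mixed_deriv d s f = foldr (\<lambda>i. partial_deriv i ^^ s i) [0..<d] f"

text \<open>The second condition says that every one-variable differentiation which occurs in the
  construction of the derivatives \<open>mixed_deriv d s f\<close> is legitimate: if \<open>s\<close> vanishes before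
  \<open>i\<close>, then the next step in the variable \<open>i\<close> differentiates \<open>mixed_deriv d s f\<close>. Since all
  these derivatives are continuous, the order of differentiation is immaterial.\<close>

definition W_space :: "nat \<Rightarrow> nat \<Rightarrow> ((nat \<Rightarrow> real) \<Rightarrow> real) set" where
  "W_space p d = {f. \<forall>s\<in>multi_indices p d.
      continuous_on (cube d) (mixed_deriv d s f) \<and>
      (\<forall>i<d. s i < p \<longrightarrow> (\<forall>j<i. s j = 0) \<longrightarrow>
        (\<forall>y\<in>cube d. (\<lambda>t. mixed_deriv d s f (y(i := t))) differentiable (at (y i) within {-1..1})))}"

definition W_norm :: "nat \<Rightarrow> nat \<Rightarrow> ((nat \<Rightarrow> real) \<Rightarrow> real) \<Rightarrow> real" where
  "W_norm p d f = Max ((\<lambda>s. SUP y\<in>cube d. \<bar>mixed_deriv d s f y\<bar>) ` multi_indices p d)"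


subsection \<open>The oscillatory integral and the splitting of the frequency vector\<close>

definition phase :: "real \<Rightarrow> nat \<Rightarrow> (nat \<Rightarrow> real) \<Rightarrow> (nat \<Rightarrow> real) \<Rightarrow> complex" where
  "phase k d a y = exp (\<i> * complex_of_real (k * (\<Sum>j<d. a j * y j)))"

definition osc_integral ::
    "real \<Rightarrow> nat \<Rightarrow> (nat \<Rightarrow> real) \<Rightarrow> ((nat \<Rightarrow> real) \<Rightarrow> complex) \<Rightarrow> complex" where
  "osc_integral k d a g =
     (LINT y:cube d|(\<Pi>\<^sub>M j\<in>{..<d}. lborel). g y * phase k d a y)"

definition a_tilde :: "real \<Rightarrow> (nat \<Rightarrow> real) \<Rightarrow> nat \<Rightarrow> real" where
  "a_tilde k a j = (if k * \<bar>a j\<bar> \<ge> 1 then a j else 0)"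

definition a_hat :: "real \<Rightarrow> (nat \<Rightarrow> real) \<Rightarrow> nat \<Rightarrow> real" where
  "a_hat k a j = a j - a_tilde k a j"

definition f_hat ::
    "real \<Rightarrow> nat \<Rightarrow> (nat \<Rightarrow> real) \<Rightarrow> ((nat \<Rightarrow> real) \<Rightarrow> real) \<Rightarrow> (nat \<Rightarrow> real) \<Rightarrow> complex" where
  "f_hat k d a f y = complex_of_real (f y) * phase k d (a_hat k a) y"


subsection \<open>Interpolation in one variable\<close>

definition n_lev :: "nat \<Rightarrow> nat" where
  "n_lev l = 2 ^ (l - 1)"

definition grid :: "nat \<Rightarrow> real set" where
  "grid l = (if l = 1 then {0} else (\<lambda>j. cos (real j * pi / real (n_lev l))) ` {0..n_lev l})"

definition Q1 :: "nat \<Rightarrow> (real \<Rightarrow> complex) \<Rightarrow> real \<Rightarrow> complex" where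
  "Q1 l g t =
     (if l = 0 then 0
      else if l = 1 then g 0
      else poly (THE P. degree P \<le> n_lev l \<and>
                        (\<forall>x\<in>grid l. poly P (complex_of_real x) = g x)) (complex_of_real t))"

definition D1 :: "nat \<Rightarrow> (real \<Rightarrow> complex) \<Rightarrow> real \<Rightarrow> complex" where
  "D1 l g t = Q1 l g t - Q1 (l - 1) g t"


subsection \<open>The Smolyak interpolant and the FCCS rule\<close>

definition in_variable ::
    "nat \<Rightarrow> ((real \<Rightarrow> complex) \<Rightarrow> real \<Rightarrow> complex) \<Rightarrow>
     ((nat \<Rightarrow> real) \<Rightarrow> complex) \<Rightarrow> (nat \<Rightarrow> real) \<Rightarrow> complex" where
  "in_variable j T g y = T (\<lambda>t. g (y(j := t))) (y j)"

definition tensor_D ::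
    "nat \<Rightarrow> (nat \<Rightarrow> nat) \<Rightarrow> ((nat \<Rightarrow> real) \<Rightarrow> complex) \<Rightarrow> (nat \<Rightarrow> real) \<Rightarrow> complex" where
  "tensor_D d l g = foldr (\<lambda>j. in_variable j (D1 (l j))) [0..<d] g"

definition levels :: "nat \<Rightarrow> nat \<Rightarrow> (nat \<Rightarrow> nat) set" where
  "levels r d = {l \<in> {..<d} \<rightarrow>\<^sub>E {1..}. (\<Sum>j<d. l j) \<le> r + d - 1}"

definition smolyak ::
    "nat \<Rightarrow> nat \<Rightarrow> ((nat \<Rightarrow> real) \<Rightarrow> complex) \<Rightarrow> (nat \<Rightarrow> real) \<Rightarrow> complex" where
  "smolyak r d g y = (\<Sum>l\<in>levels r d. tensor_D d l g y)"

definition fccs_rule ::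
    "real \<Rightarrow> nat \<Rightarrow> (nat \<Rightarrow> real) \<Rightarrow> nat \<Rightarrow> ((nat \<Rightarrow> real) \<Rightarrow> real) \<Rightarrow> complex" where
  "fccs_rule k d a r f = osc_integral k d (a_tilde k a) (smolyak r d (f_hat k d a f))"

definition sparse_grid :: "nat \<Rightarrow> nat \<Rightarrow> (nat \<Rightarrow> real) set" where
  "sparse_grid r d = (\<Union>l\<in>levels r d. \<Pi>\<^sub>E j\<in>{..<d}. grid (l j))"

definition num_points :: "nat \<Rightarrow> nat \<Rightarrow> nat" where
  "num_points r d = card (sparse_grid r d)"

end

theory Submission
  imports Defs
begin

text \<open>
  In one variable, integration by parts extracts the factor \<open>1 / (k \<bar>a\<bar>)\<close> from the error functional
  and leaves the \<open>L\<^sup>1\<close> norm of the derivative of the interpolation error. After the substitution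
  \<open>x = cos t\<close> the interpolant is a cosine polynomial; comparing the continuous orthogonality
  relations of \<open>sin (k t)\<close> with the discrete ones at the midpoints of the grid shows that
  interpolation is stable in the energy norm \<open>\<integral> \<bar>d/dt u (cos t)\<bar>\<^sup>2 dt\<close>. Together with the Poincare
  inequality for functions vanishing on the grid, the same stability yields, by iteration on
  derivatives, a Jackson theorem in \<open>L\<^sup>2\<close>, and hence the rate \<open>2\<^bsup>-(p-1)l\<^esup>\<close> for level \<open>l\<close>.

  In several variables, let \<open>I(j)\<close>, \<open>Q(j,l)\<close> and \<open>D(j,l)\<close> be the exact, the level \<open>l\<close> and the level
  difference functional in the variable \<open>j\<close>. The error \<open>E(m,R)\<close> of the Smolyak rule in \<open>m\<close> variables
  with level sum at most \<open>R\<close> satisfies the finite recursion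
  \<open>E(m+1,R) = (\<Sum>l. D(0,l\<^sub>0) \<otimes> \<dots> \<otimes> D(m-1,l\<^sub>m\<^sub>-\<^sub>1) \<otimes> (I(m) - Q(m,R-|l|))) + E(m,R-1) \<otimes> I(m)\<close>
  over the \<open>l\<close> with \<open>|l| \<le> R - 1\<close>: at most \<open>R\<^sup>m\<close> terms, each of size \<open>2\<^bsup>-(p-1)R\<^esup>\<close>. No infinite tail is
  summed, so that \<open>p = 1\<close> is not exceptional. Finally \<open>2\<^bsup>r-1\<^esup> \<le> N \<le> 2\<^bsup>R+1\<^esup> R\<^bsup>d-1\<^esup>\<close> for \<open>R = r + d - 1\<close>.
\<close>

subsection \<open>Stability of trigonometric interpolation\<close>

text \<open>Estimating interpolation errors in the maximum norm would bring in the Lebesgue constant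
  of the grid, a logarithm at every level. The energy norm avoids it: there interpolation is stable
  with a constant independent of \<open>n\<close>, and since dx is sin t dt up to sign,
  Cauchy-Schwarz on [0, pi] bounds the L1 norm of an x-derivative by the energy norm. From level 2
  on the endpoints are nodes, so the interpolation error leaves no boundary terms in the integration
  by parts; the only loss is one derivative, whence the exponent p - 1. The components of k * a_hat
  are at most 1 in modulus. Multiplication by the corresponding wave therefore costs only a factor
  2^p, and its nodal values can be absorbed into the quadrature weights, so that all functionals act
  on f itself. The p-th power of the logarithm arises as 1 + (p - 1): one factor R^(d-1) counts the
  terms of the recursion, and replacing 2^(-R) by 2 R^(d-1) / N in 2^(-(p-1)R) brings p - 1
  more.\<close>

lemma sum_cos_midpoints:
  fixes n q :: nat
  assumes "0 < q" "q < 2 * n"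
  shows "(\<Sum>j<n. cos (real q * ((real j + 1/2) * pi / real n))) = 0"
proof -
  have n: "n > 0" using assms by auto
  \<comment> \<open>Multiplication by twice the sine of half the step makes the sum telescope;
    \<open>q < 2 * n\<close> keeps this sine positive.\<close>
  define s where "s = sin (real q * pi / (2 * real n))"
  have "real q * pi / (2 * real n) < pi"
    using assms n by (simp add: field_simps)
  then have s: "s > 0" unfolding s_def using assms n by (intro sin_gt_zero) auto
  have *: "2 * s * cos (real q * ((real j + 1/2) * pi / real n)) =
      sin (real q * real (Suc j) * pi / real n) - sin (real q * real j * pi / real n)" for j
  proof -
    have "real q * real (Suc j) * pi / real n = real q * ((real j + 1/2) * pi / real n) + real q * pi / (2 * real n)"
      using n by (simp add: field_simps)
    moreover have "real q * real j * pi / real n = real q * ((real j + 1/2) * pi / real n) - real q * pi / (2 * real n)"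
      using n by (simp add: field_simps)
    ultimately show ?thesis by (simp only: sin_add sin_diff s_def) simp
  qed
  have "2 * s * (\<Sum>j<n. cos (real q * ((real j + 1/2) * pi / real n))) =
      (\<Sum>j<n. sin (real q * real (Suc j) * pi / real n) - sin (real q * real j * pi / real n))"
    unfolding sum_distrib_left * ..
  also have "\<dots> = sin (real q * real n * pi / real n) - sin (real q * real 0 * pi / real n)"
    by (rule sum_lessThan_telescope)
  also have "\<dots> = 0" using n by simp
  finally show ?thesis using s by simp
qed

text \<open>The product formula leaves the frequencies \<open>m - k\<close> and
  \<open>k + m\<close>, which \<open>sum_cos_midpoints\<close> annihilates unless they are 0 or
  \<open>2 * n\<close>. The latter occurs only for \<open>k = m = n\<close>: aliasing then turns the
  cosine into -1 at every midpoint and doubles the norm of the highest mode.\<close>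

lemma sin_midpoints_orthogonal:
  fixes n k m :: nat
  assumes "k \<in> {1..n}" "m \<in> {1..n}"
  shows "(\<Sum>j<n. sin (real k * ((real j + 1/2) * pi / real n)) * sin (real m * ((real j + 1/2) * pi / real n)))
     = (if k = m then (if k = n then real n else real n / 2) else 0)" (is "?S k m = _")
  using assms
proof (induction k m rule: linorder_wlog)
  case (sym a b)
  then show ?case by (simp add: mult.commute)
next
  case (le k m)
  define \<phi> where "\<phi> j = (real j + 1/2) * pi / real n" for j
  have n: "n > 0" using le by auto
  have e: "?S k m = ((\<Sum>j<n. cos (real (m - k) * \<phi> j)) - (\<Sum>j<n. cos (real (k + m) * \<phi> j))) / 2"
    unfolding sum_subtractf[symmetric] sum_divide_distrib
  proof (rule sum.cong)
    fix j
    have c: "cos (real m * \<phi> j - real k * \<phi> j) = cos (real k * \<phi> j - real m * \<phi> j)"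
      using cos_minus[of "real m * \<phi> j - real k * \<phi> j"] by simp
    show "sin (real k * ((real j + 1/2) * pi / real n)) * sin (real m * ((real j + 1/2) * pi / real n))
      = (cos (real (m - k) * \<phi> j) - cos (real (k + m) * \<phi> j)) / 2"
      unfolding \<phi>_def[symmetric] sin_times_sin using le(1) by (simp add: of_nat_diff c algebra_simps)
  qed simp
  have z: "(\<Sum>j<n. cos (real q * \<phi> j)) = 0" if "0 < q" "q < 2 * n" for q
    using sum_cos_midpoints[OF that] unfolding \<phi>_def .
  have l: "(\<Sum>j<n. cos (real (n + n) * \<phi> j)) = - real n"
  proof -
    have "cos (real (n + n) * \<phi> j) = -1" for j
    proof -
      have "real (n + n) * \<phi> j = real j * (2 * pi) + pi"
        unfolding \<phi>_def using n by (simp add: field_simps)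
      moreover have "cos (real j * (2 * pi) + pi) = - cos (2 * real j * pi)"
        by (simp add: mult_ac)
      ultimately show ?thesis by (metis cos_2npi)
    qed
    then show ?thesis by simp
  qed
  show ?case
  proof (cases "k = m")
    case False
    then show ?thesis using e z[of "m - k"] z[of "k + m"] le by simp
  next
    case True
    then show ?thesis using e z[of "k + m"] le l by (cases "k = n") (auto simp: n)
  qed
qed

text \<open>An inequality and not an identity because the mode \<open>k = n\<close> has weight
  \<open>n\<close>, the others \<open>n / 2\<close>.\<close>

lemma sin_midpoints_bessel:
  fixes n :: nat and c :: "nat \<Rightarrow> real"
  shows "real n / 2 * (\<Sum>k\<in>{1..n}. (c k)\<^sup>2)
    \<le> (\<Sum>j<n. (\<Sum>k\<in>{1..n}. c k * sin (real k * ((real j + 1/2) * pi / real n)))\<^sup>2)"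
proof -
  let ?s = "\<lambda>k j. sin (real k * ((real j + 1/2) * pi / real n))"
  have "(\<Sum>j<n. (\<Sum>k\<in>{1..n}. c k * ?s k j)\<^sup>2)
      = (\<Sum>j<n. \<Sum>k\<in>{1..n}. \<Sum>m\<in>{1..n}. c k * c m * (?s k j * ?s m j))"
    by (simp add: power2_eq_square sum_product mult_ac)
  also have "\<dots> = (\<Sum>k\<in>{1..n}. \<Sum>m\<in>{1..n}. c k * c m * (\<Sum>j<n. ?s k j * ?s m j))"
    by (subst sum.swap, rule sum.cong, simp, subst sum.swap) (simp add: sum_distrib_left)
  also have "\<dots> = (\<Sum>k\<in>{1..n}. \<Sum>m\<in>{1..n}. if k = m then c k * c k * (if k = n then real n else real n / 2) else 0)"
    by (intro sum.cong refl) (subst sin_midpoints_orthogonal, auto)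
  also have "\<dots> = (\<Sum>k\<in>{1..n}. c k * c k * (if k = n then real n else real n / 2))"
    by (intro sum.cong refl) simp
  also have "\<dots> \<ge> (\<Sum>k\<in>{1..n}. real n / 2 * (c k)\<^sup>2)"
    by (intro sum_mono) (auto simp: power2_eq_square intro: mult_mono)
  finally show ?thesis by (simp add: sum_distrib_left)
qed

lemma has_integral_cos_int:
  "((\<lambda>t. cos (real_of_int q * t)) has_integral (if q = 0 then pi else 0)) {0..pi}"
proof (cases "q = 0")
  case True
  then show ?thesis using has_integral_const_real[of "1::real" 0 pi] by simp
next
  case False
  have "((\<lambda>t. cos (real_of_int q * t)) has_integral
     (sin (real_of_int q * pi) / real_of_int q - sin (real_of_int q * 0) / real_of_int q)) {0..pi}"
    by (rule fundamental_theorem_of_calculus)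
      (use False in \<open>auto simp: has_real_derivative_iff_has_vector_derivative[symmetric] intro!: derivative_eq_intros\<close>)
  moreover have "sin (real_of_int q * pi) = 0" by (simp add: sin_zero_iff_int2)
  ultimately show ?thesis using False by simp
qed

lemma has_integral_sin_sin:
  fixes k m :: nat
  assumes "k \<ge> 1" "m \<ge> 1"
  shows "((\<lambda>t. sin (real k * t) * sin (real m * t)) has_integral (if k = m then pi / 2 else 0)) {0..pi}"
proof -
  have "((\<lambda>t. (cos (real_of_int (int k - int m) * t) - cos (real_of_int (int k + int m) * t)) / 2) has_integral
     ((if int k - int m = 0 then pi else 0) - (if int k + int m = 0 then pi else 0)) / 2) {0..pi}"
    by (intro has_integral_divide has_integral_diff has_integral_cos_int)
  moreover have "(\<lambda>t. (cos (real_of_int (int k - int m) * t) - cos (real_of_int (int k + int m) * t)) / 2)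
     = (\<lambda>t. sin (real k * t) * sin (real m * t))"
    by (simp add: sin_times_sin algebra_simps)
  ultimately show ?thesis using assms by (cases "k = m") auto
qed

lemma has_integral_sine_polynomial_square:
  fixes c :: "nat \<Rightarrow> real"
  shows "((\<lambda>t. (\<Sum>k\<in>{1..n}. c k * sin (real k * t))\<^sup>2) has_integral (pi / 2 * (\<Sum>k\<in>{1..n}. (c k)\<^sup>2))) {0..pi}"
proof -
  have "((\<lambda>t. \<Sum>k\<in>{1..n}. \<Sum>m\<in>{1..n}. c k * c m * (sin (real k * t) * sin (real m * t))) has_integral
    (\<Sum>k\<in>{1..n}. \<Sum>m\<in>{1..n}. c k * c m * (if k = m then pi / 2 else 0))) {0..pi}"
    by (intro has_integral_sum has_integral_mult_right has_integral_sin_sin) auto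
  moreover have "(\<Sum>k\<in>{1..n}. \<Sum>m\<in>{1..n}. c k * c m * (if k = m then pi / 2 else 0)) = pi / 2 * (\<Sum>k\<in>{1..n}. (c k)\<^sup>2)"
  proof -
    have "(\<Sum>m\<in>{1..n}. c k * c m * (if k = m then pi / 2 else 0)) = pi / 2 * (c k)\<^sup>2" if "k \<in> {1..n}" for k
    proof -
      have "(\<Sum>m\<in>{1..n}. c k * c m * (if k = m then pi / 2 else 0)) = (\<Sum>m\<in>{1..n}. (if k = m then c k * c k * (pi / 2) else 0))"
        by (intro sum.cong) auto
      then show ?thesis using that by (simp add: power2_eq_square)
    qed
    then show ?thesis unfolding sum_distrib_left by (rule sum.cong[OF refl])
  qed
  moreover have "(\<Sum>k\<in>{1..n}. \<Sum>m\<in>{1..n}. c k * c m * (sin (real k * t) * sin (real m * t)))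
      = (\<Sum>k\<in>{1..n}. c k * sin (real k * t))\<^sup>2" for t
    by (simp add: power2_eq_square sum_product mult_ac)
  ultimately show ?thesis by (simp only:)
qed

text \<open>Jordan's inequality: the chord of the concave sine over [0, pi/2] lies below the
  graph.\<close>

lemma sin_ge_two_over_pi:
  assumes "0 \<le> x" "x \<le> pi / 2"
  shows "2 * x / pi \<le> sin x"
proof -
  have "concave_on {0..pi} sin"
    by (rule f''_le0_imp_concave[where f' = cos and f'' = "\<lambda>x. - sin x"])
       (auto intro!: derivative_eq_intros sin_ge_zero)
  then have "sin ((1 - u) *\<^sub>R 0 + u *\<^sub>R (pi / 2)) \<ge> (1 - u) * sin 0 + u * sin (pi / 2)" if "0 \<le> u" "u \<le> 1" for u :: real
    using concave_onD[of "{0..pi}" sin u 0 "pi/2"] that by auto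
  from this[of "2 * x / pi"] assms show ?thesis by (simp add: field_simps)
qed

text \<open>Cauchy-Schwarz against the constant 1, read off from the nonnegative integral of (f -
  c)^2 with \<open>c\<close> the mean of \<open>f\<close>.\<close>

lemma integral_square_le:
  fixes f :: "real \<Rightarrow> real"
  assumes "a \<le> b" "continuous_on {a..b} f"
  shows "(integral {a..b} f)\<^sup>2 \<le> (b - a) * integral {a..b} (\<lambda>x. (f x)\<^sup>2)"
proof (cases "a = b")
  case False
  define c where "c = integral {a..b} f / (b - a)"
  have ab: "b - a > 0" using assms False by simp
  have i: "f integrable_on {a..b}" "(\<lambda>x. (f x)\<^sup>2) integrable_on {a..b}"
    using assms(2) by (auto intro!: integrable_continuous_real continuous_intros)
  have "((\<lambda>x. (f x)\<^sup>2 - 2 * c * f x + c\<^sup>2) has_integral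
      (integral {a..b} (\<lambda>x. (f x)\<^sup>2) - 2 * c * integral {a..b} f + (b - a) * c\<^sup>2)) {a..b}"
    using i has_integral_const_real[of "c\<^sup>2" a b] assms(1)
    by (intro has_integral_add has_integral_diff has_integral_mult_right integrable_integral) auto
  then have "0 \<le> integral {a..b} (\<lambda>x. (f x)\<^sup>2) - 2 * c * integral {a..b} f + (b - a) * c\<^sup>2"
  proof (rule has_integral_nonneg)
    fix x
    have "(f x)\<^sup>2 - 2 * c * f x + c\<^sup>2 = (f x - c)\<^sup>2" by (simp add: power2_eq_square algebra_simps)
    then show "0 \<le> (f x)\<^sup>2 - 2 * c * f x + c\<^sup>2" by simp
  qed
  also have "\<dots> = integral {a..b} (\<lambda>x. (f x)\<^sup>2) - (integral {a..b} f)\<^sup>2 / (b - a)"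
  proof -
    have "(b - a) * c\<^sup>2 = c * integral {a..b} f" "(integral {a..b} f)\<^sup>2 / (b - a) = c * integral {a..b} f"
      unfolding c_def using ab by (simp_all add: power2_eq_square)
    then show ?thesis by simp
  qed
  finally show ?thesis using ab by (simp add: field_simps)
qed simp

lemma sum_integral_cells:
  fixes f :: "real \<Rightarrow> real" and n :: nat
  assumes "n > 0" "f integrable_on {0..pi}"
  shows "(\<Sum>j<n. integral {real j * pi / real n..real (Suc j) * pi / real n} f) = integral {0..pi} f"
proof -
  have "(\<Sum>j<m. integral {real j * pi / real n..real (Suc j) * pi / real n} f)
      = integral {0..real m * pi / real n} f" if "m \<le> n" for m
    using that
  proof (induction m)
    case (Suc m)
    have le: "real (Suc m) * pi / real n \<le> pi"
      using Suc.prems assms(1) by (simp add: field_simps del: of_nat_Suc)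
    have "integral {0..real m * pi / real n} f + integral {real m * pi / real n..real (Suc m) * pi / real n} f
      = integral {0..real (Suc m) * pi / real n} f"
      using assms le
      by (intro Henstock_Kurzweil_Integration.integral_combine integrable_on_subinterval[OF assms(2)])
         (auto simp: field_simps)
    then show ?case using Suc by simp
  qed simp
  from this[of n] show ?thesis using assms by simp
qed

lemma cell_subset:
  assumes "j < n"
  shows "{real j * pi / real n..real (Suc j) * pi / real n} \<subseteq> {0..pi}"
proof -
  have "real (Suc j) * pi / real n \<le> pi" using assms by (simp add: field_simps del: of_nat_Suc)
  then show ?thesis by (auto simp del: of_nat_Suc)
qed

lemma fundamental_theorem_cell:
  fixes G G' :: "real \<Rightarrow> real"
  assumes "\<And>t. t \<in> {0..pi} \<Longrightarrow> (G has_real_derivative G' t) (at t within {0..pi})"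
    and "{a..b} \<subseteq> {0..pi}" "a \<le> b"
  shows "integral {a..b} G' = G b - G a"
proof (intro integral_unique fundamental_theorem_of_calculus assms(3))
  fix x assume "x \<in> {a..b}"
  then have "(G has_real_derivative G' x) (at x within {a..b})"
    using assms(2) DERIV_subset[OF assms(1)] by blast
  then show "(G has_vector_derivative G' x) (at x within {a..b})"
    by (simp add: has_real_derivative_iff_has_vector_derivative)
qed

text \<open>Differences of \<open>G\<close> at adjacent grid points are sine sums at the midpoints
  with coefficients \<open>c k\<close>. The discrete Bessel inequality bounds the \<open>c k\<close>
  by these differences, Jordan's inequality recovers \<open>k * b k\<close> from \<open>c k\<close>
  at the price of \<open>n / 2\<close>, and each squared difference is at most \<open>pi / n\<close>
  times the energy of \<open>G\<close> on its cell. The powers of \<open>n\<close> cancel and leave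
  \<open>pi / 2\<close>; a second \<open>pi / 2\<close> comes from the continuous Parseval
  identity.\<close>

lemma trigonometric_interpolation_stable:
  fixes b :: "nat \<Rightarrow> real" and G G' :: "real \<Rightarrow> real"
  assumes n: "n > 0"
    and G: "\<And>t. t \<in> {0..pi} \<Longrightarrow> (G has_real_derivative G' t) (at t within {0..pi})"
    and G': "continuous_on {0..pi} G'"
    and T: "\<And>j. j \<le> n \<Longrightarrow> G (real j * pi / real n) = (\<Sum>k\<le>n. b k * cos (real k * (real j * pi / real n)))"
  shows "integral {0..pi} (\<lambda>t. (\<Sum>k\<in>{1..n}. real k * b k * sin (real k * t))\<^sup>2)
    \<le> pi\<^sup>2 / 4 * integral {0..pi} (\<lambda>t. (G' t)\<^sup>2)"
proof -
  let ?I = "integral {0..pi} (\<lambda>t. (G' t)\<^sup>2)"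
  define \<theta> where "\<theta> j = real j * pi / real n" for j
  define c where "c k = - 2 * b k * sin (real k * pi / (2 * real n))" for k
  have step: "\<theta> (Suc j) - \<theta> j = pi / real n" for j
    unfolding \<theta>_def by (simp add: add_divide_distrib algebra_simps)
  have diff: "G (\<theta> (Suc j)) - G (\<theta> j) = (\<Sum>k\<in>{1..n}. c k * sin (real k * ((real j + 1/2) * pi / real n)))"
    if "j < n" for j
  proof -
    have "G (\<theta> (Suc j)) - G (\<theta> j) = (\<Sum>k\<le>n. b k * (cos (real k * \<theta> (Suc j)) - cos (real k * \<theta> j)))"
      using T[of j] T[of "Suc j"] that unfolding \<theta>_def
      by (simp add: sum_subtractf right_diff_distrib del: of_nat_Suc)
    also have "\<dots> = (\<Sum>k\<le>n. c k * sin (real k * ((real j + 1/2) * pi / real n)))"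
    proof (rule sum.cong[OF refl])
      fix k
      have "(real k * \<theta> (Suc j) + real k * \<theta> j) / 2 = real k * ((real j + 1/2) * pi / real n)"
        unfolding \<theta>_def using n by (simp add: field_simps)
      moreover have "(real k * \<theta> j - real k * \<theta> (Suc j)) / 2 = - (real k * pi / (2 * real n))"
        unfolding \<theta>_def using n by (simp add: field_simps)
      ultimately show "b k * (cos (real k * \<theta> (Suc j)) - cos (real k * \<theta> j))
          = c k * sin (real k * ((real j + 1/2) * pi / real n))"
        unfolding c_def by (simp only: cos_diff_cos sin_minus) simp
    qed
    also have "\<dots> = (\<Sum>k\<in>{1..n}. c k * sin (real k * ((real j + 1/2) * pi / real n)))"
      by (intro sum.mono_neutral_right) (auto simp: not_le)
    finally show ?thesis .
  qed
  have "(\<Sum>k\<in>{1..n}. (real k * b k)\<^sup>2) = (real n)\<^sup>2 / 4 * (\<Sum>k\<in>{1..n}. 4 * (b k)\<^sup>2 * (real k / real n)\<^sup>2)"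
    unfolding sum_distrib_left using n by (intro sum.cong refl) (simp add: power2_eq_square field_simps)
  also have "\<dots> \<le> (real n)\<^sup>2 / 4 * (\<Sum>k\<in>{1..n}. (c k)\<^sup>2)"
  proof (intro mult_left_mono sum_mono)
    fix k assume k: "k \<in> {1..n}"
    have "real k / real n \<le> sin (real k * pi / (2 * real n))"
      using sin_ge_two_over_pi[of "real k * pi / (2 * real n)"] k n by (simp add: field_simps)
    then have "(real k / real n)\<^sup>2 \<le> (sin (real k * pi / (2 * real n)))\<^sup>2"
      by (intro power_mono) auto
    then show "4 * (b k)\<^sup>2 * (real k / real n)\<^sup>2 \<le> (c k)\<^sup>2"
      unfolding c_def power_mult_distrib by (intro mult_mono) auto
  qed simp
  also have "\<dots> = real n / 2 * (real n / 2 * (\<Sum>k\<in>{1..n}. (c k)\<^sup>2))" by (simp add: power2_eq_square)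
  also have "\<dots> \<le> real n / 2 * (\<Sum>j<n. (G (\<theta> (Suc j)) - G (\<theta> j))\<^sup>2)"
    using sin_midpoints_bessel[of n c] by (intro mult_left_mono) (auto simp: diff)
  also have "\<dots> \<le> real n / 2 * (\<Sum>j<n. pi / real n * integral {\<theta> j..\<theta> (Suc j)} (\<lambda>t. (G' t)\<^sup>2))"
  proof (intro mult_left_mono sum_mono)
    fix j assume "j \<in> {..<n}"
    then have sub: "{\<theta> j..\<theta> (Suc j)} \<subseteq> {0..pi}" using cell_subset unfolding \<theta>_def by blast
    have le: "\<theta> j \<le> \<theta> (Suc j)" by (metis step diff_ge_0_iff_ge divide_nonneg_nonneg pi_ge_zero of_nat_0_le_iff)
    show "(G (\<theta> (Suc j)) - G (\<theta> j))\<^sup>2 \<le> pi / real n * integral {\<theta> j..\<theta> (Suc j)} (\<lambda>t. (G' t)\<^sup>2)"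
      using integral_square_le[OF le continuous_on_subset[OF G' sub]] fundamental_theorem_cell[OF G sub le]
      by (simp add: step)
  qed simp
  also have "\<dots> = real n / 2 * (pi / real n * ?I)"
    unfolding sum_distrib_left[symmetric] \<theta>_def using G'
    by (subst sum_integral_cells[OF n]) (auto intro: integrable_continuous_real continuous_on_power)
  also have "\<dots> = pi / 2 * ?I" using n by simp
  finally have "(\<Sum>k\<in>{1..n}. (real k * b k)\<^sup>2) \<le> pi / 2 * ?I" .
  then have "pi / 2 * (\<Sum>k\<in>{1..n}. (real k * b k)\<^sup>2) \<le> pi / 2 * (pi / 2 * ?I)"
    by (intro mult_left_mono) auto
  also have "pi / 2 * (pi / 2 * ?I) = pi\<^sup>2 / 4 * ?I" by (simp add: power2_eq_square)
  finally show ?thesis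
    unfolding integral_unique[OF has_integral_sine_polynomial_square[of "\<lambda>k. real k * b k" n]] .
qed

text \<open>On each cell \<open>G\<close> starts from 0 at the left node, so Cauchy-Schwarz bounds
  (G t)^2 by the cell length times the energy on the cell. Integration over the cell supplies the
  second factor \<open>pi / n\<close>.\<close>

lemma grid_poincare:
  fixes G G' :: "real \<Rightarrow> real"
  assumes n: "n > 0"
    and G: "\<And>t. t \<in> {0..pi} \<Longrightarrow> (G has_real_derivative G' t) (at t within {0..pi})"
    and G': "continuous_on {0..pi} G'"
    and Z: "\<And>j. j \<le> n \<Longrightarrow> G (real j * pi / real n) = 0"
  shows "integral {0..pi} (\<lambda>t. (G t)\<^sup>2) \<le> (pi / real n)\<^sup>2 * integral {0..pi} (\<lambda>t. (G' t)\<^sup>2)"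
proof -
  define \<theta> where "\<theta> j = real j * pi / real n" for j
  have step: "\<theta> (Suc j) - \<theta> j = pi / real n" for j
    unfolding \<theta>_def by (simp add: add_divide_distrib algebra_simps)
  have le: "\<theta> j \<le> \<theta> (Suc j)" for j by (metis step diff_ge_0_iff_ge divide_nonneg_nonneg pi_ge_zero of_nat_0_le_iff)
  have contG: "continuous_on {0..pi} G"
    using G by (metis DERIV_continuous_on)
  have cell: "integral {\<theta> j..\<theta> (Suc j)} (\<lambda>t. (G t)\<^sup>2)
      \<le> (pi / real n)\<^sup>2 * integral {\<theta> j..\<theta> (Suc j)} (\<lambda>t. (G' t)\<^sup>2)" if "j < n" for j
  proof -
    let ?J = "integral {\<theta> j..\<theta> (Suc j)} (\<lambda>t. (G' t)\<^sup>2)"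
    have sub: "{\<theta> j..\<theta> (Suc j)} \<subseteq> {0..pi}" using cell_subset[OF that] unfolding \<theta>_def by blast
    have pt: "(G t)\<^sup>2 \<le> pi / real n * ?J" if t: "t \<in> {\<theta> j..\<theta> (Suc j)}" for t
    proof -
      have sub': "{\<theta> j..t} \<subseteq> {0..pi}" using sub t by auto
      have "(G t - G (\<theta> j))\<^sup>2 \<le> (t - \<theta> j) * integral {\<theta> j..t} (\<lambda>t. (G' t)\<^sup>2)"
        using integral_square_le[OF _ continuous_on_subset[OF G' sub']] t
          fundamental_theorem_cell[OF G sub'] by auto
      also have "\<dots> \<le> pi / real n * ?J"
      proof (intro mult_mono)
        show "integral {\<theta> j..t} (\<lambda>t. (G' t)\<^sup>2) \<le> ?J"
          using t continuous_on_subset[OF G' sub] continuous_on_subset[OF G' sub']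
          by (intro integral_subset_le integrable_continuous_real continuous_on_power) auto
        show "0 \<le> integral {\<theta> j..t} (\<lambda>t. (G' t)\<^sup>2)"
          by (rule integral_nonneg)
            (use continuous_on_subset[OF G' sub'] in \<open>auto intro!: integrable_continuous_real continuous_on_power\<close>)
      qed (use t step[of j] in auto)
      finally show ?thesis using Z[of j] \<open>j < n\<close> unfolding \<theta>_def by simp
    qed
    have "integral {\<theta> j..\<theta> (Suc j)} (\<lambda>t. (G t)\<^sup>2) \<le> integral {\<theta> j..\<theta> (Suc j)} (\<lambda>t. pi / real n * ?J)"
      using pt continuous_on_subset[OF contG sub]
      by (intro integral_le integrable_continuous_real continuous_on_power) auto
    also have "\<dots> = (pi / real n)\<^sup>2 * ?J"
      using le[of j] step[of j] by (simp add: power2_eq_square)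
    finally show ?thesis .
  qed
  have "integral {0..pi} (\<lambda>t. (G t)\<^sup>2) = (\<Sum>j<n. integral {\<theta> j..\<theta> (Suc j)} (\<lambda>t. (G t)\<^sup>2))"
    unfolding \<theta>_def using contG
    by (intro sum_integral_cells[symmetric] n integrable_continuous_real continuous_on_power)
  also have "\<dots> \<le> (\<Sum>j<n. (pi / real n)\<^sup>2 * integral {\<theta> j..\<theta> (Suc j)} (\<lambda>t. (G' t)\<^sup>2))"
    using cell by (intro sum_mono) auto
  also have "\<dots> = (pi / real n)\<^sup>2 * integral {0..pi} (\<lambda>t. (G' t)\<^sup>2)"
    unfolding sum_distrib_left[symmetric] \<theta>_def using G'
    by (subst sum_integral_cells[OF n]) (auto intro: integrable_continuous_real continuous_on_power)
  finally show ?thesis .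
qed

text \<open>Induction along the Horner form of \<open>P\<close>: \<open>V n\<close> is the span of
  \<open>cos (k * t)\<close> for \<open>k \<le> n\<close>, and by the product formula multiplication
  by \<open>cos t\<close> maps it into \<open>V (Suc n)\<close>.\<close>

lemma poly_cos_expansion:
  fixes P :: "real poly"
  assumes "degree P \<le> n"
  shows "\<exists>b. \<forall>t. poly P (cos t) = (\<Sum>k\<le>n. b k * cos (real k * t))"
proof -
  define V where "V n = {f. \<exists>b :: nat \<Rightarrow> real. \<forall>t. f t = (\<Sum>k\<le>n. b k * cos (real k * t))}" for n
  have addV: "(\<lambda>t. f t + g t) \<in> V n" if "f \<in> V n" "g \<in> V n" for f g n
  proof -
    obtain b c where "\<forall>t. f t = (\<Sum>k\<le>n. b k * cos (real k * t))" "\<forall>t. g t = (\<Sum>k\<le>n. c k * cos (real k * t))"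
      using \<open>f \<in> V n\<close> \<open>g \<in> V n\<close> unfolding V_def by blast
    then show ?thesis unfolding V_def
      by (auto intro!: exI[of _ "\<lambda>k. b k + c k"] simp: sum.distrib distrib_right)
  qed
  have scaleV: "(\<lambda>t. a * f t) \<in> V n" if "f \<in> V n" for a f n
  proof -
    obtain b where "\<forall>t. f t = (\<Sum>k\<le>n. b k * cos (real k * t))" using \<open>f \<in> V n\<close> unfolding V_def by blast
    then show ?thesis unfolding V_def
      by (auto intro!: exI[of _ "\<lambda>k. a * b k"] simp: sum_distrib_left mult.assoc)
  qed
  have cosV: "(\<lambda>t. cos (real k * t)) \<in> V n" if "k \<le> n" for k n
    unfolding V_def using that
    by (auto intro!: exI[of _ "\<lambda>i. if i = k then 1 else 0"] simp: if_distrib[where f = "\<lambda>x. x * _"] cong: if_cong)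
  have sumV: "(\<lambda>t. \<Sum>k\<in>A. f k t) \<in> V n" if "finite A" "\<And>k. k \<in> A \<Longrightarrow> f k \<in> V n" for A and f :: "nat \<Rightarrow> _" and n
    using that
  proof (induction A rule: finite_induct)
    case empty
    then show ?case using scaleV[OF cosV[of 0 n], of 0] by simp
  next
    case (insert x A)
    then show ?case using addV[of "f x" n "\<lambda>t. \<Sum>k\<in>A. f k t"] by simp
  qed
  have mulV: "(\<lambda>t. cos t * f t) \<in> V (Suc n)" if "f \<in> V n" for f n
  proof -
    obtain b where b: "\<forall>t. f t = (\<Sum>k\<le>n. b k * cos (real k * t))" using \<open>f \<in> V n\<close> unfolding V_def by blast
    have *: "(\<lambda>t. cos t * cos (real k * t)) \<in> V (Suc n)" if "k \<le> n" for k
    proof (cases k)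
      case 0
      then show ?thesis using cosV[of 1 "Suc n"] by simp
    next
      case (Suc k')
      have "cos t * cos (real k * t) = 1/2 * cos (real (Suc k) * t) + 1/2 * cos (real k' * t)" for t
        using cos_times_cos[of "real k * t" t] Suc by (simp add: algebra_simps add_divide_distrib)
      moreover have "(\<lambda>t. 1/2 * cos (real (Suc k) * t) + 1/2 * cos (real k' * t)) \<in> V (Suc n)"
        using that Suc by (intro addV scaleV cosV) auto
      ultimately show ?thesis by (simp only:)
    qed
    have "(\<lambda>t. \<Sum>k\<le>n. b k * (cos t * cos (real k * t))) \<in> V (Suc n)"
      by (intro sumV scaleV *) auto
    then show ?thesis using b by (simp add: sum_distrib_left mult_ac)
  qed
  have "(\<lambda>t. poly P (cos t)) \<in> V n" using assms
  proof (induction P arbitrary: n)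
    case 0
    then show ?case using scaleV[OF cosV[of 0 n], of 0] by simp
  next
    case (pCons a P)
    have c: "(\<lambda>t. a) \<in> V n" using scaleV[OF cosV[of 0 n], of a] by simp
    show ?case
    proof (cases "P = 0")
      case True
      then show ?thesis using c by simp
    next
      case False
      then obtain m where m: "n = Suc m" "degree P \<le> m" using pCons.prems by (cases n) auto
      show ?thesis using addV[OF c mulV[OF pCons.IH[OF m(2)], folded m(1)]] by simp
    qed
  qed
  then show ?thesis unfolding V_def by simp
qed

subsection \<open>Polynomial interpolation at the Chebyshev extremal points\<close>

text \<open>Over a general field, since real bases enter the quadrature weights while
  \<open>Q1\<close> selects a complex polynomial.\<close>

definition lagrange_basis :: "'a::field set \<Rightarrow> 'a \<Rightarrow> 'a poly" where
  "lagrange_basis A x = (\<Prod>z\<in>A - {x}. smult (inverse (x - z)) [:- z, 1:])"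

lemma degree_lagrange_basis:
  assumes "finite A" "x \<in> A"
  shows "degree (lagrange_basis A x) \<le> card A - 1"
proof -
  have "degree (lagrange_basis A x) \<le> (\<Sum>z\<in>A - {x}. degree (smult (inverse (x - z)) [:- z, 1:]))"
    unfolding lagrange_basis_def
    using degree_prod_sum_le[of "A - {x}" "\<lambda>z. smult (inverse (x - z)) [:- z, 1:]"] assms(1)
    by (simp only: o_def finite_Diff)
  also have "\<dots> \<le> (\<Sum>z\<in>A - {x}. 1)"
    by (intro sum_mono order_trans[OF degree_smult_le]) simp
  finally show ?thesis using assms by simp
qed

lemma poly_lagrange_basis:
  assumes "finite A" "x \<in> A" "z \<in> A"
  shows "poly (lagrange_basis A x) z = (if z = x then 1 else 0)"
proof (cases "z = x")
  case True
  have "poly (smult (inverse (x - y)) [:- y, 1:]) x = 1" if "y \<in> A - {x}" for y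
    using that left_inverse[of "x - y"] by (auto simp: algebra_simps)
  then show ?thesis unfolding lagrange_basis_def poly_prod using True by (simp only: prod.neutral_const cong: prod.cong) simp
next
  case False
  then show ?thesis using assms unfolding lagrange_basis_def poly_prod by (auto intro!: prod_zero)
qed

definition lagrange_interpolant :: "'a::field set \<Rightarrow> ('a \<Rightarrow> 'a) \<Rightarrow> 'a poly" where
  "lagrange_interpolant A g = (\<Sum>x\<in>A. smult (g x) (lagrange_basis A x))"

lemma degree_lagrange_interpolant:
  assumes "finite A"
  shows "degree (lagrange_interpolant A g) \<le> card A - 1"
  unfolding lagrange_interpolant_def
  by (intro degree_sum_le assms order_trans[OF degree_smult_le] degree_lagrange_basis) auto

lemma poly_lagrange_interpolant:
  assumes "finite A" "z \<in> A"
  shows "poly (lagrange_interpolant A g) z = g z"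
proof -
  have "poly (lagrange_interpolant A g) z = (\<Sum>x\<in>A. if z = x then g x else 0)"
    unfolding lagrange_interpolant_def poly_sum using assms
    by (intro sum.cong refl) (simp add: poly_lagrange_basis)
  then show ?thesis using assms by simp
qed

lemma ex_poly_antiderivative:
  fixes p :: "real poly"
  obtains q where "pderiv q = p" "degree q \<le> Suc (degree p)"
proof
  let ?q = "\<Sum>i\<le>degree p. monom (coeff p i / real (Suc i)) (Suc i)"
  have "pderiv (sum f A) = (\<Sum>i\<in>A. pderiv (f i))" for f :: "nat \<Rightarrow> real poly" and A
    by (induction A rule: infinite_finite_induct) (simp_all add: pderiv_add)
  then have "pderiv ?q = (\<Sum>i\<le>degree p. monom (coeff p i) i)"
    by (simp add: pderiv_monom del: of_nat_Suc)
  then show "pderiv ?q = p" by (simp add: poly_as_sum_of_monoms)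
  show "degree ?q \<le> Suc (degree p)"
    by (intro degree_sum_le order_trans[OF degree_monom_le]) auto
qed

lemma cos_in_Icc: "cos t \<in> {-1..1::real}" by simp

lemma continuous_on_comp_cos:
  assumes "continuous_on {-1..1} (u :: real \<Rightarrow> 'a::topological_space)"
  shows "continuous_on S (\<lambda>t. u (cos t))"
  by (rule continuous_on_compose2[OF assms]) (auto intro: continuous_intros)

lemma has_derivative_comp_cos:
  fixes u :: "real \<Rightarrow> real"
  assumes "\<And>x. x \<in> {-1..1} \<Longrightarrow> (u has_real_derivative u' x) (at x within {-1..1})"
  shows "((\<lambda>t. u (cos t)) has_real_derivative - (u' (cos t) * sin t)) (at t within S)"
proof -
  have "(u has_real_derivative u' (cos t)) (at (cos t) within cos ` S)"
    by (rule DERIV_subset[OF assms]) auto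
  moreover have "(cos has_real_derivative - sin t) (at t within S)"
    by (auto intro!: derivative_eq_intros)
  ultimately show ?thesis using DERIV_image_chain[of u "u' (cos t)" cos t S "- sin t"] by (simp add: o_def)
qed

section \<open>Energy and L2 estimates for interpolation at the Chebyshev points\<close>

text \<open>\<open>P\<close> is any polynomial with the right degree and nodal values, not a chosen
  interpolant. The estimates therefore apply to \<open>u - q\<close> and \<open>P - q\<close> for a
  polynomial \<open>q\<close> of degree at most \<open>n\<close>, which is how exactness on
  polynomials enters.\<close>

locale chebyshev_interpolation =
  fixes n :: nat and u u' :: "real \<Rightarrow> real" and P :: "real poly"
  assumes n: "n > 0"
    and du: "\<And>x. x \<in> {-1..1} \<Longrightarrow> (u has_real_derivative u' x) (at x within {-1..1})"
    and cu': "continuous_on {-1..1} u'"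
    and dP: "degree P \<le> n"
    and nodes: "\<And>j. j \<le> n \<Longrightarrow> poly P (cos (real j * pi / real n)) = u (cos (real j * pi / real n))"
begin

lemma cu: "continuous_on {-1..1} u"
  using du by (metis DERIV_continuous_on)

text \<open>The cosine expansion of \<open>P\<close> takes the values of \<open>u (cos t)\<close> at
  equispaced angles, so trigonometric stability applies to \<open>G t = u (cos t)\<close>; the sign
  in the derivative of the cosine disappears in the square.\<close>

lemma energy_interpolant:
  "integral {0..pi} (\<lambda>t. (poly (pderiv P) (cos t) * sin t)\<^sup>2)
    \<le> pi\<^sup>2 / 4 * integral {0..pi} (\<lambda>t. (u' (cos t) * sin t)\<^sup>2)"
proof -
  obtain b where b: "\<And>t. poly P (cos t) = (\<Sum>k\<le>n. b k * cos (real k * t))"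
    using poly_cos_expansion[OF dP] by blast
  have d: "poly (pderiv P) (cos t) * sin t = (\<Sum>k\<in>{1..n}. real k * b k * sin (real k * t))" for t
  proof -
    have "((\<lambda>t. poly P (cos t)) has_real_derivative - (poly (pderiv P) (cos t) * sin t)) (at t)"
      by (rule has_derivative_comp_cos) (auto intro: DERIV_subset[OF poly_DERIV])
    moreover have "((\<lambda>t. poly P (cos t)) has_real_derivative (\<Sum>k\<le>n. b k * (- sin (real k * t) * real k))) (at t)"
      unfolding b by (auto intro!: derivative_eq_intros sum.cong)
    ultimately have "- (poly (pderiv P) (cos t) * sin t) = (\<Sum>k\<le>n. b k * (- sin (real k * t) * real k))"
      by (rule DERIV_unique)
    also have "\<dots> = - (\<Sum>k\<le>n. real k * b k * sin (real k * t))"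
      by (simp add: sum_negf mult_ac)
    also have "(\<Sum>k\<le>n. real k * b k * sin (real k * t)) = (\<Sum>k\<in>{1..n}. real k * b k * sin (real k * t))"
      by (intro sum.mono_neutral_right) (auto simp: not_le)
    finally show ?thesis by simp
  qed
  have "integral {0..pi} (\<lambda>t. (\<Sum>k\<in>{1..n}. real k * b k * sin (real k * t))\<^sup>2)
    \<le> pi\<^sup>2 / 4 * integral {0..pi} (\<lambda>t. (- (u' (cos t) * sin t))\<^sup>2)"
  proof (rule trigonometric_interpolation_stable[OF n])
    show "((\<lambda>t. u (cos t)) has_real_derivative - (u' (cos t) * sin t)) (at t within {0..pi})" for t
      by (rule has_derivative_comp_cos[OF du])
    show "continuous_on {0..pi} (\<lambda>t. - (u' (cos t) * sin t))"
      by (intro continuous_intros continuous_on_comp_cos cu')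
    show "u (cos (real j * pi / real n)) = (\<Sum>k\<le>n. b k * cos (real k * (real j * pi / real n)))" if "j \<le> n" for j
      using nodes[OF that] b by simp
  qed
  then show ?thesis by (simp add: d)
qed

text \<open>The constant is 2 + 2 * pi^2 / 4, from (a - b)^2 \<le> 2 a^2 + 2 b^2. The weight
  \<open>sin t\<close> is dropped on the right because approximations of \<open>u'\<close> will be
  controlled in the plain L2 norm in \<open>t\<close>.\<close>

lemma energy_error:
  "integral {0..pi} (\<lambda>t. ((u' (cos t) - poly (pderiv P) (cos t)) * sin t)\<^sup>2)
    \<le> (2 + pi\<^sup>2 / 2) * integral {0..pi} (\<lambda>t. (u' (cos t))\<^sup>2)"
proof -
  note [continuous_intros] = continuous_on_comp_cos[OF cu']
  have "integral {0..pi} (\<lambda>t. ((u' (cos t) - poly (pderiv P) (cos t)) * sin t)\<^sup>2)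
    \<le> integral {0..pi} (\<lambda>t. 2 * (u' (cos t) * sin t)\<^sup>2 + 2 * (poly (pderiv P) (cos t) * sin t)\<^sup>2)"
  proof (intro integral_le)
    fix t
    have "((u' (cos t) * sin t) - poly (pderiv P) (cos t) * sin t)\<^sup>2
      \<le> 2 * (u' (cos t) * sin t)\<^sup>2 + 2 * (poly (pderiv P) (cos t) * sin t)\<^sup>2"
      using zero_le_power2[of "u' (cos t) * sin t + poly (pderiv P) (cos t) * sin t"]
      by (simp add: power2_eq_square algebra_simps)
    then show "((u' (cos t) - poly (pderiv P) (cos t)) * sin t)\<^sup>2
      \<le> 2 * (u' (cos t) * sin t)\<^sup>2 + 2 * (poly (pderiv P) (cos t) * sin t)\<^sup>2"
      by (simp add: left_diff_distrib)
  qed (auto intro!: integrable_continuous_real continuous_intros)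
  also have "\<dots> = 2 * integral {0..pi} (\<lambda>t. (u' (cos t) * sin t)\<^sup>2)
     + 2 * integral {0..pi} (\<lambda>t. (poly (pderiv P) (cos t) * sin t)\<^sup>2)"
    by (subst Henstock_Kurzweil_Integration.integral_add)
       (auto intro!: integrable_continuous_real continuous_intros)
  also have "\<dots> \<le> (2 + pi\<^sup>2 / 2) * integral {0..pi} (\<lambda>t. (u' (cos t) * sin t)\<^sup>2)"
    using energy_interpolant by (simp add: algebra_simps)
  also have "\<dots> \<le> (2 + pi\<^sup>2 / 2) * integral {0..pi} (\<lambda>t. (u' (cos t))\<^sup>2)"
  proof (intro mult_left_mono integral_le)
    fix t :: real
    have "(sin t)\<^sup>2 \<le> 1" using sin_cos_squared_add[of t] zero_le_power2[of "cos t"] by linarith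
    then show "(u' (cos t) * sin t)\<^sup>2 \<le> (u' (cos t))\<^sup>2"
      by (simp add: power_mult_distrib mult_left_le)
  qed (auto intro!: integrable_continuous_real continuous_intros)
  finally show ?thesis .
qed

text \<open>The error vanishes at the nodes, so the Poincare inequality gains a factor
  \<open>1 / n\<close> in norm. Both sides carry the same norm, for \<open>u - P\<close> and for
  \<open>u'\<close>; this makes the estimate iterable.\<close>

lemma L2_error:
  "integral {0..pi} (\<lambda>t. (u (cos t) - poly P (cos t))\<^sup>2)
    \<le> (pi / real n)\<^sup>2 * (2 + pi\<^sup>2 / 2) * integral {0..pi} (\<lambda>t. (u' (cos t))\<^sup>2)"
proof -
  have "integral {0..pi} (\<lambda>t. (u (cos t) - poly P (cos t))\<^sup>2)
      \<le> (pi / real n)\<^sup>2 * integral {0..pi} (\<lambda>t. (- ((u' (cos t) - poly (pderiv P) (cos t)) * sin t))\<^sup>2)"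
  proof (rule grid_poincare[OF n])
    show "((\<lambda>t. u (cos t) - poly P (cos t)) has_real_derivative
        - ((u' (cos t) - poly (pderiv P) (cos t)) * sin t)) (at t within {0..pi})" for t
      by (rule has_derivative_comp_cos[where u = "\<lambda>x. u x - poly P x"])
         (auto intro!: DERIV_diff du DERIV_subset[OF poly_DERIV])
    show "continuous_on {0..pi} (\<lambda>t. - ((u' (cos t) - poly (pderiv P) (cos t)) * sin t))"
      by (intro continuous_intros continuous_on_comp_cos cu')
  qed (simp add: nodes)
  also have "\<dots> \<le> (pi / real n)\<^sup>2 * ((2 + pi\<^sup>2 / 2) * integral {0..pi} (\<lambda>t. (u' (cos t))\<^sup>2))"
    using energy_error by (intro mult_left_mono) auto
  finally show ?thesis by (simp only: mult.assoc)
qed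

end

lemma ex_chebyshev_interpolant:
  assumes "n > 0"
    and "\<And>x. x \<in> {-1..1} \<Longrightarrow> (u has_real_derivative u' x) (at x within {-1..1})"
    and "continuous_on {-1..1} u'"
  obtains P where "chebyshev_interpolation n u u' P"
proof
  let ?A = "(\<lambda>j. cos (real j * pi / real n)) ` {..n}"
  have "card ?A \<le> Suc n" using card_image_le[of "{..n}"] by (metis card_atMost finite_atMost)
  then have "degree (lagrange_interpolant ?A u) \<le> n"
    using degree_lagrange_interpolant[of ?A u] by simp
  then show "chebyshev_interpolation n u u' (lagrange_interpolant ?A u)"
    using assms by unfold_locales (auto simp: poly_lagrange_interpolant)
qed

section \<open>Jackson approximation and the L1 error of the derivative\<close>

text \<open>The constant of \<open>L2_error\<close> apart from 1 / n^2: the price of one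
  derivative.\<close>

definition jackson_const :: real where "jackson_const = pi\<^sup>2 * (2 + pi\<^sup>2 / 2)"

text \<open>Approximate the derivative in degree \<open>n - 1\<close>, integrate the result to
  \<open>q0\<close>, and interpolate \<open>u 0 - q0\<close>, whose derivative is already small;
  \<open>q0 + P\<close> is the new approximant. The successive gains are 1/n, 1/(n-1), ..., each
  estimated by the worst one, 1/(n+1-m).\<close>

lemma jackson_L2:
  fixes u :: "nat \<Rightarrow> real \<Rightarrow> real"
  assumes "m \<le> n"
    and "\<And>i x. i < m \<Longrightarrow> x \<in> {-1..1} \<Longrightarrow> (u i has_real_derivative u (Suc i) x) (at x within {-1..1})"
    and "continuous_on {-1..1} (u m)"
  shows "\<exists>q. degree q \<le> n \<and> integral {0..pi} (\<lambda>t. (u 0 (cos t) - poly q (cos t))\<^sup>2)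
    \<le> jackson_const ^ m / real (n + 1 - m) ^ (2 * m) * integral {0..pi} (\<lambda>t. (u m (cos t))\<^sup>2)"
  using assms
proof (induction m arbitrary: n u)
  case 0
  then show ?case by (intro exI[of _ 0]) auto
next
  case (Suc m)
  then obtain n' where n': "n = Suc n'" "m \<le> n'" by (cases n) auto
  obtain q1 where q1: "degree q1 \<le> n'" "integral {0..pi} (\<lambda>t. (u 1 (cos t) - poly q1 (cos t))\<^sup>2)
    \<le> jackson_const ^ m / real (n' + 1 - m) ^ (2 * m) * integral {0..pi} (\<lambda>t. (u (Suc m) (cos t))\<^sup>2)"
    using Suc.IH[of n' "\<lambda>i. u (Suc i)"] Suc.prems n' by auto
  obtain q0 where q0: "pderiv q0 = q1" "degree q0 \<le> Suc (degree q1)"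
    by (rule ex_poly_antiderivative)
  have d: "((\<lambda>x. u 0 x - poly q0 x) has_real_derivative (u 1 x - poly q1 x)) (at x within {-1..1})"
    if "x \<in> {-1..1}" for x
    using Suc.prems(2)[of 0 x] that unfolding q0(1)[symmetric]
    by (auto intro!: DERIV_diff DERIV_subset[OF poly_DERIV])
  have c1: "continuous_on {-1..1} (u 1)"
  proof (cases m)
    case (Suc m')
    then show ?thesis using Suc.prems(2)[of 1] by (metis DERIV_continuous_on One_nat_def Suc_less_eq zero_less_Suc)
  qed (use Suc.prems in auto)
  obtain P where P: "chebyshev_interpolation n (\<lambda>x. u 0 x - poly q0 x) (\<lambda>x. u 1 x - poly q1 x) P"
    by (rule ex_chebyshev_interpolant[of n, OF _ d])
      (use n' c1 in \<open>auto intro!: continuous_intros\<close>)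
  have "jackson_const \<ge> 0" unfolding jackson_const_def by simp
  have "integral {0..pi} (\<lambda>t. (u 0 (cos t) - poly (q0 + P) (cos t))\<^sup>2)
     \<le> (pi / real n)\<^sup>2 * (2 + pi\<^sup>2 / 2) * integral {0..pi} (\<lambda>t. (u 1 (cos t) - poly q1 (cos t))\<^sup>2)"
    using chebyshev_interpolation.L2_error[OF P] by (simp add: diff_diff_eq)
  also have "(pi / real n)\<^sup>2 * (2 + pi\<^sup>2 / 2) = jackson_const / real n ^ 2"
    unfolding jackson_const_def by (simp add: power_divide)
  also have "jackson_const / real n ^ 2 * integral {0..pi} (\<lambda>t. (u 1 (cos t) - poly q1 (cos t))\<^sup>2)
    \<le> jackson_const / real (n + 1 - Suc m) ^ 2 *
      (jackson_const ^ m / real (n' + 1 - m) ^ (2 * m) * integral {0..pi} (\<lambda>t. (u (Suc m) (cos t))\<^sup>2))"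
  proof (intro mult_mono q1(2) divide_left_mono power_mono)
    show "0 \<le> integral {0..pi} (\<lambda>t. (u 1 (cos t) - poly q1 (cos t))\<^sup>2)"
      by (intro integral_nonneg integrable_continuous_real continuous_intros continuous_on_comp_cos c1) auto
  qed (use n' \<open>jackson_const \<ge> 0\<close> in auto)
  also have "\<dots> = jackson_const ^ Suc m / real (n + 1 - Suc m) ^ (2 * Suc m) * integral {0..pi} (\<lambda>t. (u (Suc m) (cos t))\<^sup>2)"
    using n' by (simp add: power2_eq_square mult_ac)
  finally have "integral {0..pi} (\<lambda>t. (u 0 (cos t) - poly (q0 + P) (cos t))\<^sup>2)
    \<le> jackson_const ^ Suc m / real (n + 1 - Suc m) ^ (2 * Suc m) * integral {0..pi} (\<lambda>t. (u (Suc m) (cos t))\<^sup>2)" .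
  moreover have "degree (q0 + P) \<le> n"
    using q0(2) q1(1) n' chebyshev_interpolation.dP[OF P] by (intro degree_add_le) auto
  ultimately show ?case by blast
qed

lemma jackson_const_ge_1: "jackson_const \<ge> 1"
proof -
  have "1 * 1 \<le> jackson_const" unfolding jackson_const_def
    using pi_gt3 by (intro mult_mono) (auto simp: power2_eq_square intro: add_increasing2 mult_mono[of 1 pi 1 pi, simplified])
  then show ?thesis by simp
qed

text \<open>Under the root: \<open>pi\<close> from Cauchy-Schwarz on [0, pi], the middle factor from
  \<open>energy_error\<close>, the last one from \<open>jackson_first_derivative\<close>.\<close>

definition interp_const :: "nat \<Rightarrow> real" where
  "interp_const p = sqrt (pi * (2 + pi\<^sup>2 / 2) * (pi * jackson_const ^ (p - 1) * real p ^ (2 * (p - 1))))"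

lemma integral_cos_substitution:
  fixes g :: "real \<Rightarrow> real"
  assumes "continuous_on {-1..1} g"
  shows "integral {-1..1} g = integral {0..pi} (\<lambda>t. sin t * g (cos t))"
proof -
  have "((\<lambda>t. (- sin t) *\<^sub>R g (cos t)) has_integral (integral {cos 0..cos pi} g - integral {cos pi..cos 0} g)) {0..pi}"
    by (rule has_integral_substitution_general[of "{}" 0 pi cos "-1" 1 g])
       (use assms in \<open>auto intro!: derivative_eq_intros continuous_intros\<close>)
  then have "((\<lambda>t. - ((- sin t) *\<^sub>R g (cos t))) has_integral - (integral {cos 0..cos pi} g - integral {cos pi..cos 0} g)) {0..pi}"
    by (rule has_integral_neg)
  then show ?thesis by (simp add: integral_unique)
qed

text \<open>Jackson's estimate for \<open>h 1\<close>, which has \<open>p - 1\<close> further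
  derivatives. The power of \<open>real p\<close> makes the bound uniform in \<open>n\<close>,
  including the small \<open>n\<close> to which the iteration does not apply.\<close>

lemma jackson_first_derivative:
  fixes h :: "nat \<Rightarrow> real \<Rightarrow> real"
  assumes p: "p \<ge> 1" and n: "n > 0"
    and dh: "\<And>i x. i < p \<Longrightarrow> x \<in> {-1..1} \<Longrightarrow> (h i has_real_derivative h (Suc i) x) (at x within {-1..1})"
    and ch: "\<And>i. i \<le> p \<Longrightarrow> continuous_on {-1..1} (h i)"
    and bh: "\<And>i x. i \<le> p \<Longrightarrow> x \<in> {-1..1} \<Longrightarrow> \<bar>h i x\<bar> \<le> M"
  shows "\<exists>q. degree q \<le> n - 1 \<and> integral {0..pi} (\<lambda>t. (h 1 (cos t) - poly q (cos t))\<^sup>2)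
    \<le> pi * jackson_const ^ (p - 1) * real p ^ (2 * (p - 1)) / real n ^ (2 * (p - 1)) * M\<^sup>2"
proof -
  have b: "integral {0..pi} (\<lambda>t. (h i (cos t))\<^sup>2) \<le> pi * M\<^sup>2" if "i \<le> p" for i
  proof -
    have "integral {0..pi} (\<lambda>t. (h i (cos t))\<^sup>2) \<le> integral {0..pi} (\<lambda>t. M\<^sup>2)"
      using bh[OF that cos_in_Icc]
      by (intro integral_le integrable_continuous_real continuous_intros continuous_on_comp_cos ch that)
         (auto simp: abs_le_square_iff[symmetric] intro: order_trans[OF _ abs_ge_self])
    then show ?thesis by simp
  qed
  show ?thesis
  proof (cases "n \<ge> p")
    case True
    obtain q where q: "degree q \<le> n - 1" "integral {0..pi} (\<lambda>t. (h 1 (cos t) - poly q (cos t))\<^sup>2)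
      \<le> jackson_const ^ (p - 1) / real (n - 1 + 1 - (p - 1)) ^ (2 * (p - 1)) * integral {0..pi} (\<lambda>t. (h p (cos t))\<^sup>2)"
      using jackson_L2[OF diff_le_mono[OF True, of 1], of "\<lambda>i. h (Suc i)"] dh ch p by auto
    \<comment> \<open>n - p + 1 \<ge> n / p is (n - p)(p - 1) \<ge> 0 rearranged.\<close>
    have "real n / real p \<le> real (n - 1 + 1 - (p - 1))"
    proof -
      have "(real n - real p) * (real p - 1) \<ge> 0" using True p by (intro mult_nonneg_nonneg) auto
      then have "real n \<le> (real n + 1 - real p) * real p" by (simp add: algebra_simps)
      moreover have "real (n - 1 + 1 - (p - 1)) = real n + 1 - real p" using True p n by (simp add: of_nat_diff)
      ultimately show ?thesis using p by (simp add: field_simps)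
    qed
    then have "1 / real (n - 1 + 1 - (p - 1)) ^ (2 * (p - 1)) \<le> 1 / (real n / real p) ^ (2 * (p - 1))"
      using n p True by (intro divide_left_mono power_mono) (auto intro!: mult_pos_pos zero_less_power)
    also have "\<dots> = real p ^ (2 * (p - 1)) / real n ^ (2 * (p - 1))"
      by (simp add: power_divide)
    finally have r: "jackson_const ^ (p - 1) / real (n - 1 + 1 - (p - 1)) ^ (2 * (p - 1))
       \<le> jackson_const ^ (p - 1) * (real p ^ (2 * (p - 1)) / real n ^ (2 * (p - 1)))"
      using jackson_const_ge_1 by (simp add: divide_inverse mult_left_mono)
    have "jackson_const ^ (p - 1) / real (n - 1 + 1 - (p - 1)) ^ (2 * (p - 1)) * integral {0..pi} (\<lambda>t. (h p (cos t))\<^sup>2)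
       \<le> jackson_const ^ (p - 1) * (real p ^ (2 * (p - 1)) / real n ^ (2 * (p - 1))) * (pi * M\<^sup>2)"
      using jackson_const_ge_1
      by (intro mult_mono r b integral_nonneg integrable_continuous_real continuous_intros continuous_on_comp_cos ch) auto
    then show ?thesis using q by (intro exI[of _ q]) (auto simp: mult_ac)
  next
    case False
    \<comment> \<open>For \<open>n < p\<close> the zero polynomial suffices, because p / n \<ge> 1
      lifts the right-hand side above the trivial bound.\<close>
    have "1 * 1 \<le> jackson_const ^ (p - 1) * (real p / real n) ^ (2 * (p - 1))"
      using False n jackson_const_ge_1 by (intro mult_mono one_le_power) auto
    then have "pi * M\<^sup>2 * 1 \<le> pi * M\<^sup>2 * (jackson_const ^ (p - 1) * (real p / real n) ^ (2 * (p - 1)))"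
      by (intro mult_left_mono) auto
    then show ?thesis using b[of 1] p by (intro exI[of _ 0]) (auto simp: power_divide mult_ac)
  qed
qed

text \<open>Subtract from \<open>h 0\<close> an antiderivative \<open>q\<close> of a good
  approximant of \<open>h 1\<close>. Interpolation reproduces \<open>q\<close>, so the error is
  unchanged, while \<open>energy_error\<close> now only sees the small derivative
  \<open>h 1 - q1\<close>. The substitution x = cos t supplies exactly the factor
  \<open>sin t\<close> that the energy contains.\<close>

lemma interpolation_error_L1:
  fixes h :: "nat \<Rightarrow> real \<Rightarrow> real"
  assumes p: "p \<ge> 1" and n: "n > 0" and M: "M \<ge> 0"
    and dh: "\<And>i x. i < p \<Longrightarrow> x \<in> {-1..1} \<Longrightarrow> (h i has_real_derivative h (Suc i) x) (at x within {-1..1})"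
    and ch: "\<And>i. i \<le> p \<Longrightarrow> continuous_on {-1..1} (h i)"
    and bh: "\<And>i x. i \<le> p \<Longrightarrow> x \<in> {-1..1} \<Longrightarrow> \<bar>h i x\<bar> \<le> M"
    and P: "degree P \<le> n" "\<And>j. j \<le> n \<Longrightarrow> poly P (cos (real j * pi / real n)) = h 0 (cos (real j * pi / real n))"
  shows "integral {-1..1} (\<lambda>x. \<bar>h 1 x - poly (pderiv P) x\<bar>) \<le> interp_const p / real n ^ (p - 1) * M"
proof -
  let ?A = "pi * jackson_const ^ (p - 1) * real p ^ (2 * (p - 1))"
  have "\<exists>q. degree q \<le> n - 1 \<and> integral {0..pi} (\<lambda>t. (h 1 (cos t) - poly q (cos t))\<^sup>2)
      \<le> ?A / real n ^ (2 * (p - 1)) * M\<^sup>2"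
    by (rule jackson_first_derivative[OF p n]) (use dh ch bh in auto)
  then obtain q1 where q1: "degree q1 \<le> n - 1" "integral {0..pi} (\<lambda>t. (h 1 (cos t) - poly q1 (cos t))\<^sup>2)
      \<le> ?A / real n ^ (2 * (p - 1)) * M\<^sup>2"
    by blast
  obtain q where q: "pderiv q = q1" "degree q \<le> Suc (degree q1)"
    by (rule ex_poly_antiderivative)
  interpret chebyshev_interpolation n "\<lambda>x. h 0 x - poly q x" "\<lambda>x. h 1 x - poly q1 x" "P - q"
  proof
    show "((\<lambda>x. h 0 x - poly q x) has_real_derivative (h 1 x - poly q1 x)) (at x within {-1..1})"
      if "x \<in> {-1..1}" for x
      using dh[of 0 x] that p unfolding q(1)[symmetric]
      by (auto intro!: DERIV_diff DERIV_subset[OF poly_DERIV])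
    show "degree (P - q) \<le> n" using P(1) q(2) q1(1) n by (intro degree_diff_le) auto
  qed (use n P(2) ch[of 1] p in \<open>auto intro!: continuous_intros\<close>)
  let ?g = "\<lambda>x. \<bar>h 1 x - poly (pderiv P) x\<bar>"
  have cg: "continuous_on {-1..1} ?g" using ch[of 1] p by (auto intro!: continuous_intros)
  have c: "continuous_on {0..pi} (\<lambda>t. sin t * ?g (cos t))"
    by (intro continuous_intros continuous_on_comp_cos ch p)
  have "(integral {-1..1} ?g)\<^sup>2 \<le> pi * integral {0..pi} (\<lambda>t. (sin t * ?g (cos t))\<^sup>2)"
    unfolding integral_cos_substitution[OF cg] using integral_square_le[OF _ c] by simp
  also have "(\<lambda>t. (sin t * ?g (cos t))\<^sup>2)
      = (\<lambda>t. ((h 1 (cos t) - poly q1 (cos t) - poly (pderiv (P - q)) (cos t)) * sin t)\<^sup>2)"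
    by (simp add: power_mult_distrib pderiv_diff q mult.commute)
  also have "pi * integral {0..pi} \<dots> \<le> pi * ((2 + pi\<^sup>2 / 2) * (?A / real n ^ (2 * (p - 1)) * M\<^sup>2))"
    by (rule mult_left_mono[OF order_trans[OF energy_error mult_left_mono[OF q1(2)]]]) auto
  also have "\<dots> = (interp_const p / real n ^ (p - 1) * M)\<^sup>2"
  proof -
    have s: "(interp_const p)\<^sup>2 = pi * (2 + pi\<^sup>2 / 2) * ?A"
      unfolding interp_const_def using jackson_const_ge_1
      by (intro real_sqrt_pow2 mult_nonneg_nonneg) auto
    have e: "real n ^ (2 * (p - 1)) = (real n ^ (p - 1))\<^sup>2" by (simp add: power_mult[symmetric] mult.commute)
    show ?thesis unfolding power_mult_distrib power_divide s e by simp
  qed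
  finally have sq: "(integral {-1..1} ?g)\<^sup>2 \<le> (interp_const p / real n ^ (p - 1) * M)\<^sup>2" .
  have "interp_const p / real n ^ (p - 1) * M \<ge> 0"
    unfolding interp_const_def using jackson_const_ge_1 M by simp
  then show ?thesis by (rule power2_le_imp_le[OF sq])
qed

subsection \<open>One-dimensional quadrature errors\<close>

lemma n_lev_pos: "n_lev l > 0"
  unfolding n_lev_def by simp

lemma finite_grid: "finite (grid l)"
  unfolding grid_def by simp

lemma grid_subset: "grid l \<subseteq> {-1..1}"
  unfolding grid_def by auto

lemma card_grid:
  assumes "l \<noteq> 1"
  shows "card (grid l) = n_lev l + 1"
proof -
  have "inj_on (\<lambda>j. cos (real j * pi / real (n_lev l))) {0..n_lev l}"
  proof (rule inj_onI)
    fix i j assume "i \<in> {0..n_lev l}" "j \<in> {0..n_lev l}"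
      and eq: "cos (real i * pi / real (n_lev l)) = cos (real j * pi / real (n_lev l))"
    then have "real i * pi / real (n_lev l) = real j * pi / real (n_lev l)"
      using n_lev_pos[of l] by (intro cos_inj_pi[OF _ _ _ _ eq]) (auto simp: field_simps)
    then show "i = j" using n_lev_pos[of l] by simp
  qed
  then show ?thesis using assms unfolding grid_def by (simp add: card_image)
qed

lemma card_grid_1: "card (grid 1) = 1"
  unfolding grid_def by simp

lemma poly_eq_on_finite_set:
  fixes p q :: "'a::idom poly"
  assumes "finite A" "card A > n" "degree p \<le> n" "degree q \<le> n" "\<And>x. x \<in> A \<Longrightarrow> poly p x = poly q x"
  shows "p = q"
proof (rule ccontr)
  assume "p \<noteq> q"
  then have nz: "p - q \<noteq> 0" by simp
  have "card A \<le> card {x. poly (p - q) x = 0}"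
    using assms(5) by (intro card_mono poly_roots_finite[OF nz]) auto
  also have "\<dots> \<le> degree (p - q)" using card_poly_roots_bound[OF nz] .
  also have "\<dots> \<le> n" using assms by (intro degree_diff_le)
  finally show False using assms(2) by simp
qed

lemma poly_lagrange_basis_of_real:
  "poly (lagrange_basis (complex_of_real ` A) (complex_of_real x)) (complex_of_real t)
    = complex_of_real (poly (lagrange_basis A x) t)"
proof -
  have "complex_of_real ` A - {complex_of_real x} = complex_of_real ` (A - {x})" by auto
  then show ?thesis unfolding lagrange_basis_def poly_prod
    by (simp add: prod.reindex inj_on_def poly_prod)
qed

text \<open>Valid at level 1 too, where the basis polynomial on \<open>{0}\<close> is an empty
  product. At higher levels the \<open>n_lev l + 1\<close> distinct nodes make the polynomial in the
  definite description unique.\<close>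

lemma Q1_eq_lagrange:
  assumes "l \<ge> 1"
  shows "Q1 l g t = (\<Sum>x\<in>grid l. g x * complex_of_real (poly (lagrange_basis (grid l) x) t))"
proof (cases "l = 1")
  case True
  then show ?thesis unfolding Q1_def by (simp add: grid_def lagrange_basis_def)
next
  case False
  let ?A = "complex_of_real ` grid l"
  let ?P = "lagrange_interpolant ?A (\<lambda>z. g (Re z))"
  have fin: "finite ?A" using finite_grid by blast
  have card: "card ?A = n_lev l + 1"
    using card_grid[OF False] by (simp add: card_image inj_on_def)
  have dP: "degree ?P \<le> n_lev l"
    using degree_lagrange_interpolant[OF fin, of "\<lambda>z. g (Re z)"] card by simp
  have "(THE P. degree P \<le> n_lev l \<and> (\<forall>x\<in>grid l. poly P (complex_of_real x) = g x)) = ?P"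
  proof (rule the_equality)
    show "degree ?P \<le> n_lev l \<and> (\<forall>x\<in>grid l. poly ?P (complex_of_real x) = g x)"
      using dP fin by (simp add: poly_lagrange_interpolant)
    show "P = ?P" if "degree P \<le> n_lev l \<and> (\<forall>x\<in>grid l. poly P (complex_of_real x) = g x)" for P
      by (rule poly_eq_on_finite_set[OF fin, of "n_lev l"])
         (use that dP card fin in \<open>auto simp: poly_lagrange_interpolant\<close>)
  qed
  then have "Q1 l g t = poly ?P (complex_of_real t)"
    unfolding Q1_def using assms False by simp
  also have "\<dots> = (\<Sum>x\<in>grid l. g x * complex_of_real (poly (lagrange_basis (grid l) x) t))"
    unfolding lagrange_interpolant_def poly_sum
    by (simp add: sum.reindex inj_on_def poly_lagrange_basis_of_real)
  finally show ?thesis .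
qed

lemma Q1_eq_poly:
  assumes "l \<ge> 1"
  shows "Q1 l g t = Complex (poly (lagrange_interpolant (grid l) (\<lambda>x. Re (g x))) t)
                            (poly (lagrange_interpolant (grid l) (\<lambda>x. Im (g x))) t)"
  unfolding Q1_eq_lagrange[OF assms] lagrange_interpolant_def poly_sum
  by (simp add: complex_eq_iff)

section \<open>Jets in one variable and oscillatory integrals\<close>

text \<open>The derivatives are carried as data. An operator that commutes with differentiation then
  maps a jet to a jet entry by entry.\<close>

definition smooth_jet :: "nat \<Rightarrow> (nat \<Rightarrow> real \<Rightarrow> complex) \<Rightarrow> real \<Rightarrow> bool" where
  "smooth_jet p g M \<longleftrightarrow>
    (\<forall>i<p. \<forall>t\<in>{-1..1}. (g i has_vector_derivative g (Suc i) t) (at t within {-1..1})) \<and>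
    (\<forall>i\<le>p. continuous_on {-1..1} (g i)) \<and>
    (\<forall>i\<le>p. \<forall>t\<in>{-1..1}. cmod (g i t) \<le> M)"

lemma smooth_jetD:
  assumes "smooth_jet p g M"
  shows "\<And>i t. i < p \<Longrightarrow> t \<in> {-1..1} \<Longrightarrow> (g i has_vector_derivative g (Suc i) t) (at t within {-1..1})"
    and "\<And>i. i \<le> p \<Longrightarrow> continuous_on {-1..1} (g i)"
    and "\<And>i t. i \<le> p \<Longrightarrow> t \<in> {-1..1} \<Longrightarrow> cmod (g i t) \<le> M"
  using assms unfolding smooth_jet_def by blast+

lemma smooth_jet_nonneg: "smooth_jet p g M \<Longrightarrow> M \<ge> 0"
  using smooth_jetD(3)[of p g M 0 0] order_trans[OF norm_ge_zero[of "g 0 0"]] by simp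

lemma has_vector_derivative_cis:
  "((\<lambda>t. cis (\<sigma> * t)) has_vector_derivative \<i> * complex_of_real \<sigma> * cis (\<sigma> * t)) (at t within S)"
  unfolding has_vector_derivative_def
  by (auto intro!: derivative_eq_intros simp: scaleR_conv_of_real mult_ac)

text \<open>Since (s cis)' = (s' + i \<sigma> s) cis, differentiating the product amounts to
  applying \<open>S\<close> to the jet of the first factor. Each application at most doubles the
  bound, because \<open>\<bar>\<sigma>\<bar> \<le> 1\<close>, and uses up one order; hence
  \<open>2 ^ p\<close>.\<close>

lemma smooth_jet_mult_cis:
  assumes g: "smooth_jet p g M" and \<sigma>: "\<bar>\<sigma>\<bar> \<le> 1"
  obtains h where "h 0 = (\<lambda>t. g 0 t * cis (\<sigma> * t))" "smooth_jet p h (2 ^ p * M)"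
proof -
  define S where "S s = (\<lambda>i t. s (Suc i) t + \<i> * complex_of_real \<sigma> * s i t)"
    for s :: "nat \<Rightarrow> real \<Rightarrow> complex"
  have step: "smooth_jet q (S s) (2 * K)" if s: "smooth_jet (Suc q) s K" for q s K
    unfolding smooth_jet_def
  proof (intro conjI allI impI ballI)
    fix i t assume "i < q" "t \<in> {-1..1::real}"
    then show "(S s i has_vector_derivative S s (Suc i) t) (at t within {-1..1})"
      unfolding S_def using smooth_jetD(1)[OF s]
      by (intro has_vector_derivative_add has_vector_derivative_mult_right) auto
  next
    fix i assume "i \<le> q"
    then show "continuous_on {-1..1} (S s i)"
      unfolding S_def using smooth_jetD(2)[OF s] by (intro continuous_intros) auto
  next
    fix i t assume i: "i \<le> q" and t: "t \<in> {-1..1::real}"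
    have "cmod (S s i t) \<le> cmod (s (Suc i) t) + \<bar>\<sigma>\<bar> * cmod (s i t)"
      unfolding S_def by (rule norm_triangle_le) (simp add: norm_mult)
    also have "\<dots> \<le> K + 1 * K"
      using smooth_jetD(3)[OF s, of "Suc i" t] smooth_jetD(3)[OF s, of i t] i t \<sigma>
      by (intro add_mono mult_mono) auto
    finally show "cmod (S s i t) \<le> 2 * K" by simp
  qed
  have it: "smooth_jet (p - i) ((S ^^ i) g) (2 ^ i * M)" if "i \<le> p" for i
    using that
  proof (induction i)
    case (Suc i)
    then show ?case using step[of "p - Suc i" "(S ^^ i) g" "2 ^ i * M"]
      by (simp add: Suc_diff_Suc mult.assoc)
  qed (use g in simp)
  let ?h = "\<lambda>i t. (S ^^ i) g 0 t * cis (\<sigma> * t)"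
  have "smooth_jet p ?h (2 ^ p * M)"
    unfolding smooth_jet_def
  proof (intro conjI allI impI ballI)
    fix i t assume i: "i < p" and t: "t \<in> {-1..1::real}"
    have "((S ^^ i) g 0 has_vector_derivative (S ^^ i) g 1 t) (at t within {-1..1})"
      using smooth_jetD(1)[OF it[of i], of 0 t] i t by simp
    from has_vector_derivative_mult[OF this has_vector_derivative_cis[of \<sigma> t]]
    show "(?h i has_vector_derivative ?h (Suc i) t) (at t within {-1..1})"
      by (simp add: S_def algebra_simps)
  next
    fix i assume "i \<le> p"
    then show "continuous_on {-1..1} (?h i)"
      using smooth_jetD(2)[OF it, of i 0] by (intro continuous_intros) auto
  next
    fix i t assume i: "i \<le> p" and t: "t \<in> {-1..1::real}"
    have "cmod (?h i t) \<le> 2 ^ i * M"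
      using smooth_jetD(3)[OF it[OF i], of 0 t] t by (simp add: norm_mult)
    also have "\<dots> \<le> 2 ^ p * M"
      using i smooth_jet_nonneg[OF g] by (intro mult_right_mono power_increasing) auto
    finally show "cmod (?h i t) \<le> 2 ^ p * M" .
  qed
  then show thesis by (intro that[of ?h]) auto
qed

definition freq_factor :: "real \<Rightarrow> real" where
  "freq_factor \<tau> = (if \<bar>\<tau>\<bar> \<ge> 1 then 1 / \<bar>\<tau>\<bar> else 1)"

lemma freq_factor_pos: "freq_factor \<tau> > 0"
  unfolding freq_factor_def by auto

text \<open>For \<open>\<bar>\<tau>\<bar> \<ge> 1\<close> this is integration by parts. For
  \<open>\<tau> = 0\<close> nothing oscillates, and the value at -1 plus the total variation bounds
  \<open>G\<close> pointwise; the length of the interval gives the factor 2. The same right-hand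
  side serves both cases.\<close>

lemma oscillatory_integral_bound:
  fixes G G' :: "real \<Rightarrow> complex"
  assumes dG: "\<And>t. t \<in> {-1..1} \<Longrightarrow> (G has_vector_derivative G' t) (at t within {-1..1})"
    and cG': "continuous_on {-1..1} G'"
    and \<tau>: "\<bar>\<tau>\<bar> \<ge> 1 \<or> \<tau> = 0"
  shows "cmod (integral {-1..1} (\<lambda>t. G t * cis (\<tau> * t)))
    \<le> 2 * freq_factor \<tau> * (cmod (G 1) + cmod (G (-1)) + integral {-1..1} (\<lambda>t. cmod (G' t)))"
proof -
  let ?V = "integral {-1..1} (\<lambda>t. cmod (G' t))"
  have cG: "continuous_on {-1..1} G"
    by (rule continuous_on_vector_derivative) (use dG in auto)
  have V0: "?V \<ge> 0" by (intro integral_nonneg integrable_continuous_real continuous_intros cG') auto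
  show ?thesis
  proof (cases "\<tau> = 0")
    case True
    have "cmod (G t) \<le> cmod (G (-1)) + ?V" if t: "t \<in> {-1..1}" for t
    proof -
      have "(G' has_integral (G t - G (-1))) {-1..t}"
        using t by (intro fundamental_theorem_of_calculus)
          (auto intro!: has_vector_derivative_within_subset[OF dG])
      then have "cmod (G t - G (-1)) = cmod (integral {-1..t} G')" by (simp add: integral_unique)
      also have "\<dots> \<le> integral {-1..t} (\<lambda>t. cmod (G' t))"
        using t continuous_on_subset[OF cG', of "{-1..t}"]
        by (intro integral_norm_bound_integral integrable_continuous_real continuous_intros) auto
      also have "\<dots> \<le> ?V"
        using t continuous_on_subset[OF cG', of "{-1..t}"] cG'
        by (intro integral_subset_le integrable_continuous_real continuous_intros) auto
      finally show ?thesis using norm_triangle_sub[of "G t" "G (-1)"] by linarith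
    qed
    then have "cmod (integral {-1..1} G) \<le> integral {-1..1} (\<lambda>t::real. cmod (G (-1)) + ?V)"
      using integral_norm_bound_integral[of G "{-1..1}" "\<lambda>t. cmod (G (-1)) + ?V"] cG
      by (auto intro: integrable_continuous_real)
    also have "\<dots> = 2 * (cmod (G (-1)) + ?V)" by simp
    also have "\<dots> \<le> 2 * (cmod (G 1) + cmod (G (-1)) + ?V)" by simp
    finally show ?thesis using True by (simp add: freq_factor_def)
  next
    case False
    then have t1: "\<bar>\<tau>\<bar> \<ge> 1" using \<tau> by simp
    have "((\<lambda>t. G t * (\<i> * complex_of_real \<tau> * cis (\<tau> * t)) + G' t * cis (\<tau> * t)) has_integral
       (G 1 * cis (\<tau> * 1) - G (-1) * cis (\<tau> * (-1)))) {-1..1}"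
      by (intro fundamental_theorem_of_calculus has_vector_derivative_mult dG has_vector_derivative_cis) auto
    moreover have "((\<lambda>t. G' t * cis (\<tau> * t)) has_integral integral {-1..1} (\<lambda>t. G' t * cis (\<tau> * t))) {-1..1}"
      using cG' by (intro integrable_integral integrable_continuous_real continuous_intros)
    ultimately have "((\<lambda>t. (G t * (\<i> * complex_of_real \<tau> * cis (\<tau> * t)) + G' t * cis (\<tau> * t)) - G' t * cis (\<tau> * t))
       has_integral (G 1 * cis (\<tau> * 1) - G (-1) * cis (\<tau> * (-1)) - integral {-1..1} (\<lambda>t. G' t * cis (\<tau> * t)))) {-1..1}"
      by (rule has_integral_diff)
    then have "((\<lambda>t. \<i> * complex_of_real \<tau> * (G t * cis (\<tau> * t)))
       has_integral (G 1 * cis (\<tau> * 1) - G (-1) * cis (\<tau> * (-1)) - integral {-1..1} (\<lambda>t. G' t * cis (\<tau> * t)))) {-1..1}"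
      by (simp add: mult_ac)
    then have "integral {-1..1} (\<lambda>t. \<i> * complex_of_real \<tau> * (G t * cis (\<tau> * t)))
       = G 1 * cis (\<tau> * 1) - G (-1) * cis (\<tau> * (-1)) - integral {-1..1} (\<lambda>t. G' t * cis (\<tau> * t))"
      by (rule integral_unique)
    then have "\<i> * complex_of_real \<tau> * integral {-1..1} (\<lambda>t. G t * cis (\<tau> * t))
       = G 1 * cis (\<tau> * 1) - G (-1) * cis (\<tau> * (-1)) - integral {-1..1} (\<lambda>t. G' t * cis (\<tau> * t))"
      by (simp only: Henstock_Kurzweil_Integration.integral_mult_right)
    then have "\<bar>\<tau>\<bar> * cmod (integral {-1..1} (\<lambda>t. G t * cis (\<tau> * t)))
       = cmod (G 1 * cis (\<tau> * 1) - G (-1) * cis (\<tau> * (-1)) - integral {-1..1} (\<lambda>t. G' t * cis (\<tau> * t)))"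
      by (metis norm_mult norm_ii norm_of_real mult_1)
    also have "\<dots> \<le> cmod (G 1 * cis (\<tau> * 1)) + cmod (G (-1) * cis (\<tau> * (-1)))
        + cmod (integral {-1..1} (\<lambda>t. G' t * cis (\<tau> * t)))"
      by (intro order_trans[OF norm_triangle_ineq4] add_mono norm_triangle_ineq4 order_refl)
    also have "\<dots> \<le> cmod (G 1) + cmod (G (-1)) + ?V"
      using cG' by (intro add_mono integral_norm_bound_integral integrable_continuous_real continuous_intros)
        (auto simp: norm_mult)
    finally have "cmod (integral {-1..1} (\<lambda>t. G t * cis (\<tau> * t))) \<le> (cmod (G 1) + cmod (G (-1)) + ?V) / \<bar>\<tau>\<bar>"
      using t1 by (simp add: field_simps)
    also have "\<dots> \<le> 2 * freq_factor \<tau> * (cmod (G 1) + cmod (G (-1)) + ?V)"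
      using t1 V0 by (simp add: freq_factor_def field_simps)
    finally show ?thesis .
  qed
qed

section \<open>Functionals combining point evaluations and an integral\<close>

text \<open>One class for all functionals of the proof: the exact integral has \<open>w = 0\<close>,
  level differences have \<open>e = 0\<close>, and a quadrature error has both parts.\<close>

definition functional :: "real set \<Rightarrow> (real \<Rightarrow> complex) \<Rightarrow> (real \<Rightarrow> complex) \<Rightarrow> (real \<Rightarrow> complex) \<Rightarrow> complex" where
  "functional X w e g = (\<Sum>x\<in>X. w x * g x) + integral {-1..1} (\<lambda>t. e t * g t)"

definition functional_bound :: "nat \<Rightarrow> real set \<Rightarrow> (real \<Rightarrow> complex) \<Rightarrow> (real \<Rightarrow> complex) \<Rightarrow> real \<Rightarrow> bool" where
  "functional_bound p X w e b \<longleftrightarrow> (\<forall>g M. smooth_jet p g M \<longrightarrow> cmod (functional X w e (g 0)) \<le> b * M)"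

lemma functional_diff:
  assumes "continuous_on {-1..1} g" "continuous_on {-1..1} e" "continuous_on {-1..1} e'"
  shows "functional X (\<lambda>x. w x - w' x) (\<lambda>t. e t - e' t) g = functional X w e g - functional X w' e' g"
proof -
  have "integral {-1..1} (\<lambda>t. (e t - e' t) * g t)
      = integral {-1..1} (\<lambda>t. e t * g t) - integral {-1..1} (\<lambda>t. e' t * g t)"
    unfolding left_diff_distrib using assms
    by (intro Henstock_Kurzweil_Integration.integral_diff integrable_continuous_real continuous_intros)
  then show ?thesis unfolding functional_def by (simp add: left_diff_distrib sum_subtractf)
qed

text \<open>Here \<open>\<tau>\<close> and \<open>\<sigma>\<close> stand for \<open>k * a_tilde k a j\<close> and \<open>k * a_hat k a j\<close>.\<close>

definition quad_weight :: "real \<Rightarrow> real \<Rightarrow> nat \<Rightarrow> real \<Rightarrow> complex" where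
  "quad_weight \<tau> \<sigma> l x = (if l \<ge> 1 \<and> x \<in> grid l
     then integral {-1..1} (\<lambda>t. complex_of_real (poly (lagrange_basis (grid l) x) t) * cis (\<tau> * t)) * cis (\<sigma> * x)
     else 0)"

text \<open>The wave with frequency \<open>\<sigma>\<close> sits in the weights, so the rule is a
  combination of values of \<open>g\<close> itself. Weights vanish off the grid and at level 0,
  which lets all levels share one node set \<open>X\<close>.\<close>

lemma sum_quad_weight:
  assumes "finite X" "l \<ge> 1 \<Longrightarrow> grid l \<subseteq> X"
  shows "(\<Sum>x\<in>X. quad_weight \<tau> \<sigma> l x * g x) = integral {-1..1} (\<lambda>t. Q1 l (\<lambda>t. g t * cis (\<sigma> * t)) t * cis (\<tau> * t))"
proof (cases "l \<ge> 1")
  case True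
  have "(\<Sum>x\<in>X. quad_weight \<tau> \<sigma> l x * g x) = (\<Sum>x\<in>grid l. quad_weight \<tau> \<sigma> l x * g x)"
    using assms True by (intro sum.mono_neutral_right) (auto simp: quad_weight_def)
  also have "\<dots> = (\<Sum>x\<in>grid l. integral {-1..1} (\<lambda>t. g x * cis (\<sigma> * x) *
      (complex_of_real (poly (lagrange_basis (grid l) x) t) * cis (\<tau> * t))))"
    using True by (intro sum.cong refl) (simp add: quad_weight_def)
  also have "\<dots> = integral {-1..1} (\<lambda>t. \<Sum>x\<in>grid l. g x * cis (\<sigma> * x) *
      (complex_of_real (poly (lagrange_basis (grid l) x) t) * cis (\<tau> * t)))"
    using finite_grid by (intro integral_sum[symmetric] integrable_continuous_real continuous_intros)
  also have "\<dots> = integral {-1..1} (\<lambda>t. Q1 l (\<lambda>t. g t * cis (\<sigma> * t)) t * cis (\<tau> * t))"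
    by (simp add: Q1_eq_lagrange[OF True] sum_distrib_right mult.assoc)
  finally show ?thesis .
qed (simp add: quad_weight_def Q1_def)

lemma Re_Im_jet:
  assumes "smooth_jet p g M" "f = Re \<or> f = Im"
  shows "\<And>i t. i < p \<Longrightarrow> t \<in> {-1..1} \<Longrightarrow> ((\<lambda>t. f (g i t)) has_real_derivative f (g (Suc i) t)) (at t within {-1..1})"
    and "\<And>i. i \<le> p \<Longrightarrow> continuous_on {-1..1} (\<lambda>t. f (g i t))"
    and "\<And>i t. i \<le> p \<Longrightarrow> t \<in> {-1..1} \<Longrightarrow> \<bar>f (g i t)\<bar> \<le> M"
proof -
  have bl: "bounded_linear f" using assms(2) bounded_linear_Re bounded_linear_Im by blast
  show "((\<lambda>t. f (g i t)) has_real_derivative f (g (Suc i) t)) (at t within {-1..1})" if "i < p" "t \<in> {-1..1}" for i t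
    using bounded_linear.has_vector_derivative[OF bl smooth_jetD(1)[OF assms(1) that]]
    by (simp add: has_real_derivative_iff_has_vector_derivative)
  show "continuous_on {-1..1} (\<lambda>t. f (g i t))" if "i \<le> p" for i
    by (intro bounded_linear.continuous_on[OF bl] smooth_jetD(2)[OF assms(1) that])
  show "\<bar>f (g i t)\<bar> \<le> M" if "i \<le> p" "t \<in> {-1..1}" for i t
    using smooth_jetD(3)[OF assms(1) that] abs_Re_le_cmod[of "g i t"] abs_Im_le_cmod[of "g i t"] assms(2)
    by auto
qed

text \<open>The real estimate is applied to real and imaginary parts, whence the factor 2. At levels
  \<open>l \<ge> 2\<close> the points 1 and -1 are the nodes with \<open>j = 0\<close> and
  \<open>j = n_lev l\<close>.\<close>

lemma Q1_error_L1:
  assumes g: "smooth_jet p g M" and p: "p \<ge> 1" and l: "l \<ge> 2"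
  obtains R' where
    "\<And>t. t \<in> {-1..1} \<Longrightarrow> ((\<lambda>t. g 0 t - Q1 l (g 0) t) has_vector_derivative R' t) (at t within {-1..1})"
    "continuous_on {-1..1} R'" "g 0 1 = Q1 l (g 0) 1" "g 0 (-1) = Q1 l (g 0) (-1)"
    "integral {-1..1} (\<lambda>t. cmod (R' t)) \<le> 2 * interp_const p / real (n_lev l) ^ (p - 1) * M"
proof -
  define P where "P f = lagrange_interpolant (grid l) (\<lambda>x. f (g 0 x))" for f :: "complex \<Rightarrow> real"
  let ?D = "\<lambda>f t. f (g 1 t) - poly (pderiv (P f)) t"
  define R' where "R' t = complex_of_real (?D Re t) + \<i> * complex_of_real (?D Im t)" for t
  have Q: "Q1 l (g 0) t = complex_of_real (poly (P Re) t) + \<i> * complex_of_real (poly (P Im) t)" for t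
    using l by (simp add: Q1_eq_poly P_def complex_eq_iff)
  have grid: "grid l = (\<lambda>j. cos (real j * pi / real (n_lev l))) ` {0..n_lev l}"
    using l by (simp add: grid_def)
  have nodes: "poly (P f) (cos (real j * pi / real (n_lev l))) = f (g 0 (cos (real j * pi / real (n_lev l))))"
    if "j \<le> n_lev l" for f j
    unfolding P_def using that by (intro poly_lagrange_interpolant finite_grid) (auto simp: grid)
  have ends: "poly (P f) 1 = f (g 0 1)" "poly (P f) (-1) = f (g 0 (-1))" for f
    using nodes[of 0 f] nodes[of "n_lev l" f] n_lev_pos[of l] by simp_all
  have D: "integral {-1..1} (\<lambda>t. \<bar>?D f t\<bar>) \<le> interp_const p / real (n_lev l) ^ (p - 1) * M"
    and cD: "continuous_on {-1..1} (?D f)"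
    and dD: "\<And>t. t \<in> {-1..1} \<Longrightarrow> ((\<lambda>t. f (g 0 t) - poly (P f) t) has_vector_derivative ?D f t) (at t within {-1..1})"
    if f: "f = Re \<or> f = Im" for f
  proof -
    note J = Re_Im_jet[OF g f]
    have deg: "degree (P f) \<le> n_lev l"
      unfolding P_def using degree_lagrange_interpolant[OF finite_grid, of l] card_grid[of l] l
      by (metis One_nat_def Suc_1 Suc_n_not_le_n add_diff_cancel_right')
    show "integral {-1..1} (\<lambda>t. \<bar>?D f t\<bar>) \<le> interp_const p / real (n_lev l) ^ (p - 1) * M"
      by (rule interpolation_error_L1[where h = "\<lambda>i t. f (g i t)", OF p n_lev_pos smooth_jet_nonneg[OF g]])
        (use J nodes deg in auto)
    show "continuous_on {-1..1} (?D f)"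
      using J(2)[of 1] p by (intro continuous_intros) auto
    show "((\<lambda>t. f (g 0 t) - poly (P f) t) has_vector_derivative ?D f t) (at t within {-1..1})"
      if "t \<in> {-1..1}" for t
      using J(1)[of 0 t] that p
      by (auto simp: has_real_derivative_iff_has_vector_derivative[symmetric]
          intro!: DERIV_diff DERIV_subset[OF poly_DERIV])
  qed
  have "((\<lambda>t. complex_of_real (Re (g 0 t) - poly (P Re) t) + \<i> * complex_of_real (Im (g 0 t) - poly (P Im) t))
      has_vector_derivative R' t) (at t within {-1..1})" if "t \<in> {-1..1}" for t
    unfolding R'_def using dD[of Re t] dD[of Im t] that
    by (intro has_vector_derivative_add has_vector_derivative_mult_right has_vector_derivative_of_real)
      (auto simp: has_real_derivative_iff_has_vector_derivative)
  moreover have "complex_of_real (Re (g 0 t) - poly (P Re) t) + \<i> * complex_of_real (Im (g 0 t) - poly (P Im) t)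
     = g 0 t - Q1 l (g 0) t" for t
    unfolding Q by (simp add: complex_eq_iff)
  ultimately have d: "((\<lambda>t. g 0 t - Q1 l (g 0) t) has_vector_derivative R' t) (at t within {-1..1})"
    if "t \<in> {-1..1}" for t
    using that by simp
  have c: "continuous_on {-1..1} R'"
    unfolding R'_def by (intro continuous_on_add continuous_on_mult continuous_on_const continuous_on_of_real cD) auto
  have "integral {-1..1} (\<lambda>t. cmod (R' t)) \<le> integral {-1..1} (\<lambda>t. \<bar>?D Re t\<bar> + \<bar>?D Im t\<bar>)"
  proof (intro integral_le integrable_continuous_real continuous_on_norm c continuous_on_add)
    show "cmod (R' t) \<le> \<bar>?D Re t\<bar> + \<bar>?D Im t\<bar>" for t
      using cmod_le[of "R' t"] by (simp add: R'_def)
  qed (use cD[of Re] cD[of Im] in \<open>auto intro: continuous_on_rabs\<close>)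
  also have "\<dots> = integral {-1..1} (\<lambda>t. \<bar>?D Re t\<bar>) + integral {-1..1} (\<lambda>t. \<bar>?D Im t\<bar>)"
    using cD[of Re] cD[of Im]
    by (intro Henstock_Kurzweil_Integration.integral_add integrable_continuous_real continuous_on_rabs) auto
  also have "\<dots> \<le> 2 * interp_const p / real (n_lev l) ^ (p - 1) * M"
    using add_mono[OF D[of Re] D[of Im]] by (simp add: algebra_simps)
  finally have b: "integral {-1..1} (\<lambda>t. cmod (R' t)) \<le> 2 * interp_const p / real (n_lev l) ^ (p - 1) * M" .
  show thesis
    by (rule that[OF d c _ _ b]) (simp_all add: Q ends complex_eq_iff)
qed

text \<open>The gain per level: \<open>decay p ^ l\<close> is 2^(-(p-1)l), and equals 1 throughout
  when \<open>p = 1\<close>.\<close>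

definition decay :: "nat \<Rightarrow> real" where "decay p = (1 / 2) ^ (p - 1)"

lemma decay_bounds: "0 < decay p" "decay p \<le> 1"
  unfolding decay_def by (simp_all add: power_le_one)

text \<open>The leading 2 comes from \<open>oscillatory_integral_bound\<close>,
  \<open>2 * interp_const p\<close> from levels at least 2, while 12 dominates the 6 that arises at
  levels 0 and 1. \<open>2 ^ p\<close> is the cost of the factor \<open>cis\<close>, and
  \<open>2 ^ (p - 1)\<close> that of passing from \<open>n_lev l\<close> to
  \<open>2 ^ l\<close>.\<close>

definition error_const :: "nat \<Rightarrow> real" where
  "error_const p = 2 * (12 + 2 * interp_const p) * 2 ^ p * 2 ^ (p - 1)"

lemma error_const_ge_1: "error_const p \<ge> 1"
proof -
  have "interp_const p \<ge> 0" unfolding interp_const_def using jackson_const_ge_1 by simp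
  then have "1 * 1 * 1 \<le> 2 * (12 + 2 * interp_const p) * 2 ^ p * 2 ^ (p - 1)"
    by (intro mult_mono) auto
  then show ?thesis unfolding error_const_def by simp
qed

lemma quadrature_error_bound:
  assumes p: "p \<ge> 1" and \<sigma>: "\<bar>\<sigma>\<bar> \<le> 1" and \<tau>: "\<bar>\<tau>\<bar> \<ge> 1 \<or> \<tau> = 0"
    and X: "finite X" "l \<ge> 1 \<Longrightarrow> grid l \<subseteq> X"
  shows "functional_bound p X (\<lambda>x. - quad_weight \<tau> \<sigma> l x) (\<lambda>t. cis ((\<tau> + \<sigma>) * t))
    (error_const p * freq_factor \<tau> * decay p ^ l)"
  unfolding functional_bound_def
proof (intro allI impI)
  fix g M assume g: "smooth_jet p g M"
  obtain h where h0: "h 0 = (\<lambda>t. g 0 t * cis (\<sigma> * t))" and h: "smooth_jet p h (2 ^ p * M)"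
    using smooth_jet_mult_cis[OF g \<sigma>] .
  define R where "R t = h 0 t - Q1 l (h 0) t" for t
  have ic: "interp_const p \<ge> 0" unfolding interp_const_def using jackson_const_ge_1 by simp
  have M: "2 ^ p * M \<ge> 0" using smooth_jet_nonneg[OF h] .
  obtain R' where R': "\<And>t. t \<in> {-1..1} \<Longrightarrow> (R has_vector_derivative R' t) (at t within {-1..1})"
    "continuous_on {-1..1} R'"
    "cmod (R 1) + cmod (R (-1)) + integral {-1..1} (\<lambda>t. cmod (R' t))
       \<le> (12 + 2 * interp_const p) * 2 ^ (p - 1) * decay p ^ l * (2 ^ p * M)"
  proof (cases "l \<ge> 2")
    case True
    have "decay p ^ l * 2 ^ (p - 1) = 1 / real (n_lev l) ^ (p - 1)"
    proof -
      have "(2::real) ^ l = 2 * real (n_lev l)" unfolding n_lev_def using True by (cases l) auto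
      then have "((1::real) / 2) ^ l = 1 / (2 * real (n_lev l))" by (simp add: power_one_over)
      moreover have "decay p ^ l = ((1 / 2) ^ l) ^ (p - 1)"
        unfolding decay_def by (simp only: power_mult[symmetric] mult.commute)
      ultimately show ?thesis by (simp add: power_mult_distrib power_divide)
    qed
    then have e: "2 * interp_const p / real (n_lev l) ^ (p - 1) * (2 ^ p * M)
        = 2 * interp_const p * (2 ^ (p - 1) * decay p ^ l * (2 ^ p * M))"
      by (simp add: mult_ac)
    show thesis
    proof (rule Q1_error_L1[OF h p True], rule that)
      fix S' assume "integral {-1..1} (\<lambda>t. cmod (S' t)) \<le> 2 * interp_const p / real (n_lev l) ^ (p - 1) * (2 ^ p * M)"
        "h 0 1 = Q1 l (h 0) 1" "h 0 (-1) = Q1 l (h 0) (-1)"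
      then have "cmod (R 1) + cmod (R (-1)) + integral {-1..1} (\<lambda>t. cmod (S' t))
          \<le> 2 * interp_const p * (2 ^ (p - 1) * decay p ^ l * (2 ^ p * M))"
        unfolding e by (simp add: R_def)
      also have "\<dots> \<le> (12 + 2 * interp_const p) * (2 ^ (p - 1) * decay p ^ l * (2 ^ p * M))"
        using smooth_jet_nonneg[OF g] decay_bounds[of p] by (intro mult_right_mono mult_nonneg_nonneg) auto
      finally show "cmod (R 1) + cmod (R (-1)) + integral {-1..1} (\<lambda>t. cmod (S' t))
          \<le> (12 + 2 * interp_const p) * 2 ^ (p - 1) * decay p ^ l * (2 ^ p * M)" by (simp only: mult.assoc)
    qed (auto simp: R_def[abs_def])
  next
    case False
    have "decay p * 2 ^ (p - 1) = 1" unfolding decay_def by (simp add: power_divide)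
    moreover have "decay p \<le> decay p ^ l"
      using False decay_bounds[of p] power_decreasing[of l 1 "decay p"] by simp
    ultimately have d: "1 \<le> 2 ^ (p - 1) * decay p ^ l"
      by (metis mult.commute mult_right_mono zero_le_numeral zero_le_power)
    \<comment> \<open>The constant value of the interpolant at levels 0 and 1; the error then has
      derivative \<open>h 1\<close>.\<close>
    define c where "c = (if l = 1 then h 0 0 else 0)"
    have R: "R = (\<lambda>t. h 0 t - c)"
      using False by (auto simp: R_def c_def Q1_def le_Suc_eq numeral_2_eq_2)
    have hb: "cmod (h i t) \<le> 2 ^ p * M" if "i \<le> p" "t \<in> {-1..1}" for i t
      using smooth_jetD(3)[OF h that] .
    have cb: "cmod c \<le> 2 ^ p * M" unfolding c_def using hb[of 0 0] M by auto
    have Rb: "cmod (R t) \<le> 2 * (2 ^ p * M)" if "t \<in> {-1..1}" for t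
      using norm_triangle_ineq4[of "h 0 t" c] hb[of 0 t] that cb unfolding R by auto
    show thesis
    proof (rule that[of "h 1"])
      show "(R has_vector_derivative h 1 t) (at t within {-1..1})" if "t \<in> {-1..1}" for t
        unfolding R using smooth_jetD(1)[OF h, of 0 t] that p
        by (auto intro: has_vector_derivative_diff_const[THEN iffD2])
      show c1: "continuous_on {-1..1} (h 1)" using smooth_jetD(2)[OF h, of 1] p by simp
      have "integral {-1..1} (\<lambda>t. cmod (h 1 t)) \<le> integral {-1..1} (\<lambda>t::real. 2 ^ p * M)"
        using hb[of 1] p by (intro integral_le integrable_continuous_real continuous_on_norm c1) auto
      \<comment> \<open>6 = 2 + 2 for the endpoint values plus 2 for the length of the
        interval.\<close>
      then have "cmod (R 1) + cmod (R (-1)) + integral {-1..1} (\<lambda>t. cmod (h 1 t)) \<le> 6 * (2 ^ p * M)"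
        using Rb[of 1] Rb[of "-1"] by simp
      also have "\<dots> \<le> (12 + 2 * interp_const p) * (2 ^ p * M)"
        using ic M by (intro mult_right_mono) auto
      also have "\<dots> * 1 \<le> (12 + 2 * interp_const p) * (2 ^ p * M) * (2 ^ (p - 1) * decay p ^ l)"
        using ic smooth_jet_nonneg[OF g] by (intro mult_left_mono d mult_nonneg_nonneg) auto
      finally show "cmod (R 1) + cmod (R (-1)) + integral {-1..1} (\<lambda>t. cmod (h 1 t))
          \<le> (12 + 2 * interp_const p) * 2 ^ (p - 1) * decay p ^ l * (2 ^ p * M)"
        by (simp add: mult_ac)
    qed
  qed
  have ch0: "continuous_on {-1..1} (h 0)" using smooth_jetD(2)[OF h] by simp
  have cQ: "continuous_on {-1..1} (Q1 l (h 0))"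
  proof -
    have "continuous_on {-1..1} R" by (rule continuous_on_vector_derivative) (use R'(1) in auto)
    then have "continuous_on {-1..1} (\<lambda>t. h 0 t - R t)" using ch0 by (intro continuous_intros)
    then show ?thesis unfolding R_def by simp
  qed
  have "functional X (\<lambda>x. - quad_weight \<tau> \<sigma> l x) (\<lambda>t. cis ((\<tau> + \<sigma>) * t)) (g 0)
     = integral {-1..1} (\<lambda>t. h 0 t * cis (\<tau> * t)) - integral {-1..1} (\<lambda>t. Q1 l (h 0) t * cis (\<tau> * t))"
  proof -
    have e: "cis ((\<tau> + \<sigma>) * t) * g 0 t = h 0 t * cis (\<tau> * t)" for t
      using cis_mult[of "\<tau> * t" "\<sigma> * t"] unfolding h0 by (simp add: algebra_simps)
    show ?thesis
      unfolding functional_def e using sum_quad_weight[OF X, of \<tau> \<sigma> "g 0"]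
      by (simp add: h0 sum_negf)
  qed
  also have "\<dots> = integral {-1..1} (\<lambda>t. R t * cis (\<tau> * t))"
    unfolding R_def left_diff_distrib using ch0 cQ
    by (intro Henstock_Kurzweil_Integration.integral_diff[symmetric] integrable_continuous_real continuous_intros)
  finally have "cmod (functional X (\<lambda>x. - quad_weight \<tau> \<sigma> l x) (\<lambda>t. cis ((\<tau> + \<sigma>) * t)) (g 0))
     \<le> 2 * freq_factor \<tau> * (cmod (R 1) + cmod (R (-1)) + integral {-1..1} (\<lambda>t. cmod (R' t)))"
    using oscillatory_integral_bound[OF R'(1,2) \<tau>] by simp
  also have "\<dots> \<le> 2 * freq_factor \<tau> * ((12 + 2 * interp_const p) * 2 ^ (p - 1) * decay p ^ l * (2 ^ p * M))"
    using R'(3) freq_factor_pos[of \<tau>] by (intro mult_left_mono) auto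
  also have "\<dots> = error_const p * freq_factor \<tau> * decay p ^ l * M"
    unfolding error_const_def by (simp add: mult_ac)
  finally show "cmod (functional X (\<lambda>x. - quad_weight \<tau> \<sigma> l x) (\<lambda>t. cis ((\<tau> + \<sigma>) * t)) (g 0))
     \<le> error_const p * freq_factor \<tau> * decay p ^ l * M" .
qed

text \<open>The level difference is a difference of two quadrature errors in which the exact
  integral cancels. Going back one level costs \<open>2 ^ (p - 1)\<close>; for \<open>l = 1\<close>
  the coarser error is the exact integral.\<close>

lemma hierarchical_bound:
  assumes p: "p \<ge> 1" and \<sigma>: "\<bar>\<sigma>\<bar> \<le> 1" and \<tau>: "\<bar>\<tau>\<bar> \<ge> 1 \<or> \<tau> = 0"
    and X: "finite X" "grid l \<subseteq> X" "l \<ge> 2 \<Longrightarrow> grid (l - 1) \<subseteq> X" and l: "l \<ge> 1"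
  shows "functional_bound p X (\<lambda>x. quad_weight \<tau> \<sigma> l x - quad_weight \<tau> \<sigma> (l - 1) x) (\<lambda>t. 0)
    ((1 + 2 ^ (p - 1)) * error_const p * freq_factor \<tau> * decay p ^ l)"
  unfolding functional_bound_def
proof (intro allI impI)
  fix g M assume g: "smooth_jet p g M"
  let ?e = "\<lambda>t. cis ((\<tau> + \<sigma>) * t)"
  have c: "continuous_on {-1..1} (g 0)" using smooth_jetD(2)[OF g] by simp
  have "functional X (\<lambda>x. quad_weight \<tau> \<sigma> l x - quad_weight \<tau> \<sigma> (l - 1) x) (\<lambda>t. 0) (g 0)
     = functional X (\<lambda>x. - quad_weight \<tau> \<sigma> (l - 1) x) ?e (g 0) - functional X (\<lambda>x. - quad_weight \<tau> \<sigma> l x) ?e (g 0)"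
    by (subst functional_diff[symmetric]) (auto intro: c continuous_intros)
  also have "cmod \<dots> \<le> error_const p * freq_factor \<tau> * decay p ^ (l - 1) * M + error_const p * freq_factor \<tau> * decay p ^ l * M"
    using quadrature_error_bound[OF p \<sigma> \<tau> X(1), of "l - 1"] quadrature_error_bound[OF p \<sigma> \<tau> X(1), of l] X l g
    unfolding functional_bound_def
    by (intro order_trans[OF norm_triangle_ineq4] add_mono) auto
  also have "decay p ^ (l - 1) = 2 ^ (p - 1) * decay p ^ l"
  proof -
    have "2 ^ (p - 1) * decay p = 1" unfolding decay_def by (simp add: power_divide)
    then show ?thesis using l by (cases l) (auto simp: mult.assoc[symmetric])
  qed
  finally show "cmod (functional X (\<lambda>x. quad_weight \<tau> \<sigma> l x - quad_weight \<tau> \<sigma> (l - 1) x) (\<lambda>t. 0) (g 0))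
    \<le> (1 + 2 ^ (p - 1)) * error_const p * freq_factor \<tau> * decay p ^ l * M"
    by (simp add: algebra_simps)
qed

subsection \<open>Tensor products of functionals\<close>

lemma cube_upd: "y \<in> cube d \<Longrightarrow> m < d \<Longrightarrow> t \<in> {-1..1} \<Longrightarrow> y(m := t) \<in> cube d"
  unfolding cube_def by (auto simp: PiE_iff extensional_def)

lemma cube_component: "y \<in> cube d \<Longrightarrow> m < d \<Longrightarrow> y m \<in> {-1..1}"
  unfolding cube_def by (auto simp: PiE_iff)

lemma continuous_on_fun_upd:
  fixes h :: "'a::topological_space \<Rightarrow> nat \<Rightarrow> real"
  assumes "continuous_on S h" "continuous_on S u"
  shows "continuous_on S (\<lambda>x. (h x)(m := u x))"
proof (rule continuous_on_coordinatewise_then_product)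
  fix i
  have "continuous_on S (\<lambda>x. h x i)"
    by (rule continuous_on_product_then_coordinatewise[OF assms(1)])
  then show "continuous_on S (\<lambda>x. ((h x)(m := u x)) i)"
    using assms(2) by (cases "i = m") auto
qed

lemma continuous_on_slice:
  assumes "continuous_on (cube d) F" "y \<in> cube d" "m < d"
  shows "continuous_on {-1..1} (\<lambda>t. F (y(m := t)))"
  by (rule continuous_on_compose2[OF assms(1)])
     (use assms cube_upd in \<open>auto intro!: continuous_on_fun_upd continuous_on_const continuous_on_id\<close>)

lemma functional_continuous_on:
  assumes F: "continuous_on (cube d) F" and m: "m < d" and X: "X \<subseteq> {-1..1}"
    and e: "continuous_on {-1..1} e"
  shows "continuous_on (cube d) (\<lambda>y. functional X w e (\<lambda>t. F (y(m := t))))"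
  unfolding functional_def
proof (intro continuous_on_add continuous_on_sum continuous_on_mult continuous_on_const)
  fix x assume "x \<in> X"
  then show "continuous_on (cube d) (\<lambda>y. F (y(m := x)))"
    using m X cube_upd
    by (intro continuous_on_compose2[OF F] continuous_on_fun_upd continuous_on_const continuous_on_id) auto
next
  have "continuous_on (cube d \<times> cbox (-1) 1) (\<lambda>(y, t). e t * F (y(m := t)))"
    unfolding split_beta using m cube_upd
    by (intro continuous_on_mult continuous_on_compose2[OF F] continuous_on_compose2[OF e]
        continuous_on_fun_upd continuous_on_fst continuous_on_snd continuous_on_id) auto
  from integral_continuous_on_param[OF this]
  show "continuous_on (cube d) (\<lambda>y. integral {-1..1} (\<lambda>t. e t * F (y(m := t))))" by simp
qed

section \<open>Mixed smoothness and operators in the first variables\<close>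

definition has_pd :: "nat \<Rightarrow> nat \<Rightarrow> ((nat \<Rightarrow> real) \<Rightarrow> complex) \<Rightarrow> ((nat \<Rightarrow> real) \<Rightarrow> complex) \<Rightarrow> bool" where
  "has_pd d j f f' \<longleftrightarrow> (\<forall>y\<in>cube d. ((\<lambda>t. f (y(j := t))) has_vector_derivative f' y) (at (y j) within {-1..1}))"

lemma has_pdD:
  assumes "has_pd d j f f'" "y \<in> cube d" "j < d" "t \<in> {-1..1}"
  shows "((\<lambda>t. f (y(j := t))) has_vector_derivative f' (y(j := t))) (at t within {-1..1})"
  using assms(1)[unfolded has_pd_def, rule_format, OF cube_upd[OF assms(2-)]] by simp

text \<open>Differentiation under the integral sign: a functional in variable \<open>m\<close>
  commutes with derivatives in every other variable.\<close>

lemma functional_has_pd: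
  assumes F: "continuous_on (cube d) F" and F': "continuous_on (cube d) F'" and pd: "has_pd d j F F'"
    and m: "m < d" and j: "j < d" "j \<noteq> m" and X: "X \<subseteq> {-1..1}"
    and e: "continuous_on {-1..1} e"
  shows "has_pd d j (\<lambda>y. functional X w e (\<lambda>t. F (y(m := t)))) (\<lambda>y. functional X w e (\<lambda>t. F' (y(m := t))))"
  unfolding has_pd_def
proof
  fix y assume y: "y \<in> cube d"
  have pd': "((\<lambda>t. F (y(j := t, m := x))) has_vector_derivative F' (y(j := t, m := x))) (at t within {-1..1})"
    if "x \<in> {-1..1}" "t \<in> {-1..1}" for x t
    using has_pdD[OF pd cube_upd[OF y m that(1)] j(1) that(2)] j(2) by (simp add: fun_upd_twist)
  have yj: "y j \<in> {-1..1}" using cube_component[OF y j(1)] .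
  have "((\<lambda>t. functional X w e (\<lambda>x. F (y(j := t, m := x)))) has_vector_derivative
      functional X w e (\<lambda>x. F' (y(j := y j, m := x)))) (at (y j) within {-1..1})"
    unfolding functional_def
  proof (intro has_vector_derivative_add has_vector_derivative_sum has_vector_derivative_mult_right pd' yj)
    have "((\<lambda>t. integral (cbox (-1) 1) (\<lambda>x. e x * F (y(j := t, m := x)))) has_vector_derivative
        integral (cbox (-1) 1) (\<lambda>x. e x * F' (y(j := y j, m := x)))) (at (y j) within {-1..1})"
    proof (rule leibniz_rule_vector_derivative[OF _ _ _ yj])
      show "((\<lambda>t. e x * F (y(j := t, m := x))) has_vector_derivative e x * F' (y(j := t, m := x))) (at t within {-1..1})"
        if "t \<in> {-1..1}" "x \<in> cbox (-1) 1" for t x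
        using that by (intro has_vector_derivative_mult_right pd') auto
      show "(\<lambda>x. e x * F (y(j := t, m := x))) integrable_on cbox (-1) 1" if "t \<in> {-1..1}" for t
        using continuous_on_slice[OF F cube_upd[OF y j(1) that] m] e
        by (auto intro!: integrable_continuous_real continuous_intros)
      show "continuous_on ({-1..1} \<times> cbox (-1) 1) (\<lambda>(t, x). e x * F' (y(j := t, m := x)))"
        unfolding split_beta using m j y cube_upd
        by (intro continuous_on_mult continuous_on_compose2[OF F'] continuous_on_compose2[OF e]
            continuous_on_fun_upd continuous_on_fst continuous_on_snd continuous_on_id continuous_on_const) auto
    qed simp
    then show "((\<lambda>t. integral {-1..1} (\<lambda>x. e x * F (y(j := t, m := x)))) has_vector_derivative
        integral {-1..1} (\<lambda>x. e x * F' (y(j := y j, m := x)))) (at (y j) within {-1..1})" by simp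
  qed (use X in auto)
  then show "((\<lambda>t. functional X w e (\<lambda>x. F ((y(j := t))(m := x)))) has_vector_derivative
      functional X w e (\<lambda>x. F' (y(m := x)))) (at (y j) within {-1..1})" by simp
qed

text \<open>Only mixed derivatives in which the variables \<open>m - 1, \<dots>, 0\<close> are differentiated in
  this order occur, so no theorem on the symmetry of partial derivatives is needed.\<close>

primrec mixed_smooth :: "nat \<Rightarrow> nat \<Rightarrow> nat \<Rightarrow> ((nat \<Rightarrow> real) \<Rightarrow> complex) \<Rightarrow> real \<Rightarrow> bool" where
  "mixed_smooth d p 0 f M \<longleftrightarrow> continuous_on (cube d) f \<and> (\<forall>y\<in>cube d. cmod (f y) \<le> M)"
| "mixed_smooth d p (Suc m) f M \<longleftrightarrow>
    (\<exists>g. g 0 = f \<and> (\<forall>i\<le>p. mixed_smooth d p m (g i) M) \<and> (\<forall>i<p. has_pd d m (g i) (g (Suc i))))"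

lemma mixed_smooth_0: "mixed_smooth d p m f M \<Longrightarrow> continuous_on (cube d) f \<and> (\<forall>y\<in>cube d. cmod (f y) \<le> M)"
  by (induction m arbitrary: f) auto

lemma cube_nonempty: "cube d \<noteq> {}"
  unfolding cube_def by (auto simp: PiE_eq_empty_iff)

lemma mixed_smooth_nonneg: "mixed_smooth d p m f M \<Longrightarrow> M \<ge> 0"
  using mixed_smooth_0[of d p m f M] cube_nonempty[of d] by (meson ex_in_conv norm_ge_zero order_trans)

text \<open>An operator acting on the variables below \<open>m\<close>. Besides the bound, induction
  over the variables needs continuity of the image and commutation with derivatives in the variables
  from \<open>m\<close> on, which are still to be processed.\<close>

definition bounded_operator ::
    "nat \<Rightarrow> nat \<Rightarrow> nat \<Rightarrow> (((nat \<Rightarrow> real) \<Rightarrow> complex) \<Rightarrow> (nat \<Rightarrow> real) \<Rightarrow> complex) \<Rightarrow> real \<Rightarrow> bool" where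
  "bounded_operator d p m A B \<longleftrightarrow>
    (\<forall>f. continuous_on (cube d) f \<longrightarrow> continuous_on (cube d) (A f)) \<and>
    (\<forall>f f' j. continuous_on (cube d) f \<longrightarrow> continuous_on (cube d) f' \<longrightarrow> m \<le> j \<longrightarrow> j < d \<longrightarrow>
        has_pd d j f f' \<longrightarrow> has_pd d j (A f) (A f')) \<and>
    (\<forall>f M. mixed_smooth d p m f M \<longrightarrow> (\<forall>y\<in>cube d. cmod (A f y) \<le> B * M))"

lemma bounded_operatorD:
  assumes "bounded_operator d p m A B"
  shows "\<And>f. continuous_on (cube d) f \<Longrightarrow> continuous_on (cube d) (A f)"
    and "\<And>f f' j. continuous_on (cube d) f \<Longrightarrow> continuous_on (cube d) f' \<Longrightarrow> m \<le> j \<Longrightarrow> j < d \<Longrightarrow>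
        has_pd d j f f' \<Longrightarrow> has_pd d j (A f) (A f')"
    and "\<And>f M y. mixed_smooth d p m f M \<Longrightarrow> y \<in> cube d \<Longrightarrow> cmod (A f y) \<le> B * M"
  using assms unfolding bounded_operator_def by blast+

lemma bounded_operator_id: "bounded_operator d p 0 (\<lambda>f. f) 1"
  unfolding bounded_operator_def by simp

lemma bounded_operator_zero: "bounded_operator d p m (\<lambda>f y. 0) 0"
  unfolding bounded_operator_def has_pd_def by simp

lemma bounded_operator_mono:
  assumes "bounded_operator d p m A B" "B \<le> B'"
  shows "bounded_operator d p m A B'"
  unfolding bounded_operator_def
proof (intro conjI allI impI ballI)
  fix f M y assume f: "mixed_smooth d p m f M" and y: "y \<in> cube d"
  have "cmod (A f y) \<le> B * M" using bounded_operatorD(3)[OF assms(1) f y] .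
  also have "\<dots> \<le> B' * M" using assms(2) mixed_smooth_nonneg[OF f] by (intro mult_right_mono)
  finally show "cmod (A f y) \<le> B' * M" .
qed (use bounded_operatorD[OF assms(1)] in auto)

lemma bounded_operator_add:
  assumes "bounded_operator d p m A B" "bounded_operator d p m A' B'"
  shows "bounded_operator d p m (\<lambda>f y. A f y + A' f y) (B + B')"
  unfolding bounded_operator_def
proof (intro conjI allI impI ballI)
  fix f M y assume f: "mixed_smooth d p m f M" and y: "y \<in> cube d"
  show "cmod (A f y + A' f y) \<le> (B + B') * M"
    using bounded_operatorD(3)[OF assms(1) f y] bounded_operatorD(3)[OF assms(2) f y]
    by (simp add: distrib_right norm_triangle_mono)
next
  fix f f' j assume a: "continuous_on (cube d) f" "continuous_on (cube d) f'" "m \<le> j" "j < d" "has_pd d j f f'"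
  show "has_pd d j (\<lambda>y. A f y + A' f y) (\<lambda>y. A f' y + A' f' y)"
    using bounded_operatorD(2)[OF assms(1) a] bounded_operatorD(2)[OF assms(2) a]
    unfolding has_pd_def by (auto intro: has_vector_derivative_add)
qed (intro continuous_on_add bounded_operatorD(1)[OF assms(1)] bounded_operatorD(1)[OF assms(2)])

lemma bounded_operator_sum:
  assumes "finite S" "\<And>l. l \<in> S \<Longrightarrow> bounded_operator d p m (A l) (B l)"
  shows "bounded_operator d p m (\<lambda>f y. \<Sum>l\<in>S. A l f y) (\<Sum>l\<in>S. B l)"
  using assms
  by (induction S rule: finite_induct) (simp_all add: bounded_operator_zero bounded_operator_add)

text \<open>Along a line in direction \<open>m\<close>, applying \<open>A\<close> to the successive
  derivatives \<open>g i\<close> gives a jet bounded by \<open>B * M\<close>: \<open>A\<close>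
  commutes with the derivative in \<open>m\<close>, and every \<open>g i\<close> has the same mixed
  bound in the lower variables. Bounds therefore multiply.\<close>

lemma bounded_operator_Suc:
  assumes A: "bounded_operator d p m A B" and m: "m < d" and X: "X \<subseteq> {-1..1}"
    and e: "continuous_on {-1..1} e" and b: "functional_bound p X w e b"
  shows "bounded_operator d p (Suc m) (\<lambda>f y. functional X w e (\<lambda>t. A f (y(m := t)))) (b * B)"
  unfolding bounded_operator_def
proof (intro conjI allI impI ballI)
  fix f :: "(nat \<Rightarrow> real) \<Rightarrow> complex" assume "continuous_on (cube d) f"
  then show "continuous_on (cube d) (\<lambda>y. functional X w e (\<lambda>t. A f (y(m := t))))"
    by (intro functional_continuous_on bounded_operatorD(1)[OF A] m X e)
next
  fix f f' j assume "continuous_on (cube d) f" "continuous_on (cube d) f'" "Suc m \<le> j" "j < d" "has_pd d j f f'"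
  then show "has_pd d j (\<lambda>y. functional X w e (\<lambda>t. A f (y(m := t)))) (\<lambda>y. functional X w e (\<lambda>t. A f' (y(m := t))))"
    by (intro functional_has_pd bounded_operatorD(1)[OF A] bounded_operatorD(2)[OF A] m X e) auto
next
  fix f M y assume f: "mixed_smooth d p (Suc m) f M" and y: "y \<in> cube d"
  then obtain g where g: "g 0 = f" "\<And>i. i \<le> p \<Longrightarrow> mixed_smooth d p m (g i) M"
    "\<And>i. i < p \<Longrightarrow> has_pd d m (g i) (g (Suc i))" by auto
  have cg: "continuous_on (cube d) (g i)" if "i \<le> p" for i
    using mixed_smooth_0[OF g(2)[OF that]] by simp
  have "smooth_jet p (\<lambda>i t. A (g i) (y(m := t))) (B * M)"
    unfolding smooth_jet_def
  proof (intro conjI allI impI ballI)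
    fix i t assume "i < p" "t \<in> {-1..1::real}"
    then show "((\<lambda>t. A (g i) (y(m := t))) has_vector_derivative A (g (Suc i)) (y(m := t))) (at t within {-1..1})"
      by (intro has_pdD[OF _ y m] bounded_operatorD(2)[OF A] cg g(3) m) auto
  next
    fix i assume "i \<le> p"
    then show "continuous_on {-1..1} (\<lambda>t. A (g i) (y(m := t)))"
      by (intro continuous_on_slice[OF _ y m] bounded_operatorD(1)[OF A] cg)
  next
    fix i t assume "i \<le> p" "t \<in> {-1..1::real}"
    then show "cmod (A (g i) (y(m := t))) \<le> B * M"
      by (intro bounded_operatorD(3)[OF A] g(2) cube_upd y m)
  qed
  then show "cmod (functional X w e (\<lambda>t. A f (y(m := t)))) \<le> b * B * M"
    using b unfolding functional_bound_def g(1)[symmetric] by (auto simp: mult.assoc)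
qed

text \<open>The result stays a function of \<open>y\<close>: coordinates below \<open>m\<close> are
  overwritten, those from \<open>m\<close> on are parameters. At \<open>m = d\<close> the value is
  the same for all points \<open>y\<close> of \<open>cube d\<close>.\<close>

primrec tensor_functional :: "real set \<Rightarrow> (nat \<Rightarrow> real \<Rightarrow> complex) \<Rightarrow> (nat \<Rightarrow> real \<Rightarrow> complex) \<Rightarrow> nat \<Rightarrow>
    ((nat \<Rightarrow> real) \<Rightarrow> complex) \<Rightarrow> (nat \<Rightarrow> real) \<Rightarrow> complex" where
  "tensor_functional X w e 0 f y = f y"
| "tensor_functional X w e (Suc m) f y = functional X (w m) (e m) (\<lambda>t. tensor_functional X w e m f (y(m := t)))"

lemma tensor_functional_cong:
  "(\<And>j. j < m \<Longrightarrow> w j = w' j \<and> e j = e' j) \<Longrightarrow> tensor_functional X w e m f y = tensor_functional X w' e' m f y"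
  by (induction m arbitrary: y) auto

lemma bounded_operator_tensor:
  assumes "m \<le> d" "X \<subseteq> {-1..1}"
    and "\<And>j. j < m \<Longrightarrow> continuous_on {-1..1} (e j)"
    and "\<And>j. j < m \<Longrightarrow> functional_bound p X (w j) (e j) (b j)"
  shows "bounded_operator d p m (tensor_functional X w e m) (\<Prod>j<m. b j)"
  using assms
proof (induction m)
  case 0
  have "tensor_functional X w e 0 = (\<lambda>f. f)" by (intro ext) simp
  then show ?case using bounded_operator_id by simp
next
  case (Suc m)
  have "tensor_functional X w e (Suc m) = (\<lambda>f y. functional X (w m) (e m) (\<lambda>t. tensor_functional X w e m f (y(m := t))))"
    by (intro ext) simp
  moreover have "bounded_operator d p (Suc m)
      (\<lambda>f y. functional X (w m) (e m) (\<lambda>t. tensor_functional X w e m f (y(m := t)))) (b m * (\<Prod>j<m. b j))"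
    using Suc.prems by (intro bounded_operator_Suc Suc.IH) auto
  ultimately show ?case by (simp add: mult.commute)
qed

subsection \<open>The Smolyak error recursion\<close>

text \<open>The bound \<open>R\<close> is independent of the number of variables, because the
  recursion changes both.\<close>

definition bounded_levels :: "nat \<Rightarrow> nat \<Rightarrow> (nat \<Rightarrow> nat) set" where
  "bounded_levels m R = {l \<in> {..<m} \<rightarrow>\<^sub>E {1..}. (\<Sum>j<m. l j) \<le> R}"

lemma bounded_levels_sum: "l \<in> bounded_levels m R \<Longrightarrow> (\<Sum>j<m. l j) \<le> R"
  unfolding bounded_levels_def by simp

lemma bounded_levels_component:
  assumes "l \<in> bounded_levels m R" "j < m"
  shows "l j \<ge> 1" "l j \<le> R"
proof -
  show "l j \<ge> 1" using assms unfolding bounded_levels_def by (auto simp: PiE_iff)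
  have "l j \<le> (\<Sum>j<m. l j)" using assms(2) by (intro member_le_sum) auto
  then show "l j \<le> R" using bounded_levels_sum[OF assms(1)] by linarith
qed

lemma bounded_levels_subset: "bounded_levels m R \<subseteq> {..<m} \<rightarrow>\<^sub>E {1..R}"
proof
  fix l assume l: "l \<in> bounded_levels m R"
  then have "l \<in> extensional {..<m}" by (auto simp: bounded_levels_def PiE_iff)
  then show "l \<in> {..<m} \<rightarrow>\<^sub>E {1..R}" using bounded_levels_component[OF l] by (simp add: PiE_iff)
qed

lemma finite_bounded_levels: "finite (bounded_levels m R)"
  by (rule finite_subset[OF bounded_levels_subset]) (intro finite_PiE, auto)

lemma card_bounded_levels: "card (bounded_levels m R) \<le> R ^ m"
proof -
  have "card (bounded_levels m R) \<le> card ({..<m} \<rightarrow>\<^sub>E {1..R})"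
    by (intro card_mono finite_PiE bounded_levels_subset) auto
  then show ?thesis by (simp add: card_PiE)
qed

text \<open>The last level is at least 1, so the others sum to at most \<open>R - 1\<close>.
  Resetting coordinate \<open>m\<close> to \<open>undefined\<close> restores extensionality in the
  inverse map.\<close>

lemma sum_bounded_levels_Suc:
  fixes F :: "(nat \<Rightarrow> nat) \<Rightarrow> 'a::comm_monoid_add"
  shows "(\<Sum>l\<in>bounded_levels (Suc m) R. F l)
    = (\<Sum>l\<in>bounded_levels m (R - 1). \<Sum>q\<in>{1..R - (\<Sum>j<m. l j)}. F (l(m := q)))"
proof -
  have "(\<Sum>l\<in>bounded_levels m (R - 1). \<Sum>q\<in>{1..R - (\<Sum>j<m. l j)}. F (l(m := q)))
     = (\<Sum>(l, q)\<in>Sigma (bounded_levels m (R - 1)) (\<lambda>l. {1..R - (\<Sum>j<m. l j)}). F (l(m := q)))"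
    by (rule sum.Sigma) (auto simp: finite_bounded_levels)
  also have "\<dots> = (\<Sum>l\<in>bounded_levels (Suc m) R. F l)"
  proof (rule sum.reindex_bij_witness[where i = "\<lambda>l. (l(m := undefined), l m)" and j = "\<lambda>(l, q). l(m := q)"])
    fix a assume a: "a \<in> Sigma (bounded_levels m (R - 1)) (\<lambda>l. {1..R - (\<Sum>j<m. l j)})"
    obtain l q where lq: "a = (l, q)" by (cases a)
    have l: "l \<in> {..<m} \<rightarrow>\<^sub>E {1..}" "(\<Sum>j<m. l j) \<le> R - 1" and q: "q \<ge> 1" "q \<le> R - (\<Sum>j<m. l j)"
      using a unfolding lq bounded_levels_def by auto
    have um: "l m = undefined" using l(1) by (auto simp: PiE_iff extensional_def)
    then show "(\<lambda>l. (l(m := undefined), l m)) ((\<lambda>(l, q). l(m := q)) a) = a"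
      unfolding lq by auto
    show "(\<lambda>(l, q). l(m := q)) a \<in> bounded_levels (Suc m) R"
      unfolding lq bounded_levels_def using l q
      by (auto simp: PiE_iff extensional_def)
  next
    fix l assume l: "l \<in> bounded_levels (Suc m) R"
    then show "(\<lambda>(l, q). l(m := q)) ((\<lambda>l. (l(m := undefined), l m)) l) = l" by auto
    have lm: "l m \<ge> 1" using bounded_levels_component(1)[OF l] by simp
    moreover have "(\<Sum>j<m. l j) + l m \<le> R" using l unfolding bounded_levels_def by simp
    ultimately have "(\<Sum>j<m. l j) \<le> R - 1" "l m \<le> R - (\<Sum>j<m. l j)" by linarith+
    moreover have "l(m := undefined) \<in> {..<m} \<rightarrow>\<^sub>E {1..}"
      using l unfolding bounded_levels_def by (auto simp: PiE_iff extensional_def)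
    ultimately show "(\<lambda>l. (l(m := undefined), l m)) l \<in> Sigma (bounded_levels m (R - 1)) (\<lambda>l. {1..R - (\<Sum>j<m. l j)})"
      using lm unfolding bounded_levels_def by simp
  qed auto
  finally show ?thesis ..
qed

lemma functional_sum_right:
  assumes "finite S" "\<And>i. i \<in> S \<Longrightarrow> continuous_on {-1..1} (g i)" "continuous_on {-1..1} e"
  shows "functional X w e (\<lambda>t. \<Sum>i\<in>S. g i t) = (\<Sum>i\<in>S. functional X w e (g i))"
proof -
  have "integral {-1..1} (\<lambda>t. \<Sum>i\<in>S. e t * g i t) = (\<Sum>i\<in>S. integral {-1..1} (\<lambda>t. e t * g i t))"
    using assms by (intro integral_sum integrable_continuous_real continuous_intros) auto
  then show ?thesis
    unfolding functional_def by (simp add: sum_distrib_left sum.distrib sum.swap[of _ X])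
qed

lemma functional_add_right:
  assumes "continuous_on {-1..1} g" "continuous_on {-1..1} h" "continuous_on {-1..1} e"
  shows "functional X w e (\<lambda>t. g t + h t) = functional X w e g + functional X w e h"
proof -
  have "integral {-1..1} (\<lambda>t. e t * g t + e t * h t) = integral {-1..1} (\<lambda>t. e t * g t) + integral {-1..1} (\<lambda>t. e t * h t)"
    using assms by (intro Henstock_Kurzweil_Integration.integral_add integrable_continuous_real continuous_intros)
  then show ?thesis unfolding functional_def by (simp add: distrib_left sum.distrib)
qed

section \<open>The error operator of the Smolyak rule\<close>

text \<open>\<open>S\<close> caps every level that occurs, so that one finite set
  \<open>nodes\<close> carries all the functionals.\<close>

locale smolyak_quadrature =
  fixes d p S :: nat and \<tau> \<sigma> :: "nat \<Rightarrow> real"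
  assumes p: "p \<ge> 1" and S: "S \<ge> 1" and \<sigma>: "\<And>j. \<bar>\<sigma> j\<bar> \<le> 1" and \<tau>: "\<And>j. \<bar>\<tau> j\<bar> \<ge> 1 \<or> \<tau> j = 0"
begin

definition nodes :: "real set" where
  "nodes = (\<Union>l\<in>{1..S}. grid l)"

definition wave :: "nat \<Rightarrow> real \<Rightarrow> complex" where
  "wave j t = cis ((\<tau> j + \<sigma> j) * t)"

definition hier_weight :: "(nat \<Rightarrow> nat) \<Rightarrow> nat \<Rightarrow> real \<Rightarrow> complex" where
  "hier_weight l j x = quad_weight (\<tau> j) (\<sigma> j) (l j) x - quad_weight (\<tau> j) (\<sigma> j) (l j - 1) x"

definition exact :: "nat \<Rightarrow> ((nat \<Rightarrow> real) \<Rightarrow> complex) \<Rightarrow> (nat \<Rightarrow> real) \<Rightarrow> complex" where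
  "exact m f y = tensor_functional nodes (\<lambda>j x. 0) wave m f y"

definition hier :: "(nat \<Rightarrow> nat) \<Rightarrow> nat \<Rightarrow> ((nat \<Rightarrow> real) \<Rightarrow> complex) \<Rightarrow> (nat \<Rightarrow> real) \<Rightarrow> complex" where
  "hier l m f y = tensor_functional nodes (hier_weight l) (\<lambda>j t. 0) m f y"

text \<open>Defined by the recursion itself, so that it can be bounded as an operator before it is
  identified with the error. At \<open>R = 0\<close> subtraction is truncated and the level 0 rule
  is zero; for \<open>m > 0\<close> the recursion then yields the full integral, as it
  should.\<close>

primrec smolyak_error where
  "smolyak_error 0 R f y = 0"
| "smolyak_error (Suc m) R f y =
    (\<Sum>l\<in>bounded_levels m (R - 1). functional nodes
        (\<lambda>x. - quad_weight (\<tau> m) (\<sigma> m) (R - (\<Sum>j<m. l j)) x) (wave m) (\<lambda>t. hier l m f (y(m := t))))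
    + functional nodes (\<lambda>x. 0) (wave m) (\<lambda>t. smolyak_error m (R - 1) f (y(m := t)))"

definition C :: real where
  "C = (1 + 2 ^ (p - 1)) * error_const p * 2 ^ (p - 1)"

lemma finite_nodes: "finite nodes"
  unfolding nodes_def using finite_grid by auto

lemma nodes_subset: "nodes \<subseteq> {-1..1}"
  unfolding nodes_def using grid_subset by blast

lemma grid_nodes: "l \<ge> 1 \<Longrightarrow> l \<le> S \<Longrightarrow> grid l \<subseteq> nodes"
  unfolding nodes_def by auto

lemma continuous_wave: "continuous_on A (wave j)"
  unfolding wave_def by (intro continuous_intros)

lemma C_ge: "error_const p \<le> C" "(1 + 2 ^ (p - 1)) * error_const p \<le> C" "1 \<le> C"
proof -
  have "1 * error_const p * 1 \<le> C" "(1 + 2 ^ (p - 1)) * error_const p * 1 \<le> C"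
    unfolding C_def using error_const_ge_1[of p] by (intro mult_mono mult_nonneg_nonneg; simp)+
  then show "error_const p \<le> C" "(1 + 2 ^ (p - 1)) * error_const p \<le> C" by simp_all
  then show "1 \<le> C" using error_const_ge_1[of p] by linarith
qed

lemma functional_bound_mono:
  assumes "functional_bound p X w e b" "b \<le> b'"
  shows "functional_bound p X w e b'"
  using assms unfolding functional_bound_def
  by (meson smooth_jet_nonneg mult_right_mono order_trans)

lemma quadrature_functional_bound:
  assumes "l \<le> S"
  shows "functional_bound p nodes (\<lambda>x. - quad_weight (\<tau> j) (\<sigma> j) l x) (wave j) (C * freq_factor (\<tau> j) * decay p ^ l)"
  unfolding wave_def
proof (rule functional_bound_mono[OF quadrature_error_bound[OF p \<sigma> \<tau> finite_nodes]])
  show "error_const p * freq_factor (\<tau> j) * decay p ^ l \<le> C * freq_factor (\<tau> j) * decay p ^ l"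
    using freq_factor_pos[of "\<tau> j"] decay_bounds[of p] C_ge by (intro mult_right_mono) auto
qed (use assms grid_nodes in auto)

lemma exact_functional_bound: "functional_bound p nodes (\<lambda>x. 0) (wave j) (C * freq_factor (\<tau> j))"
  using quadrature_functional_bound[of 0 j] by (simp add: quad_weight_def)

lemma hier_functional_bound:
  assumes "l j \<ge> 1" "l j \<le> S"
  shows "functional_bound p nodes (hier_weight l j) (\<lambda>t. 0) (C * freq_factor (\<tau> j) * decay p ^ l j)"
proof -
  have "functional_bound p nodes (\<lambda>x. hier_weight l j x) (\<lambda>t. 0)
      ((1 + 2 ^ (p - 1)) * error_const p * freq_factor (\<tau> j) * decay p ^ l j)"
    unfolding hier_weight_def
    using assms grid_nodes by (intro hierarchical_bound[OF p \<sigma> \<tau> finite_nodes]) auto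
  then show ?thesis
  proof (rule functional_bound_mono)
    show "(1 + 2 ^ (p - 1)) * error_const p * freq_factor (\<tau> j) * decay p ^ l j \<le> C * freq_factor (\<tau> j) * decay p ^ l j"
      using freq_factor_pos[of "\<tau> j"] decay_bounds[of p] C_ge by (intro mult_right_mono) auto
  qed
qed

lemma bounded_operator_hier:
  assumes "m \<le> d" "l \<in> bounded_levels m R" "R \<le> S"
  shows "bounded_operator d p m (hier l m) (C ^ m * (\<Prod>j<m. freq_factor (\<tau> j)) * decay p ^ (\<Sum>j<m. l j))"
proof -
  have "bounded_operator d p m (tensor_functional nodes (hier_weight l) (\<lambda>j t. 0) m)
      (\<Prod>j<m. C * freq_factor (\<tau> j) * decay p ^ l j)"
    using bounded_levels_component[OF assms(2)] assms(3)
    by (intro bounded_operator_tensor assms(1) nodes_subset hier_functional_bound) (auto intro: order_trans)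
  moreover have "hier l m = tensor_functional nodes (hier_weight l) (\<lambda>j t. 0) m"
    by (intro ext) (simp add: hier_def)
  ultimately show ?thesis by (simp add: prod.distrib power_sum)
qed

text \<open>In each term the level sum \<open>|l|\<close> and the remaining level
  \<open>R - |l|\<close> add up to \<open>R\<close>, so all terms have the same size whatever
  \<open>l\<close> is. The factor \<open>real m\<close> counts the stages of the recursion, and each
  stage costs \<open>2 ^ (p - 1)\<close> for lowering \<open>R\<close> by one.\<close>

lemma bounded_operator_smolyak_error:
  assumes "m \<le> d" "R \<le> S"
  shows "bounded_operator d p m (smolyak_error m R)
    (real m * C ^ m * real S ^ (m - 1) * (\<Prod>j<m. freq_factor (\<tau> j)) * decay p ^ R * (2 ^ (p - 1)) ^ m)"
  using assms
proof (induction m arbitrary: R)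
  case 0
  have "smolyak_error 0 R = (\<lambda>f y. 0)" by (intro ext) simp
  then show ?case using bounded_operator_zero by simp
next
  case (Suc m)
  let ?F = "\<lambda>m. \<Prod>j<m. freq_factor (\<tau> j)"
  let ?A = "\<lambda>l f y. functional nodes (\<lambda>x. - quad_weight (\<tau> m) (\<sigma> m) (R - (\<Sum>j<m. l j)) x) (wave m) (\<lambda>t. hier l m f (y(m := t)))"
  let ?B = "\<lambda>f y. functional nodes (\<lambda>x. 0) (wave m) (\<lambda>t. smolyak_error m (R - 1) f (y(m := t)))"
  have F: "?F m > 0" for m using freq_factor_pos by (intro prod_pos) auto
  have dp: "decay p ^ k \<ge> 0" for k using decay_bounds[of p] by simp
  have C0: "C \<ge> 0" using C_ge by linarith
  have A: "bounded_operator d p (Suc m) (?A l) (C ^ Suc m * ?F (Suc m) * decay p ^ R)"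
    if l: "l \<in> bounded_levels m (R - 1)" for l
  proof -
    have s: "(\<Sum>j<m. l j) \<le> R" using bounded_levels_sum[OF l] by linarith
    have "bounded_operator d p (Suc m) (?A l) ((C * freq_factor (\<tau> m) * decay p ^ (R - (\<Sum>j<m. l j)))
        * (C ^ m * ?F m * decay p ^ (\<Sum>j<m. l j)))"
      using Suc.prems
      by (intro bounded_operator_Suc bounded_operator_hier[OF _ l] nodes_subset continuous_wave quadrature_functional_bound) auto
    also have "(C * freq_factor (\<tau> m) * decay p ^ (R - (\<Sum>j<m. l j))) * (C ^ m * ?F m * decay p ^ (\<Sum>j<m. l j))
        = C ^ Suc m * ?F (Suc m) * (decay p ^ (R - (\<Sum>j<m. l j)) * decay p ^ (\<Sum>j<m. l j))"
      by simp
    also have "\<dots> = C ^ Suc m * ?F (Suc m) * decay p ^ R"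
      using s by (simp add: power_add[symmetric])
    finally show ?thesis .
  qed
  have B: "bounded_operator d p (Suc m) ?B ((C * freq_factor (\<tau> m)) *
      (real m * C ^ m * real S ^ (m - 1) * ?F m * decay p ^ (R - 1) * (2 ^ (p - 1)) ^ m))"
    using Suc.prems
    by (intro bounded_operator_Suc Suc.IH nodes_subset continuous_wave exact_functional_bound) auto
  have eq: "smolyak_error (Suc m) R = (\<lambda>f y. (\<Sum>l\<in>bounded_levels m (R - 1). ?A l f y) + ?B f y)"
    by (intro ext) simp
  have bo: "bounded_operator d p (Suc m) (\<lambda>f y. (\<Sum>l\<in>bounded_levels m (R - 1). ?A l f y) + ?B f y)
     ((\<Sum>l\<in>bounded_levels m (R - 1). C ^ Suc m * ?F (Suc m) * decay p ^ R) + (C * freq_factor (\<tau> m)) *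
      (real m * C ^ m * real S ^ (m - 1) * ?F m * decay p ^ (R - 1) * (2 ^ (p - 1)) ^ m))"
    by (intro bounded_operator_add bounded_operator_sum finite_bounded_levels A B)
  have "(\<Sum>l\<in>bounded_levels m (R - 1). C ^ Suc m * ?F (Suc m) * decay p ^ R) + (C * freq_factor (\<tau> m)) *
      (real m * C ^ m * real S ^ (m - 1) * ?F m * decay p ^ (R - 1) * (2 ^ (p - 1)) ^ m)
    \<le> real (Suc m) * C ^ Suc m * real S ^ (Suc m - 1) * ?F (Suc m) * decay p ^ R * (2 ^ (p - 1)) ^ Suc m"
  proof -
    let ?K = "C ^ Suc m * ?F (Suc m) * decay p ^ R"
    have K: "?K \<ge> 0" using F[of "Suc m"] C0 dp by (intro mult_nonneg_nonneg) auto
    have "real (card (bounded_levels m (R - 1))) \<le> real S ^ m * (2 ^ (p - 1)) ^ Suc m"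
    proof -
      have "card (bounded_levels m (R - 1)) \<le> (R - 1) ^ m" by (rule card_bounded_levels)
      also have "\<dots> \<le> S ^ m" using Suc.prems by (intro power_mono) auto
      finally have "real (card (bounded_levels m (R - 1))) * 1 \<le> real S ^ m * (2 ^ (p - 1)) ^ Suc m"
        by (intro mult_mono one_le_power) (auto simp flip: of_nat_power)
      then show ?thesis by simp
    qed
    then have 1: "(\<Sum>l\<in>bounded_levels m (R - 1). ?K) \<le> real S ^ m * (2 ^ (p - 1)) ^ Suc m * ?K"
      using mult_right_mono[OF _ K] by simp
    \<comment> \<open>For \<open>R = 0\<close> truncated subtraction leaves both powers of
      \<open>decay p\<close> equal to 1.\<close>
    have d: "decay p ^ (R - 1) \<le> 2 ^ (p - 1) * decay p ^ R"
    proof (cases R)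
      case (Suc k)
      have "2 ^ (p - 1) * decay p = 1" unfolding decay_def by (simp add: power_divide)
      then show ?thesis unfolding Suc by (simp add: mult.assoc[symmetric])
    qed simp
    have le: "real m * real S ^ (m - 1) \<le> real m * real S ^ m"
      using S by (intro mult_left_mono power_increasing) auto
    have "(C ^ Suc m * ?F (Suc m) * (2 ^ (p - 1)) ^ m) * ((real m * real S ^ (m - 1)) * decay p ^ (R - 1))
      \<le> (C ^ Suc m * ?F (Suc m) * (2 ^ (p - 1)) ^ m) * ((real m * real S ^ m) * (2 ^ (p - 1) * decay p ^ R))"
      by (rule mult_left_mono[OF mult_mono[OF le d]]) (use F[of "Suc m"] C0 dp in auto)
    then have 2: "(C * freq_factor (\<tau> m)) * (real m * C ^ m * real S ^ (m - 1) * ?F m * decay p ^ (R - 1) * (2 ^ (p - 1)) ^ m)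
      \<le> real m * (real S ^ m * (2 ^ (p - 1)) ^ Suc m * ?K)"
      by (simp add: mult_ac)
    show ?thesis using 1 2 by (simp add: algebra_simps)
  qed
  then show ?case unfolding eq by (rule bounded_operator_mono[OF bo])
qed

lemma hier_update:
  "hier (l(m := q)) (Suc m) f y = functional nodes
     (\<lambda>x. quad_weight (\<tau> m) (\<sigma> m) q x - quad_weight (\<tau> m) (\<sigma> m) (q - 1) x) (\<lambda>t. 0) (\<lambda>t. hier l m f (y(m := t)))"
proof -
  have "tensor_functional nodes (hier_weight (l(m := q))) (\<lambda>j t. 0) m f z = tensor_functional nodes (hier_weight l) (\<lambda>j t. 0) m f z" for z
    by (rule tensor_functional_cong) (auto simp: hier_weight_def)
  then show ?thesis by (simp add: hier_def hier_weight_def[abs_def])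
qed

text \<open>By induction the exact functional in \<open>m\<close> variables is the sum over levels
  up to \<open>R - 1\<close> plus the error; apply the exact integral in variable \<open>m\<close>
  to both. On the Smolyak side the sum over the last level telescopes for fixed \<open>l\<close>,
  and subtraction leaves a one-variable quadrature error.\<close>

lemma exact_minus_hier:
  assumes "m \<le> d" "R \<le> S" "continuous_on (cube d) f" "y \<in> cube d"
  shows "exact m f y - (\<Sum>l\<in>bounded_levels m R. hier l m f y) = smolyak_error m R f y"
  using assms
proof (induction m arbitrary: R y)
  case 0
  have "bounded_levels 0 R = {\<lambda>_. undefined}" unfolding bounded_levels_def by auto
  then show ?case by (simp add: exact_def hier_def)
next
  case (Suc m)
  let ?L = "bounded_levels m (R - 1)"
  let ?Q = "\<lambda>l. R - (\<Sum>j<m. l j)"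
  let ?h = "\<lambda>l t. hier l m f (y(m := t))"
  have ch: "continuous_on {-1..1} (?h l)" if "l \<in> ?L" for l
    using bounded_operatorD(1)[OF bounded_operator_hier[OF _ that]] Suc.prems
    by (intro continuous_on_slice[of d]) auto
  have ce: "continuous_on {-1..1} (\<lambda>t. smolyak_error m (R - 1) f (y(m := t)))"
    using bounded_operatorD(1)[OF bounded_operator_smolyak_error[of m "R - 1"]] Suc.prems
    by (intro continuous_on_slice[of d]) auto
  have "exact (Suc m) f y = functional nodes (\<lambda>x. 0) (wave m) (\<lambda>t. exact m f (y(m := t)))"
    by (simp add: exact_def)
  also have "\<dots> = functional nodes (\<lambda>x. 0) (wave m) (\<lambda>t. smolyak_error m (R - 1) f (y(m := t)) + (\<Sum>l\<in>?L. ?h l t))"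
  proof -
    have "exact m f (y(m := t)) = smolyak_error m (R - 1) f (y(m := t)) + (\<Sum>l\<in>?L. ?h l t)" if "t \<in> {-1..1}" for t
    proof -
      have "exact m f (y(m := t)) - (\<Sum>l\<in>?L. ?h l t) = smolyak_error m (R - 1) f (y(m := t))"
        using Suc.prems that by (intro Suc.IH cube_upd) auto
      then show ?thesis by (simp only: diff_eq_eq)
    qed
    then show ?thesis unfolding functional_def
      by (auto intro!: Henstock_Kurzweil_Integration.integral_cong)
  qed
  also have "\<dots> = functional nodes (\<lambda>x. 0) (wave m) (\<lambda>t. smolyak_error m (R - 1) f (y(m := t)))
     + (\<Sum>l\<in>?L. functional nodes (\<lambda>x. 0) (wave m) (?h l))"
    using ce ch by (simp add: functional_add_right functional_sum_right continuous_wave finite_bounded_levels continuous_on_sum)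
  finally have I: "exact (Suc m) f y = functional nodes (\<lambda>x. 0) (wave m) (\<lambda>t. smolyak_error m (R - 1) f (y(m := t)))
     + (\<Sum>l\<in>?L. functional nodes (\<lambda>x. 0) (wave m) (?h l))" .
  \<comment> \<open>The telescoping sum has no remainder at its lower end because the level 0
    weights vanish.\<close>
  have tel: "(\<Sum>q\<in>{1..Q}. functional nodes (\<lambda>x. quad_weight (\<tau> m) (\<sigma> m) q x - quad_weight (\<tau> m) (\<sigma> m) (q - 1) x) (\<lambda>t. 0) g)
      = functional nodes (quad_weight (\<tau> m) (\<sigma> m) Q) (\<lambda>t. 0) g" for Q g
  proof -
    define V where "V q = (\<Sum>x\<in>nodes. quad_weight (\<tau> m) (\<sigma> m) q x * g x)" for q
    have "functional nodes (\<lambda>x. quad_weight (\<tau> m) (\<sigma> m) q x - quad_weight (\<tau> m) (\<sigma> m) (q - 1) x) (\<lambda>t. 0) g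
        = V q - V (q - 1)" for q
      by (simp add: functional_def V_def left_diff_distrib sum_subtractf)
    moreover have "(\<Sum>q\<in>{1..Q}. V q - V (q - 1)) = V Q - V 0" by (induction Q) auto
    moreover have "V 0 = 0" by (simp add: V_def quad_weight_def)
    moreover have "functional nodes (quad_weight (\<tau> m) (\<sigma> m) Q) (\<lambda>t. 0) g = V Q"
      by (simp add: functional_def V_def)
    ultimately show ?thesis by (simp only: diff_zero)
  qed
  have "(\<Sum>l\<in>bounded_levels (Suc m) R. hier l (Suc m) f y)
     = (\<Sum>l\<in>?L. functional nodes (quad_weight (\<tau> m) (\<sigma> m) (?Q l)) (\<lambda>t. 0) (?h l))"
    unfolding sum_bounded_levels_Suc hier_update tel ..
  moreover have "functional nodes (\<lambda>x. 0) (wave m) (?h l) - functional nodes (quad_weight (\<tau> m) (\<sigma> m) (?Q l)) (\<lambda>t. 0) (?h l)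
     = functional nodes (\<lambda>x. - quad_weight (\<tau> m) (\<sigma> m) (?Q l) x) (wave m) (?h l)" for l
    by (simp add: functional_def sum_negf)
  ultimately show ?case unfolding I by (simp add: sum_subtractf[symmetric] del: sum_subtractf)
qed

lemma smolyak_error_bound:
  assumes R: "R \<le> S" and f: "mixed_smooth d p d f M" and y: "y \<in> cube d"
  shows "cmod (exact d f y - (\<Sum>l\<in>bounded_levels d R. hier l d f y))
    \<le> real d * C ^ d * real S ^ (d - 1) * (\<Prod>j<d. freq_factor (\<tau> j)) * decay p ^ R * (2 ^ (p - 1)) ^ d * M"
  using exact_minus_hier[OF order_refl R _ y] bounded_operatorD(3)[OF bounded_operator_smolyak_error[OF order_refl R] f y]
    mixed_smooth_0[OF f] by simp

end

subsection \<open>Integrals over the cube\<close>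

lemma cube_iff: "y \<in> cube d \<longleftrightarrow> (\<forall>j<d. y j \<in> {-1..1}) \<and> (\<forall>j\<ge>d. y j = undefined)"
  unfolding cube_def PiE_iff extensional_def by (simp add: Ball_def not_less)

lemma cube_Suc_upd_iff:
  assumes "y \<in> extensional {..<m}"
  shows "y(m := t) \<in> cube (Suc m) \<longleftrightarrow> y \<in> cube m \<and> t \<in> {-1..1}"
proof -
  have "\<forall>j\<ge>m. y j = undefined" using assms by (simp add: extensional_def)
  then show ?thesis unfolding cube_iff by (simp add: less_Suc_eq all_conj_distrib imp_disjL)
qed

lemma cube_extensional: "y \<in> cube m \<Longrightarrow> y \<in> extensional {..<m}"
  unfolding cube_def by (simp add: PiE_iff)

text \<open>In the function space the extensional cube is a product over all indices, with the
  singleton \<open>{undefined}\<close> from \<open>d\<close> on, so Tychonoff's theorem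
  applies.\<close>

lemma compact_cube: "compact (cube d)"
proof -
  have "cube d = PiE UNIV (\<lambda>i. if i < d then {-1..1} else {undefined})"
  proof (rule set_eqI)
    fix y :: "nat \<Rightarrow> real"
    have "y i \<in> (if i < d then {-1..1} else {undefined}) \<longleftrightarrow> (i < d \<longrightarrow> y i \<in> {-1..1}) \<and> (d \<le> i \<longrightarrow> y i = undefined)" for i
      by simp
    then show "y \<in> cube d \<longleftrightarrow> y \<in> PiE UNIV (\<lambda>i. if i < d then {-1..1} else {undefined})"
      unfolding cube_iff PiE_iff by (simp add: all_conj_distrib extensional_def)
  qed
  moreover have "compactin (product_topology (\<lambda>i::nat. euclidean :: real topology) UNIV)
      (PiE UNIV (\<lambda>i. if i < d then {-1..1} else {undefined}))"
    by (simp add: compactin_PiE)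
  ultimately show ?thesis by (simp add: euclidean_product_topology)
qed

section \<open>From the function space to mixed smoothness\<close>

text \<open>Compactness supplies \<open>bdd_above\<close>, without which the real supremum would
  carry no information.\<close>

lemma mixed_deriv_le_W_norm:
  assumes f: "f \<in> W_space p d" and s: "s \<in> multi_indices p d" and y: "y \<in> cube d"
  shows "\<bar>mixed_deriv d s f y\<bar> \<le> W_norm p d f"
proof -
  have "continuous_on (cube d) (\<lambda>y. \<bar>mixed_deriv d s f y\<bar>)"
    using f s unfolding W_space_def by (auto intro!: continuous_intros)
  then have "bdd_above ((\<lambda>y. \<bar>mixed_deriv d s f y\<bar>) ` cube d)"
    by (intro bounded_imp_bdd_above compact_imp_bounded compact_continuous_image compact_cube)
  then have "\<bar>mixed_deriv d s f y\<bar> \<le> (SUP y\<in>cube d. \<bar>mixed_deriv d s f y\<bar>)"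
    using y by (rule cSUP_upper2) simp
  also have "\<dots> \<le> W_norm p d f"
    unfolding W_norm_def using s
    by (intro Max_ge finite_imageI) (auto simp: multi_indices_def intro: finite_PiE)
  finally show ?thesis .
qed

lemma foldr_eq_id: "(\<And>x. x \<in> set xs \<Longrightarrow> g x = id) \<Longrightarrow> foldr g xs f = f"
  by (induction xs) auto

lemma mixed_deriv_tail:
  assumes "m \<le> d" "\<And>j. j < m \<Longrightarrow> s j = 0"
  shows "mixed_deriv d s f = foldr (\<lambda>i. partial_deriv i ^^ s i) [m..<d] f"
proof -
  have "[0..<d] = [0..<m] @ [m..<d]" using assms(1) upt_add_eq_append[of 0 m "d - m"] by simp
  then have "mixed_deriv d s f = foldr (\<lambda>i. partial_deriv i ^^ s i) [0..<m] (foldr (\<lambda>i. partial_deriv i ^^ s i) [m..<d] f)"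
    unfolding mixed_deriv_def by simp
  also have "\<dots> = foldr (\<lambda>i. partial_deriv i ^^ s i) [m..<d] f"
    by (rule foldr_eq_id) (auto simp: assms(2))
  finally show ?thesis .
qed

text \<open>\<open>foldr\<close> differentiates in the last variable first. While \<open>s\<close>
  vanishes below \<open>m\<close>, the outermost derivative is thus one in variable
  \<open>m\<close>, the order in which \<open>mixed_smooth\<close> unfolds.\<close>

lemma mixed_deriv_Suc:
  assumes "m < d" "\<And>j. j < m \<Longrightarrow> s j = 0"
  shows "mixed_deriv d (s(m := Suc i)) f = partial_deriv m (mixed_deriv d (s(m := i)) f)"
proof -
  have u: "[m..<d] = m # [Suc m..<d]" using assms(1) by (rule upt_conv_Cons)
  have "foldr (\<lambda>i. partial_deriv i ^^ (s(m := k)) i) [Suc m..<d] f = foldr (\<lambda>i. partial_deriv i ^^ s i) [Suc m..<d] f" for k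
    by (intro foldr_cong) auto
  then show ?thesis
    using assms by (simp add: mixed_deriv_tail[of m d] u)
qed

lemma W_space_mixed_smooth_aux:
  assumes f: "f \<in> W_space p d"
  shows "m \<le> d \<Longrightarrow> s \<in> multi_indices p d \<Longrightarrow> (\<And>j. j < m \<Longrightarrow> s j = 0) \<Longrightarrow>
    mixed_smooth d p m (\<lambda>y. complex_of_real (mixed_deriv d s f y)) (W_norm p d f)"
proof (induction m arbitrary: s)
  case 0
  then show ?case
    using f mixed_deriv_le_W_norm[OF f, of s] unfolding W_space_def
    by (auto intro!: continuous_on_of_real)
next
  case (Suc m)
  define s' where "s' i = s(m := i)" for i
  let ?g = "\<lambda>i y. complex_of_real (mixed_deriv d (s' i) f y)"
  have s': "s' i \<in> multi_indices p d" if "i \<le> p" for i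
    using Suc.prems(1,2) that unfolding s'_def multi_indices_def by (auto simp: PiE_iff extensional_def)
  have "s' 0 = s" using Suc.prems(3)[of m] unfolding s'_def by auto
  moreover have "mixed_smooth d p m (?g i) (W_norm p d f)" if "i \<le> p" for i
    using Suc.prems that by (intro Suc.IH s') (auto simp: s'_def)
  moreover have "has_pd d m (?g i) (?g (Suc i))" if i: "i < p" for i
    unfolding has_pd_def
  proof
    fix y assume y: "y \<in> cube d"
    have "(\<lambda>t. mixed_deriv d (s' i) f (y(m := t))) differentiable (at (y m) within {-1..1})"
      using f s'[of i] i Suc.prems y unfolding W_space_def s'_def by auto
    then have "((\<lambda>t. mixed_deriv d (s' i) f (y(m := t))) has_vector_derivative mixed_deriv d (s' (Suc i)) f y)
        (at (y m) within {-1..1})"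
      using mixed_deriv_Suc[of m d s i f] Suc.prems
      by (simp add: vector_derivative_works s'_def partial_deriv_def)
    then show "((\<lambda>t. ?g i (y(m := t))) has_vector_derivative ?g (Suc i) y) (at (y m) within {-1..1})"
      by (intro has_vector_derivative_of_real) (simp add: has_real_derivative_iff_has_vector_derivative)
  qed
  ultimately show ?case by (auto intro!: exI[of _ ?g])
qed

lemma W_space_mixed_smooth:
  assumes f: "f \<in> W_space p d"
  shows "mixed_smooth d p d (\<lambda>y. complex_of_real (f y)) (W_norm p d f)"
proof -
  define s :: "nat \<Rightarrow> nat" where "s = (\<lambda>j\<in>{..<d}. 0)"
  have "mixed_deriv d s f = f"
    using mixed_deriv_tail[of d d s f] by (simp add: s_def)
  moreover have "s \<in> multi_indices p d" unfolding s_def multi_indices_def by auto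
  ultimately show ?thesis
    using W_space_mixed_smooth_aux[OF f, of d s] by (simp add: s_def)
qed

section \<open>Fubini's theorem on the cube\<close>

lemma product_sigma_finite_lborel: "product_sigma_finite (\<lambda>_::nat. lborel :: real measure)"
  by standard

lemma Icc_integral_lborel:
  fixes u :: "real \<Rightarrow> complex"
  assumes "continuous_on {-1..1} u"
  shows "integrable lborel (\<lambda>t. indicator {-1..1} t *\<^sub>R u t)"
    and "(LINT t|lborel. indicator {-1..1} t *\<^sub>R u t) = integral {-1..1} u"
proof -
  have "set_integrable lborel {-1..1} u" by (rule borel_integrable_atLeastAtMost'[OF assms])
  then show "integrable lborel (\<lambda>t. indicator {-1..1} t *\<^sub>R u t)"
    "(LINT t|lborel. indicator {-1..1} t *\<^sub>R u t) = integral {-1..1} u"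
    using set_borel_integral_eq_integral(2) unfolding set_integrable_def set_lebesgue_integral_def by auto
qed

text \<open>Links the product sigma-algebra over \<open>{..<d}\<close> with the Borel sets of the
  full function space, where continuity lives; coordinates from \<open>d\<close> on are
  constant.\<close>

lemma measurable_id_PiM_borel:
  "(\<lambda>y. y) \<in> borel_measurable (\<Pi>\<^sub>M j\<in>{..<d::nat}. (lborel :: real measure))"
proof (rule measurable_coordinatewise_then_product)
  fix i
  show "(\<lambda>y. y i) \<in> borel_measurable (\<Pi>\<^sub>M j\<in>{..<d}. (lborel :: real measure))"
  proof (cases "i < d")
    case True
    then show ?thesis using measurable_component_singleton[of i "{..<d}" "\<lambda>_. lborel"] by simp
  next
    case False
    then have "y i = undefined" if "y \<in> space (\<Pi>\<^sub>M j\<in>{..<d}. (lborel :: real measure))" for y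
      using that by (auto simp: space_PiM PiE_iff extensional_def)
    then show ?thesis by (subst measurable_cong[where g = "\<lambda>_. undefined"]) auto
  qed
qed

lemma cube_indicator:
  assumes "y \<in> extensional {..<d}"
  shows "indicator (cube d) y = (\<Prod>j<d. indicator {-1..1} (y j) :: real)"
proof (cases "y \<in> cube d")
  case True
  then show ?thesis using cube_component by simp
next
  case False
  then obtain j where "j < d" "y j \<notin> {-1..1}" using assms unfolding cube_def by (auto simp: PiE_iff)
  then have "(\<Prod>j<d. indicator {-1..1} (y j) :: real) = 0" by (intro prod_zero bexI[of _ j]) auto
  then show ?thesis using False by simp
qed

lemma integrable_cube:
  fixes F :: "(nat \<Rightarrow> real) \<Rightarrow> complex"
  assumes "continuous_on (cube d) F"
  shows "integrable (\<Pi>\<^sub>M j\<in>{..<d}. lborel) (\<lambda>y. indicator (cube d) y *\<^sub>R F y)"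
proof -
  interpret product_sigma_finite "\<lambda>_::nat. lborel :: real measure" by (rule product_sigma_finite_lborel)
  obtain K where K: "\<And>y. y \<in> cube d \<Longrightarrow> cmod (F y) \<le> K"
    using compact_imp_bounded[OF compact_continuous_image[OF assms compact_cube]]
    unfolding bounded_iff by auto
  have "integrable lborel (indicator {-1..1} :: real \<Rightarrow> real)"
    by (simp add: integrable_indicator_iff)
  then have "integrable (\<Pi>\<^sub>M j\<in>{..<d}. lborel) (\<lambda>y::nat \<Rightarrow> real. K * (\<Prod>j<d. indicator {-1..1} (y j) :: real))"
    using product_integrable_prod[of "{..<d}" "\<lambda>_. indicator {-1..1} :: real \<Rightarrow> real"]
    by (intro integrable_mult_right) auto
  then show ?thesis
  proof (rule Bochner_Integration.integrable_bound)
    have "cube d \<in> sets borel" using compact_cube by (rule borel_compact)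
    then have "(\<lambda>y. indicator (cube d) y *\<^sub>R F y) \<in> borel_measurable borel"
      using assms by (rule borel_measurable_continuous_on_indicator)
    from measurable_compose[OF measurable_id_PiM_borel this]
    show "(\<lambda>y. indicator (cube d) y *\<^sub>R F y) \<in> borel_measurable (\<Pi>\<^sub>M j\<in>{..<d}. lborel)" .
    show "AE y in \<Pi>\<^sub>M j\<in>{..<d}. lborel. norm (indicator (cube d) y *\<^sub>R F y)
        \<le> norm (K * (\<Prod>j<d. indicator {-1..1} (y j) :: real))"
    proof (rule AE_I2)
      fix y :: "nat \<Rightarrow> real" assume "y \<in> space (\<Pi>\<^sub>M j\<in>{..<d}. lborel)"
      then have "y \<in> extensional {..<d}" by (auto simp: space_PiM PiE_iff)
      from cube_indicator[OF this] K[of y]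
      show "norm (indicator (cube d) y *\<^sub>R F y) \<le> norm (K * (\<Prod>j<d. indicator {-1..1} (y j) :: real))"
        by (cases "y \<in> cube d") (auto intro: order_trans[OF _ abs_ge_self])
    qed
  qed
qed

text \<open>Freezing a parameter coordinate commutes with the functional. In the Fubini step the
  last coordinate is frozen before the induction hypothesis is used.\<close>

lemma tensor_functional_upd:
  "tensor_functional X w e m (\<lambda>y. F (y(j := t))) z = tensor_functional X w e m F (z(j := t))" if "j \<ge> m"
  using that
proof (induction m arbitrary: z)
  case (Suc m)
  then have "z(m := x, j := t) = z(j := t, m := x)" for x by (intro fun_upd_twist) auto
  moreover have "tensor_functional X w e m (\<lambda>y. F (y(j := t))) z = tensor_functional X w e m F (z(j := t))" for z
    using Suc.prems by (intro Suc.IH) auto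
  ultimately show ?case by (simp only: tensor_functional.simps)
qed simp

lemma tensor_functional_continuous:
  assumes "m \<le> d" "X \<subseteq> {-1..1}" "\<And>j. continuous_on {-1..1} (e j)" "continuous_on (cube d) F"
  shows "continuous_on (cube d) (tensor_functional X w e m F)"
  using assms
proof (induction m)
  case (Suc m)
  then show ?case by (simp add: functional_continuous_on)
qed simp

text \<open>Fubini with the last coordinate outermost, matching the nesting of
  \<open>tensor_functional\<close>; continuity on the compact cube gives integrability.\<close>

lemma cube_integral_eq_tensor_functional:
  assumes e: "\<And>j. continuous_on {-1..1} (e j)" and X: "X \<subseteq> {-1..1}"
    and F: "continuous_on (cube d) F" and y0: "y0 \<in> cube d"
  shows "(LINT y|(\<Pi>\<^sub>M j\<in>{..<d}. lborel). indicator (cube d) y *\<^sub>R (F y * (\<Prod>j<d. e j (y j))))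
    = tensor_functional X (\<lambda>j x. 0) e d F y0"
  using F y0
proof (induction d arbitrary: F y0)
  case 0
  \<comment> \<open>The empty product measure is a unit mass at the one extensional function on no
    coordinates.\<close>
  have "(\<lambda>k. undefined) \<in> cube 0" "y0 = (\<lambda>k. undefined)" using 0 by (auto simp: cube_def)
  then show ?case by (simp add: PiM_empty lebesgue_integral_count_space_finite)
next
  case (Suc m)
  interpret product_sigma_finite "\<lambda>_::nat. lborel :: real measure" by (rule product_sigma_finite_lborel)
  let ?G = "\<lambda>y. indicator (cube (Suc m)) y *\<^sub>R (F y * (\<Prod>j<Suc m. e j (y j)))"
  let ?T = "\<lambda>t. tensor_functional X (\<lambda>j x. 0) e m F (y0(m := t))"
  let ?u = "\<lambda>t. e m t * ?T t"
  have ext: "y0(m := undefined) \<in> cube m" using Suc.prems(2) by (simp add: cube_iff)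
  have cG: "continuous_on (cube (Suc m)) (\<lambda>y. F y * (\<Prod>j<Suc m. e j (y j)))"
    by (intro continuous_on_mult Suc.prems(1) continuous_on_prod continuous_on_compose2[OF e]
        continuous_on_product_then_coordinatewise[OF continuous_on_id])
       (auto dest: cube_component)
  have un: "{m} \<union> {..<m} = {..<Suc m}" by auto
  have inner: "(LINT y|(\<Pi>\<^sub>M j\<in>{..<m}. lborel). ?G (y(m := t))) = indicator {-1..1} t *\<^sub>R ?u t" for t
  proof (cases "t \<in> {-1..1}")
    case True
    have sub: "y(m := t) \<in> cube (Suc m)" if "y \<in> cube m" for y
      using True that by (simp only: cube_Suc_upd_iff[OF cube_extensional[OF that]])
    have cF: "continuous_on (cube m) (\<lambda>y. F (y(m := t)))"
      using True by (intro continuous_on_compose2[OF Suc.prems(1)] continuous_on_fun_upd continuous_on_const continuous_on_id)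
        (use sub in blast)
    have "(LINT y|(\<Pi>\<^sub>M j\<in>{..<m}. lborel). ?G (y(m := t)))
       = (LINT y|(\<Pi>\<^sub>M j\<in>{..<m}. lborel). e m t * (indicator (cube m) y *\<^sub>R (F (y(m := t)) * (\<Prod>j<m. e j (y j)))))"
    proof (rule Bochner_Integration.integral_cong[OF refl])
      fix y :: "nat \<Rightarrow> real" assume "y \<in> space (\<Pi>\<^sub>M j\<in>{..<m}. lborel)"
      then have "y(m := t) \<in> cube (Suc m) \<longleftrightarrow> y \<in> cube m"
        using True cube_Suc_upd_iff[of y m t] by (simp add: space_PiM PiE_iff)
      then show "?G (y(m := t)) = e m t * (indicator (cube m) y *\<^sub>R (F (y(m := t)) * (\<Prod>j<m. e j (y j))))"
        by (simp add: indicator_def mult_ac)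
    qed
    also have "\<dots> = e m t * tensor_functional X (\<lambda>j x. 0) e m (\<lambda>y. F (y(m := t))) (y0(m := undefined))"
      by (simp only: integral_mult_right_zero Suc.IH[OF cF ext])
    also have "\<dots> = ?u t" by (simp only: tensor_functional_upd[OF order_refl] fun_upd_upd)
    finally show ?thesis using True by simp
  next
    case False
    then have "y(m := t) \<notin> cube (Suc m)" for y using cube_component[of "y(m := t)" "Suc m" m] by auto
    then show ?thesis using False by simp
  qed
  have cu: "continuous_on {-1..1} ?u"
    using Suc.prems X
    by (intro continuous_on_mult e continuous_on_slice[of "Suc m"] tensor_functional_continuous) auto
  have "(LINT y|(\<Pi>\<^sub>M j\<in>{..<Suc m}. lborel). ?G y) = (LINT y|(\<Pi>\<^sub>M j\<in>{m} \<union> {..<m}. lborel). ?G y)"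
    by (simp only: un)
  also have "\<dots> = (LINT x|(\<Pi>\<^sub>M j\<in>{m}. lborel). (LINT y|(\<Pi>\<^sub>M j\<in>{..<m}. lborel). ?G (merge {m} {..<m} (x, y))))"
    using integrable_cube[OF cG] by (intro product_integral_fold) (simp_all only: un, auto)
  also have "\<dots> = (LINT x|(\<Pi>\<^sub>M j\<in>{m}. lborel). indicator {-1..1} (x m) *\<^sub>R ?u (x m))"
  proof (rule Bochner_Integration.integral_cong[OF refl])
    fix x :: "nat \<Rightarrow> real"
    have "(LINT y|(\<Pi>\<^sub>M j\<in>{..<m}. lborel). ?G (merge {m} {..<m} (x, y)))
       = (LINT y|(\<Pi>\<^sub>M j\<in>{..<m}. lborel). ?G (y(m := x m)))"
    proof (rule Bochner_Integration.integral_cong[OF refl])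
      fix y :: "nat \<Rightarrow> real" assume "y \<in> space (\<Pi>\<^sub>M j\<in>{..<m}. lborel)"
      then have "merge {m} {..<m} (x, y) = y(m := x m)"
        by (auto simp: space_PiM PiE_iff extensional_def merge_def)
      then show "?G (merge {m} {..<m} (x, y)) = ?G (y(m := x m))" by simp
    qed
    then show "(LINT y|(\<Pi>\<^sub>M j\<in>{..<m}. lborel). ?G (merge {m} {..<m} (x, y))) = indicator {-1..1} (x m) *\<^sub>R ?u (x m)"
      unfolding inner .
  qed
  also have "\<dots> = (LINT t|lborel. indicator {-1..1} t *\<^sub>R ?u t)"
    using Icc_integral_lborel(1)[OF cu]
    by (intro product_integral_singleton[where f = "\<lambda>t. indicator {-1..1} t *\<^sub>R ?u t"]) auto
  also have "\<dots> = integral {-1..1} ?u" by (rule Icc_integral_lborel(2)[OF cu])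
  also have "\<dots> = tensor_functional X (\<lambda>j x. 0) e (Suc m) F y0" by (simp add: functional_def)
  finally show ?case .
qed

section \<open>The FCCS rule as a sum of tensor functionals\<close>

text \<open>Extended by zero to points off the grid, so that two adjacent levels can be summed over
  a common set.\<close>

definition cardinal_function :: "nat \<Rightarrow> real \<Rightarrow> real \<Rightarrow> complex" where
  "cardinal_function l x t =
     (if l \<ge> 1 \<and> x \<in> grid l then complex_of_real (poly (lagrange_basis (grid l) x) t) else 0)"

definition hier_function :: "nat \<Rightarrow> real \<Rightarrow> real \<Rightarrow> complex" where
  "hier_function l x t = cardinal_function l x t - cardinal_function (l - 1) x t"

lemma continuous_on_cardinal_function: "continuous_on A (cardinal_function l x)"
  unfolding cardinal_function_def by (cases "l \<ge> 1 \<and> x \<in> grid l") (auto intro!: continuous_intros)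

lemma continuous_on_hier_function: "continuous_on A (hier_function l x)"
  unfolding hier_function_def by (intro continuous_intros continuous_on_cardinal_function)

lemma Q1_eq_sum:
  assumes "finite X" "l \<ge> 1 \<Longrightarrow> grid l \<subseteq> X"
  shows "Q1 l g t = (\<Sum>x\<in>X. cardinal_function l x t * g x)"
proof (cases "l \<ge> 1")
  case True
  then have "(\<Sum>x\<in>X. cardinal_function l x t * g x) = (\<Sum>x\<in>grid l. cardinal_function l x t * g x)"
    using assms by (intro sum.mono_neutral_right) (auto simp: cardinal_function_def)
  then show ?thesis using True by (simp add: Q1_eq_lagrange cardinal_function_def mult.commute)
qed (simp add: cardinal_function_def Q1_def)

lemma D1_eq_sum:
  assumes "finite X" "l \<ge> 1 \<Longrightarrow> grid l \<subseteq> X" "l \<ge> 2 \<Longrightarrow> grid (l - 1) \<subseteq> X"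
  shows "D1 l g t = (\<Sum>x\<in>X. hier_function l x t * g x)"
  unfolding D1_def hier_function_def left_diff_distrib sum_subtractf
  using assms by (subst (1 2) Q1_eq_sum[where X = X]) auto

lemma sum_PiE_Suc:
  fixes H :: "(nat \<Rightarrow> 'a) \<Rightarrow> 'b::comm_monoid_add"
  assumes "finite X"
  shows "(\<Sum>z\<in>{..<Suc m} \<rightarrow>\<^sub>E X. H z) = (\<Sum>z\<in>{..<m} \<rightarrow>\<^sub>E X. \<Sum>x\<in>X. H (z(m := x)))"
proof -
  have "(\<Sum>z\<in>{..<m} \<rightarrow>\<^sub>E X. \<Sum>x\<in>X. H (z(m := x))) = (\<Sum>(x, z)\<in>X \<times> ({..<m} \<rightarrow>\<^sub>E X). H (z(m := x)))"
    by (subst sum.swap) (rule sum.cartesian_product)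
  also have "\<dots> = (\<Sum>z\<in>(\<lambda>(x, z). z(m := x)) ` (X \<times> ({..<m} \<rightarrow>\<^sub>E X)). H z)"
    by (subst sum.reindex[OF inj_combinator]) (auto simp: case_prod_unfold)
  also have "(\<lambda>(x, z). z(m := x)) ` (X \<times> ({..<m} \<rightarrow>\<^sub>E X)) = {..<Suc m} \<rightarrow>\<^sub>E X"
    unfolding lessThan_Suc PiE_insert_eq ..
  finally show ?thesis ..
qed

lemma override_on_upd:
  "override_on (y(m := x)) z {..<m} = override_on y (z(m := x)) {..<Suc m}"
  by (auto simp: override_on_def less_Suc_eq)

text \<open>Separates the variables: \<open>y\<close> enters through products of one-variable
  functions, \<open>g\<close> only through nodal values. \<open>override_on\<close> keeps the
  coordinates not yet interpolated.\<close>

lemma tensor_D_eq_sum: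
  assumes X: "finite X" and l: "\<And>j. j < m \<Longrightarrow> l j \<ge> 1 \<Longrightarrow> grid (l j) \<subseteq> X"
    "\<And>j. j < m \<Longrightarrow> l j \<ge> 2 \<Longrightarrow> grid (l j - 1) \<subseteq> X"
  shows "tensor_D m l g y
    = (\<Sum>z\<in>{..<m} \<rightarrow>\<^sub>E X. (\<Prod>j<m. hier_function (l j) (z j) (y j)) * g (override_on y z {..<m}))"
  using l
proof (induction m arbitrary: g)
  case 0
  then show ?case by (simp add: tensor_D_def)
next
  case (Suc m)
  have "in_variable m (D1 (l m)) g (override_on y z {..<m})
     = (\<Sum>x\<in>X. hier_function (l m) x (y m) * g (override_on y (z(m := x)) {..<Suc m}))" for z
  proof -
    have "(override_on y z {..<m})(m := x) = override_on y (z(m := x)) {..<Suc m}" for x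
      by (auto simp: override_on_def less_Suc_eq)
    then show ?thesis
      unfolding in_variable_def using Suc.prems by (simp add: D1_eq_sum[OF X])
  qed
  moreover have "tensor_D (Suc m) l g y = tensor_D m l (in_variable m (D1 (l m)) g) y"
    by (simp add: tensor_D_def)
  moreover have "(\<Prod>j<m. hier_function (l j) ((z(m := x)) j) (y j)) = (\<Prod>j<m. hier_function (l j) (z j) (y j))" for z x
    by (intro prod.cong) auto
  ultimately show ?case
    using Suc by (simp add: sum_PiE_Suc[OF X] sum_distrib_left mult.assoc)
qed

lemma tensor_functional_eq_sum:
  assumes X: "finite X"
  shows "tensor_functional X w (\<lambda>j t. 0) m f y
    = (\<Sum>z\<in>{..<m} \<rightarrow>\<^sub>E X. (\<Prod>j<m. w j (z j)) * f (override_on y z {..<m}))"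
proof (induction m arbitrary: y)
  case 0
  then show ?case by simp
next
  case (Suc m)
  have "(\<Prod>j<m. w j ((z(m := x)) j)) = (\<Prod>j<m. w j (z j))" for z x
    by (intro prod.cong) auto
  then show ?case
    unfolding tensor_functional.simps functional_def Suc sum_PiE_Suc[OF X] override_on_upd
    by (subst sum.swap) (simp add: sum_distrib_left mult_ac)
qed

lemma phase_eq_prod: "phase k d a y = (\<Prod>j<d. cis (k * a j * y j))"
proof -
  have "phase k d a y = exp (\<Sum>j<d. \<i> * complex_of_real (k * a j * y j))"
    unfolding phase_def by (simp add: sum_distrib_left mult.assoc)
  then show ?thesis by (simp add: exp_sum cis_conv_exp)
qed

context smolyak_quadrature
begin

lemma hier_weight_eq:
  "hier_weight l j x = integral {-1..1} (\<lambda>t. hier_function (l j) x t * cis (\<tau> j * t)) * cis (\<sigma> j * x)"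
proof -
  have q: "quad_weight (\<tau> j) (\<sigma> j) n x = integral {-1..1} (\<lambda>t. cardinal_function n x t * cis (\<tau> j * t)) * cis (\<sigma> j * x)" for n
    unfolding quad_weight_def cardinal_function_def by auto
  have "integral {-1..1} (\<lambda>t. hier_function (l j) x t * cis (\<tau> j * t))
     = integral {-1..1} (\<lambda>t. cardinal_function (l j) x t * cis (\<tau> j * t))
       - integral {-1..1} (\<lambda>t. cardinal_function (l j - 1) x t * cis (\<tau> j * t))"
    unfolding hier_function_def left_diff_distrib
    by (intro Henstock_Kurzweil_Integration.integral_diff integrable_continuous_real continuous_intros
        continuous_on_cardinal_function)
  then show ?thesis unfolding hier_weight_def q by (simp add: left_diff_distrib)
qed

text \<open>Both sides are expanded over the same tensor grid; integrating the product functions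
  factor by factor yields the weights of \<open>hier\<close>. Integrability is part of the claim
  because the terms are summed afterwards.\<close>

lemma has_bochner_integral_tensor_D:
  assumes l: "l \<in> bounded_levels d R" "R \<le> S" and y0: "y0 \<in> cube d"
  shows "has_bochner_integral (\<Pi>\<^sub>M j\<in>{..<d}. lborel)
    (\<lambda>y. indicator (cube d) y *\<^sub>R (tensor_D d l (\<lambda>y. F y * (\<Prod>j<d. cis (\<sigma> j * y j))) y * (\<Prod>j<d. cis (\<tau> j * y j))))
    (hier l d F y0)"
proof -
  interpret product_sigma_finite "\<lambda>_::nat. lborel :: real measure" by (rule product_sigma_finite_lborel)
  let ?M = "\<Pi>\<^sub>M j\<in>{..<d}. (lborel :: real measure)"
  let ?Z = "{..<d} \<rightarrow>\<^sub>E nodes"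
  let ?F = "\<lambda>y. F y * (\<Prod>j<d. cis (\<sigma> j * y j))"
  let ?u = "\<lambda>z j t. hier_function (l j) (z j) t * cis (\<tau> j * t)"
  \<comment> \<open>On extensional points all coordinates below \<open>d\<close> are replaced and
    the rest is \<open>undefined\<close>, so only the node remains.\<close>
  have over: "override_on y z {..<d} = z" if "y \<in> extensional {..<d}" "z \<in> ?Z" for y z
    using that by (auto simp: override_on_def PiE_iff extensional_def)
  have TD: "tensor_D d l ?F y = (\<Sum>z\<in>?Z. (\<Prod>j<d. hier_function (l j) (z j) (y j)) * ?F z)"
    if y: "y \<in> extensional {..<d}" for y
  proof -
    have "tensor_D d l ?F y = (\<Sum>z\<in>?Z. (\<Prod>j<d. hier_function (l j) (z j) (y j)) * ?F (override_on y z {..<d}))"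
      using bounded_levels_component[OF l(1)] l(2)
      by (intro tensor_D_eq_sum finite_nodes grid_nodes) (force intro: order_trans)+
    also have "\<dots> = (\<Sum>z\<in>?Z. (\<Prod>j<d. hier_function (l j) (z j) (y j)) * ?F z)"
      by (intro sum.cong refl) (simp only: over[OF y])
    finally show ?thesis .
  qed
  have cu: "continuous_on {-1..1} (?u z j)" for z j
    by (intro continuous_intros continuous_on_hier_function)
  have "has_bochner_integral ?M (\<lambda>y. \<Sum>z\<in>?Z. ?F z * (\<Prod>j<d. indicator {-1..1} (y j) *\<^sub>R ?u z j (y j)))
     (\<Sum>z\<in>?Z. ?F z * (\<Prod>j<d. integral {-1..1} (?u z j)))"
  proof (intro has_bochner_integral_sum has_bochner_integral_mult_right)
    fix z
    have "integrable ?M (\<lambda>y. \<Prod>j<d. indicator {-1..1} (y j) *\<^sub>R ?u z j (y j))"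
      by (rule product_integrable_prod) (auto intro: Icc_integral_lborel(1)[OF cu])
    moreover have "(LINT y|?M. (\<Prod>j<d. indicator {-1..1} (y j) *\<^sub>R ?u z j (y j))) = (\<Prod>j<d. integral {-1..1} (?u z j))"
      unfolding Icc_integral_lborel(2)[OF cu, symmetric]
      by (rule product_integral_prod) (auto intro: Icc_integral_lborel(1)[OF cu])
    ultimately show "has_bochner_integral ?M (\<lambda>y. \<Prod>j<d. indicator {-1..1} (y j) *\<^sub>R ?u z j (y j)) (\<Prod>j<d. integral {-1..1} (?u z j))"
      by (simp add: has_bochner_integral_iff)
  qed
  moreover have "(\<Sum>z\<in>?Z. ?F z * (\<Prod>j<d. integral {-1..1} (?u z j))) = hier l d F y0"
  proof -
    have "hier l d F y0 = (\<Sum>z\<in>?Z. (\<Prod>j<d. hier_weight l j (z j)) * F (override_on y0 z {..<d}))"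
      unfolding hier_def by (rule tensor_functional_eq_sum[OF finite_nodes])
    also have "\<dots> = (\<Sum>z\<in>?Z. ?F z * (\<Prod>j<d. integral {-1..1} (?u z j)))"
      by (intro sum.cong refl)
        (simp add: over[OF cube_extensional[OF y0]] hier_weight_eq prod.distrib mult_ac)
    finally show ?thesis ..
  qed
  moreover have "(\<Sum>z\<in>?Z. ?F z * (\<Prod>j<d. indicator {-1..1} (y j) *\<^sub>R ?u z j (y j)))
      = indicator (cube d) y *\<^sub>R (tensor_D d l ?F y * (\<Prod>j<d. cis (\<tau> j * y j)))" if "y \<in> space ?M" for y
  proof -
    have ext: "y \<in> extensional {..<d}" using that by (simp add: space_PiM PiE_iff)
    show ?thesis
      unfolding TD[OF ext] cube_indicator[OF ext]
      by (simp add: scaleR_conv_of_real prod.distrib sum_distrib_left sum_distrib_right mult_ac)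
  qed
  ultimately show ?thesis
    by (subst has_bochner_integral_cong[OF refl _ refl, symmetric]) auto
qed

end

subsection \<open>The size of the sparse grid\<close>

lemma card_grid_le: "l \<ge> 1 \<Longrightarrow> card (grid l) \<le> 2 ^ l"
proof (cases "l = 1")
  case False
  assume "l \<ge> 1"
  have "(2::nat) ^ l = 2 ^ (l - 1) + 2 ^ (l - 1)" using \<open>l \<ge> 1\<close> by (cases l) auto
  then show ?thesis using card_grid[OF False] unfolding n_lev_def by simp
qed (use card_grid_1 in simp)

lemma levels_eq_bounded_levels: "levels r d = bounded_levels d (r + d - 1)"
  unfolding levels_def bounded_levels_def ..

lemma finite_sparse_grid: "finite (sparse_grid r d)"
  unfolding sparse_grid_def levels_eq_bounded_levels
  by (intro finite_UN_I finite_bounded_levels finite_PiE finite_grid) auto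

text \<open>A union bound with at most \<open>2 ^ |l|\<close> points per tensor grid. Summing the
  last level as a geometric series costs only a factor 2, so just \<open>d - 1\<close> levels have
  to be counted, whence the exponent \<open>d - 1\<close>.\<close>

lemma num_points_upper:
  assumes d: "d \<ge> 1"
  shows "num_points r d \<le> 2 * 2 ^ (r + d - 1) * (r + d - 1) ^ (d - 1)"
proof -
  obtain m where m: "d = Suc m" using d by (cases d) auto
  define R where "R = r + d - 1"
  have "num_points r d \<le> (\<Sum>l\<in>bounded_levels d R. card (\<Pi>\<^sub>E j\<in>{..<d}. grid (l j)))"
    unfolding num_points_def sparse_grid_def levels_eq_bounded_levels R_def
    by (rule card_UN_le) (rule finite_bounded_levels)
  also have "\<dots> \<le> (\<Sum>l\<in>bounded_levels d R. 2 ^ (\<Sum>j<d. l j))"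
  proof (rule sum_mono)
    fix l assume l: "l \<in> bounded_levels d R"
    have "card (\<Pi>\<^sub>E j\<in>{..<d}. grid (l j)) = (\<Prod>j<d. card (grid (l j)))" by (simp add: card_PiE)
    also have "\<dots> \<le> (\<Prod>j<d. 2 ^ l j)"
      using bounded_levels_component[OF l] by (intro prod_mono conjI card_grid_le) auto
    finally show "card (\<Pi>\<^sub>E j\<in>{..<d}. grid (l j)) \<le> 2 ^ (\<Sum>j<d. l j)" by (simp add: power_sum)
  qed
  also have "\<dots> = (\<Sum>l\<in>bounded_levels m (R - 1). \<Sum>q\<in>{1..R - (\<Sum>j<m. l j)}. 2 ^ (\<Sum>j<d. (l(m := q)) j))"
    unfolding m by (rule sum_bounded_levels_Suc)
  also have "\<dots> \<le> (\<Sum>l\<in>bounded_levels m (R - 1). 2 * 2 ^ R)"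
  proof (rule sum_mono)
    fix l assume l: "l \<in> bounded_levels m (R - 1)"
    let ?s = "\<Sum>j<m. l j"
    have g: "(\<Sum>q\<in>{1..n}. 2 ^ q) \<le> (2 * 2 ^ n :: nat)" for n
      by (induction n) auto
    have "(\<Sum>j<d. (l(m := q)) j) = ?s + q" for q
    proof -
      have "(\<Sum>j<m. (l(m := q)) j) = ?s" by (intro sum.cong) auto
      then show ?thesis unfolding m by simp
    qed
    then have "(\<Sum>q\<in>{1..R - ?s}. 2 ^ (\<Sum>j<d. (l(m := q)) j)) = (2::nat) ^ ?s * (\<Sum>q\<in>{1..R - ?s}. 2 ^ q)"
      by (simp add: power_add sum_distrib_left)
    also have "\<dots> \<le> 2 ^ ?s * (2 * 2 ^ (R - ?s))" by (intro mult_left_mono g) auto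
    also have "\<dots> = 2 * 2 ^ R" using bounded_levels_sum[OF l] by (simp add: power_add[symmetric])
    finally show "(\<Sum>q\<in>{1..R - ?s}. 2 ^ (\<Sum>j<d. (l(m := q)) j)) \<le> (2 * 2 ^ R :: nat)" .
  qed
  also have "\<dots> = card (bounded_levels m (R - 1)) * (2 * 2 ^ R)" by simp
  also have "\<dots> \<le> R ^ m * (2 * 2 ^ R)"
  proof -
    have "card (bounded_levels m (R - 1)) \<le> (R - 1) ^ m" by (rule card_bounded_levels)
    also have "\<dots> \<le> R ^ m" by (intro power_mono) auto
    finally show ?thesis by (intro mult_right_mono) auto
  qed
  finally show ?thesis unfolding R_def m by (simp add: mult_ac)
qed

text \<open>The index (r, 1, ..., 1) alone suffices, since level 1 grids are single points.\<close>

lemma num_points_lower: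
  assumes d: "d \<ge> 1" and r: "r \<ge> 2"
  shows "num_points r d \<ge> 2 ^ (r - 1)"
proof -
  define l where "l = (\<lambda>j\<in>{..<d}. if j = 0 then r else 1 :: nat)"
  have "(\<Sum>j<d. l j) = (\<Sum>j<d. if j = 0 then r else 1)" unfolding l_def by (intro sum.cong) auto
  also have "\<dots> = r + (d - 1)"
  proof -
    have "{..<d} = insert 0 {1..<d}" using d by auto
    then show ?thesis by simp
  qed
  finally have "l \<in> levels r d" unfolding levels_def l_def using d r by auto
  then have "(\<Pi>\<^sub>E j\<in>{..<d}. grid (l j)) \<subseteq> sparse_grid r d" unfolding sparse_grid_def by blast
  then have "card (\<Pi>\<^sub>E j\<in>{..<d}. grid (l j)) \<le> num_points r d"
    unfolding num_points_def by (intro card_mono finite_sparse_grid)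
  moreover have "card (\<Pi>\<^sub>E j\<in>{..<d}. grid (l j)) = card (grid r)"
  proof -
    have "card (\<Pi>\<^sub>E j\<in>{..<d}. grid (l j)) = (\<Prod>j<d. card (grid (l j)))" by (simp add: card_PiE)
    also have "\<dots> = (\<Prod>j<d. if j = 0 then card (grid r) else 1)"
      unfolding l_def using card_grid_1 by (intro prod.cong) auto
    finally show ?thesis using d by simp
  qed
  ultimately show ?thesis using card_grid[of r] r unfolding n_lev_def by simp
qed

section \<open>From levels to numbers of points\<close>

lemma prod_freq_factor:
  assumes "k > 0"
  shows "(\<Prod>j<d. freq_factor (k * a_tilde k a j)) = inverse (\<Prod>j\<in>{j\<in>{..<d}. k * \<bar>a j\<bar> \<ge> 1}. k * \<bar>a j\<bar>)"
proof -
  have "(\<Prod>j<d. freq_factor (k * a_tilde k a j)) = (\<Prod>j<d. if k * \<bar>a j\<bar> \<ge> 1 then inverse (k * \<bar>a j\<bar>) else 1)"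
    using assms by (intro prod.cong refl)
      (auto simp: freq_factor_def a_tilde_def abs_mult inverse_eq_divide)
  also have "\<dots> = (\<Prod>j\<in>{j\<in>{..<d}. k * \<bar>a j\<bar> \<ge> 1}. inverse (k * \<bar>a j\<bar>))"
    by (rule prod.inter_filter[symmetric]) simp
  also have "\<dots> = inverse (\<Prod>j\<in>{j\<in>{..<d}. k * \<bar>a j\<bar> \<ge> 1}. k * \<bar>a j\<bar>)"
    using prod_inversef[of "\<lambda>j. k * \<bar>a j\<bar>"] by (simp only: o_def)
  finally show ?thesis .
qed

text \<open>The constant of \<open>smolyak_error_bound\<close> written outside the locale, where it
  visibly depends on \<open>d\<close> and \<open>p\<close> only.\<close>

definition smolyak_const :: "nat \<Rightarrow> nat \<Rightarrow> real" where
  "smolyak_const d p = real d * ((1 + 2 ^ (p - 1)) * error_const p * 2 ^ (p - 1)) ^ d * (2 ^ (p - 1)) ^ d"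

lemma fccs_error_bound_levels:
  assumes p: "p \<ge> 1" and d: "d \<ge> 1" and k: "k > 0" and r: "r \<ge> 1" and f: "f \<in> W_space p d"
  shows "cmod (osc_integral k d a (\<lambda>y. complex_of_real (f y)) - fccs_rule k d a r f)
    \<le> smolyak_const d p * real (r + d - 1) ^ (d - 1)
       * inverse (\<Prod>j\<in>{j\<in>{..<d}. k * \<bar>a j\<bar> \<ge> 1}. k * \<bar>a j\<bar>)
       * decay p ^ (r + d - 1) * W_norm p d f"
proof -
  define R where "R = r + d - 1"
  define \<tau> where "\<tau> j = k * a_tilde k a j" for j
  define \<sigma> where "\<sigma> j = k * a_hat k a j" for j
  \<comment> \<open>The cap \<open>S\<close> is the full level sum \<open>r + d - 1\<close>; the sum
    of the two frequencies in each variable is \<open>k * a j\<close>, so the waves multiply to the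
    original phase.\<close>
  interpret smolyak_quadrature d p R \<tau> \<sigma>
  proof
    show "\<bar>\<sigma> j\<bar> \<le> 1" for j
      using k by (auto simp: \<sigma>_def a_hat_def a_tilde_def abs_mult)
    show "\<bar>\<tau> j\<bar> \<ge> 1 \<or> \<tau> j = 0" for j
      using k by (auto simp: \<tau>_def a_tilde_def abs_mult)
  qed (use p d r in \<open>auto simp: R_def\<close>)
  let ?f = "\<lambda>y. complex_of_real (f y)"
  let ?M = "\<Pi>\<^sub>M j\<in>{..<d}. (lborel :: real measure)"
  obtain y0 where y0: "y0 \<in> cube d" using cube_nonempty by blast
  have smooth: "mixed_smooth d p d ?f (W_norm p d f)" by (rule W_space_mixed_smooth[OF f])
  then have cf: "continuous_on (cube d) ?f" using mixed_smooth_0 by blast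
  have "\<tau> j + \<sigma> j = k * a j" for j
    by (simp add: \<tau>_def \<sigma>_def a_hat_def algebra_simps)
  then have "phase k d a y = (\<Prod>j<d. wave j (y j))" for y
    by (simp add: phase_eq_prod wave_def)
  then have exact: "osc_integral k d a ?f = exact d ?f y0"
    unfolding osc_integral_def set_lebesgue_integral_def exact_def
    using cube_integral_eq_tensor_functional[OF continuous_wave nodes_subset cf y0] by simp
  have fh: "f_hat k d a f = (\<lambda>y. ?f y * (\<Prod>j<d. cis (\<sigma> j * y j)))"
    by (intro ext) (simp add: f_hat_def phase_eq_prod \<sigma>_def)
  have "has_bochner_integral ?M
      (\<lambda>y. \<Sum>l\<in>bounded_levels d R. indicator (cube d) y *\<^sub>R (tensor_D d l (f_hat k d a f) y * (\<Prod>j<d. cis (\<tau> j * y j))))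
      (\<Sum>l\<in>bounded_levels d R. hier l d ?f y0)"
    unfolding fh by (intro has_bochner_integral_sum has_bochner_integral_tensor_D y0) auto
  moreover have "(\<lambda>y. \<Sum>l\<in>bounded_levels d R. indicator (cube d) y *\<^sub>R (tensor_D d l (f_hat k d a f) y * (\<Prod>j<d. cis (\<tau> j * y j))))
     = (\<lambda>y. indicator (cube d) y *\<^sub>R (smolyak r d (f_hat k d a f) y * phase k d (a_tilde k a) y))"
    by (intro ext) (simp add: smolyak_def levels_eq_bounded_levels R_def phase_eq_prod \<tau>_def
        scaleR_sum_right sum_distrib_right)
  ultimately have "fccs_rule k d a r f = (\<Sum>l\<in>bounded_levels d R. hier l d ?f y0)"
    unfolding fccs_rule_def osc_integral_def set_lebesgue_integral_def
    by (simp add: has_bochner_integral_iff)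
  then have "cmod (osc_integral k d a ?f - fccs_rule k d a r f)
    \<le> real d * C ^ d * real R ^ (d - 1) * (\<Prod>j<d. freq_factor (\<tau> j)) * decay p ^ R * (2 ^ (p - 1)) ^ d * W_norm p d f"
    using smolyak_error_bound[OF order_refl smooth y0] exact by simp
  also have "\<dots> = smolyak_const d p * real R ^ (d - 1) * (\<Prod>j<d. freq_factor (\<tau> j)) * decay p ^ R * W_norm p d f"
    unfolding smolyak_const_def C_def by (simp only: mult_ac)
  finally show ?thesis unfolding \<tau>_def R_def prod_freq_factor[OF k] .
qed

text \<open>Combines r \<le> 2 (r - 1) with r + d - 1 \<le> r d. For \<open>r = 1\<close> the grid
  is a single point and its logarithm is 0, which is why the theorem takes 2 as the
  threshold.\<close>

lemma level_le_ln_num_points: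
  assumes d: "d \<ge> 1" and r: "r \<ge> 2"
  shows "real (r + d - 1) \<le> 2 * real d / ln 2 * ln (real (num_points r d))"
proof -
  have "real (2 ^ (r - 1)) \<le> real (num_points r d)"
    using num_points_lower[OF d r] by (rule of_nat_mono)
  then have "ln (2 ^ (r - 1)) \<le> ln (real (num_points r d))"
    by (intro ln_mono) auto
  then have "real (r - 1) * ln 2 \<le> ln (real (num_points r d))"
    by (simp add: ln_realpow)
  moreover have "real r / 2 * ln 2 \<le> real (r - 1) * ln 2"
    using r by (intro mult_right_mono) auto
  ultimately have "real r * ln 2 \<le> 2 * ln (real (num_points r d))" by linarith
  then have "real d * (real r * ln 2) \<le> real d * (2 * ln (real (num_points r d)))"
    by (intro mult_left_mono) auto
  moreover have "real (r + d - 1) \<le> real d * real r"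
  proof -
    have "(real r - 1) * (real d - 1) \<ge> 0" using d r by (intro mult_nonneg_nonneg) auto
    then show ?thesis using d by (simp add: algebra_simps of_nat_diff)
  qed
  then have "real (r + d - 1) * ln 2 \<le> real d * real r * ln 2" by (intro mult_right_mono) auto
  ultimately have "real (r + d - 1) * ln 2 \<le> 2 * real d * ln (real (num_points r d))"
    by (simp only: mult.assoc mult.left_commute[of 2])
  then show ?thesis by (simp add: field_simps)
qed

text \<open>The upper bound on N reads 2^(-R) \<le> 2 L / N with L = R^(d-1). Its power p - 1, times
  the \<open>L\<close> already present, gives L^p.\<close>

lemma decay_le_num_points:
  assumes d: "d \<ge> 1" and r: "r \<ge> 2" and p: "p \<ge> 1"
  shows "real (r + d - 1) ^ (d - 1) * decay p ^ (r + d - 1)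
    \<le> 2 ^ (p - 1) * (real (r + d - 1) ^ (d - 1)) ^ p * (1 / real (num_points r d)) ^ (p - 1)"
proof -
  define R where "R = r + d - 1"
  define L where "L = real R ^ (d - 1)"
  have N: "real (num_points r d) > 0"
    using order.strict_trans2[OF _ num_points_lower[OF d r], of 0] by simp
  have "real (num_points r d) \<le> real (2 * 2 ^ R * R ^ (d - 1))"
    using num_points_upper[OF d, of r] unfolding R_def by (rule of_nat_mono)
  then have "real (num_points r d) \<le> 2 * 2 ^ R * L" by (simp add: L_def)
  then have "(1 / 2) ^ R \<le> 2 * L * (1 / real (num_points r d))"
    using N by (simp add: power_one_over field_simps)
  then have "((1 / 2) ^ R) ^ (p - 1) \<le> (2 * L * (1 / real (num_points r d))) ^ (p - 1)"
    by (intro power_mono) auto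
  moreover have "decay p ^ R = ((1 / 2) ^ R) ^ (p - 1)"
    unfolding decay_def by (simp only: power_mult[symmetric] mult.commute)
  ultimately have "L * decay p ^ R \<le> L * ((2 * L * (1 / real (num_points r d))) ^ (p - 1))"
    unfolding L_def by (intro mult_left_mono) auto
  also have "\<dots> = 2 ^ (p - 1) * (L * L ^ (p - 1)) * (1 / real (num_points r d)) ^ (p - 1)"
    by (simp only: power_mult_distrib mult_ac)
  also have "L * L ^ (p - 1) = L ^ p" using p by (cases p) auto
  finally show ?thesis unfolding L_def R_def .
qed

theorem theorem1p2:
  fixes p d :: nat
  assumes "p \<ge> 1" and "d \<ge> 1"
  shows "\<exists>C>0. \<exists>r0\<ge>1. \<forall>(a :: nat \<Rightarrow> real) (k :: real) (r :: nat) f.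
    k > 0 \<longrightarrow> r \<ge> r0 \<longrightarrow> f \<in> W_space p d \<longrightarrow>
      cmod (osc_integral k d a (\<lambda>y. complex_of_real (f y)) - fccs_rule k d a r f)
        \<le> C * inverse (\<Prod>j\<in>{j\<in>{..<d}. k * \<bar>a j\<bar> \<ge> 1}. k * \<bar>a j\<bar>)
            * (ln (real (num_points r d)) ^ (d - 1)) ^ p
            * (1 / real (num_points r d)) ^ (p - 1)
            * W_norm p d f"
proof -
  \<comment> \<open>The ratio bounding \<open>r + d - 1\<close> by the logarithm; it enters
    \<open>C\<close> once for each of the \<open>(d - 1) * p\<close> factors.\<close>
  define \<kappa> where "\<kappa> = 2 * real d / ln 2"
  define C where "C = smolyak_const d p * 2 ^ (p - 1) * (\<kappa> ^ (d - 1)) ^ p"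
  have sc: "smolyak_const d p > 0"
    unfolding smolyak_const_def using error_const_ge_1[of p] assms(2)
    by (intro mult_pos_pos zero_less_power) (auto intro: add_pos_pos)
  have \<kappa>: "\<kappa> > 0" unfolding \<kappa>_def using assms(2) by simp
  show ?thesis
  proof (intro exI[of _ C] exI[of _ 2] conjI allI impI)
    show "C > 0" unfolding C_def using sc \<kappa> by simp
    fix a :: "nat \<Rightarrow> real" and k :: real and r :: nat and f
    assume k: "k > 0" and r: "r \<ge> 2" and f: "f \<in> W_space p d"
    define I where "I = inverse (\<Prod>j\<in>{j\<in>{..<d}. k * \<bar>a j\<bar> \<ge> 1}. k * \<bar>a j\<bar>)"
    define L where "L = real (r + d - 1) ^ (d - 1)"
    define n where "n = (1 / real (num_points r d)) ^ (p - 1)"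
    define M where "M = W_norm p d f"
    have I: "I \<ge> 0" unfolding I_def using k by (intro iffD2[OF inverse_nonnegative_iff_nonnegative] prod_nonneg) auto
    have M: "M \<ge> 0" unfolding M_def by (rule mixed_smooth_nonneg[OF W_space_mixed_smooth[OF f]])
    have n: "n \<ge> 0" unfolding n_def by simp
    have Lln: "L ^ p \<le> (\<kappa> ^ (d - 1)) ^ p * (ln (real (num_points r d)) ^ (d - 1)) ^ p"
      using level_le_ln_num_points[OF assms(2) r]
      unfolding L_def \<kappa>_def power_mult_distrib[symmetric] by (intro power_mono) auto
    have "cmod (osc_integral k d a (\<lambda>y. complex_of_real (f y)) - fccs_rule k d a r f)
      \<le> smolyak_const d p * I * M * (L * decay p ^ (r + d - 1))"
      using fccs_error_bound_levels[OF assms k _ f, of r a] r unfolding I_def L_def M_def by (simp add: mult_ac)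
    also have "\<dots> \<le> smolyak_const d p * I * M * (2 ^ (p - 1) * L ^ p * n)"
      using decay_le_num_points[OF assms(2) r assms(1)] I M sc unfolding L_def n_def
      by (intro mult_left_mono mult_nonneg_nonneg) auto
    also have "\<dots> \<le> smolyak_const d p * I * M * (2 ^ (p - 1) * ((\<kappa> ^ (d - 1)) ^ p * (ln (real (num_points r d)) ^ (d - 1)) ^ p) * n)"
      using Lln I M sc n by (intro mult_left_mono mult_right_mono mult_nonneg_nonneg) auto
    also have "\<dots> = C * I * (ln (real (num_points r d)) ^ (d - 1)) ^ p * n * M"
      unfolding C_def by (simp only: mult_ac)
    finally show "cmod (osc_integral k d a (\<lambda>y. complex_of_real (f y)) - fccs_rule k d a r f)
        \<le> C * inverse (\<Prod>j\<in>{j\<in>{..<d}. k * \<bar>a j\<bar> \<ge> 1}. k * \<bar>a j\<bar>)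
            * (ln (real (num_points r d)) ^ (d - 1)) ^ p
            * (1 / real (num_points r d)) ^ (p - 1)
            * W_norm p d f"
      unfolding I_def n_def M_def .
  qed simp
qed

end
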